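(* Let $N\ge2$, $0<g_1<\cdots<g_N$, $d\ge2$, let $\Omega\subset\mathbb R^d$ be a bounded domain of class $C^2$, let $0<T\le\infty$, and let $z\in C([0,T);C^1(\overline\Omega;\mathbb R^{N-1}))$ take values in $\mathcal Z=\prod_{j=1}^{N-1}(g_j,g_{j+1})$. Assume that there is a fixed $p>d+2$ such that, for every $0<\tau<T'<T$, $$z\in W^{1,p}(\tau,T';L^p(\Omega))\cap L^p(\tau,T';W^{2,p}(\Omega)),$$ that on that strip the root system $$\partial_tz_j-\operatorname{div}\Bigl(\frac{\nabla z_j}{\lambda_j}\Bigr)+\sum_{k\ne j}\frac{\lambda_j+\lambda_k}{\lambda_j\lambda_k(\lambda_j-\lambda_k)}\nabla z_j\cdot\nabla z_k=0,\quad j=1,\dots,N-1,$$ holds distributionally, and that $\partial_\nu z_j=0$ on $\partial\Omega$ in the Sobolev trace sense. Assume that $$a_j\le z_j(0,x)\le b_j,\qquad x\in\overline\Omega,\ j=1,\dots,N-1,\qquad\text{where } g_j<a_j\le b_j<g_{j+1}.$$ Then $$a_j\le z_j(t,x)\le b_j,\qquad (t,x)\in[0,T)\times\overline\Omega,\ j=1,\dots,N-1.$$ Moreover, with $\underline z_j(t):=\min_{\overline\Omega}z_j(t,\cdot)$ and $\overline z_j(t):=\max_{\overline\Omega}z_j(t,\cdot)$, one has for $0\le t_1\le t_2<T$ $$g_j<\underline z_j(t_1)\le\underline z_j(t_2)\le\overline z_j(t_2)\le\overline z_j(t_1)<g_{j+1}.$$ In particular each oscillation $\overline z_j(t)-\underline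 z_j(t)$ is nonincreasing. Consequently $y(t,x)=y(z(t,x))$ remains in a compact subset of the open simplex $\{y\in(0,1)^N:\sum_iy_i=1\}$.
   Context: For $z\in\mathcal Z$: $\lambda_j=\lambda_j(z)=\sum_{i=1}^Ng_i-\sum_{\ell\ne j}z_\ell>0$, so $\lambda_j-\lambda_k=z_j-z_k$. The composition associated with $z\in\mathcal Z$ is $y_i(z)=\prod_{j=1}^{N-1}(g_i-z_j)\big/\prod_{m\ne i}(g_i-g_m)$, $i=1,\dots,N$; this is a diffeomorphism of $\mathcal Z$ onto the open simplex, and $\lambda_j=z_j+\sum_ig_iy_i(z)$. *)

theory Defs
  imports "HOL-Analysis.Analysis"
begin

section \<open>Differentiable functions and domains of class C2\<close>

definition grad :: "('a::euclidean_space \<Rightarrow> real) \<Rightarrow> 'a \<Rightarrow> 'a" where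
  "grad f x = (THE D. GDERIV f x :> D)"

text \<open>k times continuously differentiable on an open set.\<close>

primrec Ck_on :: "nat \<Rightarrow> 'a::euclidean_space set \<Rightarrow> ('a \<Rightarrow> real) \<Rightarrow> bool" where
  "Ck_on 0 S f \<longleftrightarrow> continuous_on S f"
| "Ck_on (Suc k) S f \<longleftrightarrow>
     (\<forall>x\<in>S. f differentiable (at x)) \<and> (\<forall>b\<in>Basis. Ck_on k S (\<lambda>x. grad f x \<bullet> b))"

definition test_fun :: "'a::euclidean_space set \<Rightarrow> ('a \<Rightarrow> real) \<Rightarrow> bool" where
  "test_fun S \<phi> \<longleftrightarrow> (\<forall>k. Ck_on k UNIV \<phi>) \<and>
     compact (closure {x. \<phi> x \<noteq> 0}) \<and> closure {x. \<phi> x \<noteq> 0} \<subseteq> S"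

text \<open>C1 up to the boundary: the function and its gradient extend continuously to the closure.
  Only the values of \<open>u\<close> on the closure of \<open>S\<close> matter.\<close>

definition C1_closure :: "'a::euclidean_space set \<Rightarrow> ('a \<Rightarrow> real) \<Rightarrow> bool" where
  "C1_closure S u \<longleftrightarrow> continuous_on (closure S) u \<and>
     (\<exists>G. continuous_on (closure S) G \<and> (\<forall>x\<in>S. GDERIV u x :> G x))"

definition C1_norm :: "'a::euclidean_space set \<Rightarrow> ('a \<Rightarrow> real) \<Rightarrow> real" where
  "C1_norm S u = (SUP x\<in>closure S. \<bar>u x\<bar>) + (SUP x\<in>S. norm (grad u x))"

definition C_time_C1 :: "real set \<Rightarrow> 'a::euclidean_space set \<Rightarrow> (real \<Rightarrow> 'a \<Rightarrow> real) \<Rightarrow> bool" where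
  "C_time_C1 I S u \<longleftrightarrow> (\<forall>t\<in>I. C1_closure S (u t)) \<and>
     (\<forall>s\<in>I. ((\<lambda>t. C1_norm S (\<lambda>x. u t x - u s x)) \<longlongrightarrow> 0) (at s within I))"

text \<open>Near \<open>x0\<close>, in Cartesian coordinates whose last axis points in the direction \<open>e\<close>, the set is
  the part above the graph of a C2 function of the other coordinates.  The point
  \<open>x - (x \<bullet> e) *\<^sub>R e\<close> is the projection onto the hyperplane orthogonal to \<open>e\<close>; only the values of
  \<open>\<gamma>\<close> on that hyperplane matter.\<close>

definition C2_graph_chart ::
    "'a::euclidean_space set \<Rightarrow> 'a \<Rightarrow> real \<Rightarrow> 'a \<Rightarrow> ('a \<Rightarrow> real) \<Rightarrow> bool" where
  "C2_graph_chart S x0 r e \<gamma> \<longleftrightarrow> r > 0 \<and> norm e = 1 \<and> Ck_on 2 UNIV \<gamma> \<and>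
     S \<inter> ball x0 r = {x \<in> ball x0 r. x \<bullet> e > \<gamma> (x - (x \<bullet> e) *\<^sub>R e)}"

definition C2_domain :: "'a::euclidean_space set \<Rightarrow> bool" where
  "C2_domain S \<longleftrightarrow> open S \<and> connected S \<and> S \<noteq> {} \<and>
     (\<forall>x0\<in>frontier S. \<exists>r e \<gamma>. C2_graph_chart S x0 r e \<gamma>)"

text \<open>In a chart, \<open>S\<close> is the sublevel set of \<open>\<gamma> (x - (x \<bullet> e) *\<^sub>R e) - x \<bullet> e\<close>, whose gradient does not
  vanish and points outwards.\<close>

definition outer_unit_normal :: "'a::euclidean_space set \<Rightarrow> 'a \<Rightarrow> 'a \<Rightarrow> bool" where
  "outer_unit_normal S x0 \<nu> \<longleftrightarrow> x0 \<in> frontier S \<and>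
     (\<exists>r e \<gamma>. C2_graph_chart S x0 r e \<gamma> \<and>
        \<nu> = sgn (grad (\<lambda>x. \<gamma> (x - (x \<bullet> e) *\<^sub>R e) - x \<bullet> e) x0))"


section \<open>Surface measure\<close>

definition hausdorff_pre :: "nat \<Rightarrow> real \<Rightarrow> 'a::metric_space set \<Rightarrow> ennreal" where
  "hausdorff_pre s \<delta> A =
     (INF C\<in>{C :: nat \<Rightarrow> 'a set. A \<subseteq> (\<Union>n. C n) \<and> (\<forall>n. bounded (C n) \<and> diameter (C n) \<le> \<delta>)}.
        \<Sum>n. ennreal (unit_ball_vol (real s) * (diameter (C n) / 2) ^ s))"

definition hausdorff_outer :: "nat \<Rightarrow> 'a::metric_space set \<Rightarrow> ennreal" where
  "hausdorff_outer s A = (SUP \<delta>\<in>{0<..}. hausdorff_pre s \<delta> A)"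

text \<open>Meant for \<open>s > 0\<close>; that \<open>measure_of\<close> indeed yields the Hausdorff outer measure on all Borel
  sets is \<open>emeasure_hausdorff_measure\<close> at the end of this theory.\<close>

definition hausdorff_measure :: "nat \<Rightarrow> 'a::metric_space measure" where
  "hausdorff_measure s = measure_of UNIV (sets borel) (hausdorff_outer s)"

definition surface_measure :: "'a::euclidean_space set \<Rightarrow> 'a measure" where
  "surface_measure S = restrict_space (hausdorff_measure (DIM('a) - 1)) (frontier S)"


section \<open>Sobolev spaces and traces\<close>

definition Lp :: "real \<Rightarrow> 'a::euclidean_space set \<Rightarrow> ('a \<Rightarrow> real) \<Rightarrow> bool" where
  "Lp p S u \<longleftrightarrow> u \<in> borel_measurable (lebesgue_on S) \<and>
     integrable (lebesgue_on S) (\<lambda>x. \<bar>u x\<bar> powr p)"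

definition weak_deriv :: "'a::euclidean_space set \<Rightarrow> 'a \<Rightarrow> ('a \<Rightarrow> real) \<Rightarrow> ('a \<Rightarrow> real) \<Rightarrow> bool" where
  "weak_deriv S b u v \<longleftrightarrow> (\<forall>\<phi>. test_fun S \<phi> \<longrightarrow>
     (LINT x|lebesgue_on S. u x * (grad \<phi> x \<bullet> b)) = - (LINT x|lebesgue_on S. v x * \<phi> x))"

primrec sobolev :: "nat \<Rightarrow> real \<Rightarrow> 'a::euclidean_space set \<Rightarrow> ('a \<Rightarrow> real) \<Rightarrow> bool" where
  "sobolev 0 p S u \<longleftrightarrow> Lp p S u"
| "sobolev (Suc k) p S u \<longleftrightarrow> Lp p S u \<and>
     (\<forall>b\<in>Basis. \<exists>v. weak_deriv S b u v \<and> sobolev k p S v)"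

definition Lp_conv :: "real \<Rightarrow> 'a measure \<Rightarrow> (nat \<Rightarrow> 'a \<Rightarrow> real) \<Rightarrow> ('a \<Rightarrow> real) \<Rightarrow> bool" where
  "Lp_conv p M v u \<longleftrightarrow> (\<lambda>n. \<integral>\<^sup>+x. ennreal (\<bar>v n x - u x\<bar> powr p) \<partial>M) \<longlonglongrightarrow> 0"

text \<open>The trace operator is the bounded extension to \<open>W\<^sup>1\<^sup>,\<^sup>p\<close> of the restriction to the boundary of
  functions that are C1 up to the boundary: \<open>h\<close> is the trace of \<open>u\<close> if such functions converge to
  \<open>u\<close> in \<open>W\<^sup>1\<^sup>,\<^sup>p\<close> while their boundary values converge to \<open>h\<close> in \<open>L\<^sup>p\<close> of the boundary.\<close>

definition sobolev_trace ::
    "real \<Rightarrow> 'a::euclidean_space set \<Rightarrow> ('a \<Rightarrow> real) \<Rightarrow> ('a \<Rightarrow> real) \<Rightarrow> bool" where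
  "sobolev_trace p S u h \<longleftrightarrow>
     sobolev 1 p S u \<and>
     h \<in> borel_measurable (surface_measure S) \<and>
     integrable (surface_measure S) (\<lambda>x. \<bar>h x\<bar> powr p) \<and>
     (\<exists>v :: nat \<Rightarrow> 'a \<Rightarrow> real.
        (\<forall>n. C1_closure S (v n)) \<and>
        Lp_conv p (lebesgue_on S) v u \<and>
        (\<forall>b\<in>Basis. \<exists>w. weak_deriv S b u w \<and> Lp p S w \<and>
            Lp_conv p (lebesgue_on S) (\<lambda>n x. grad (v n) x \<bullet> b) w) \<and>
        Lp_conv p (surface_measure S) v h)"

text \<open>The trace of the weak gradient (taken componentwise) has vanishing normal component.\<close>

definition normal_deriv_zero :: "real \<Rightarrow> 'a::euclidean_space set \<Rightarrow> ('a \<Rightarrow> real) \<Rightarrow> bool" where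
  "normal_deriv_zero p S u \<longleftrightarrow>
     (\<exists>h :: 'a \<Rightarrow> 'a.
        (\<forall>b\<in>Basis. \<exists>w. weak_deriv S b u w \<and> sobolev_trace p S w (\<lambda>x. h x \<bullet> b)) \<and>
        (AE x in surface_measure S. \<forall>\<nu>. outer_unit_normal S x \<nu> \<longrightarrow> h x \<bullet> \<nu> = 0))"

text \<open>The Bochner space \<open>L\<^sup>p(I; L\<^sup>p(S))\<close> is identified with \<open>L\<^sup>p(I \<times> S)\<close>.  Accordingly, an element of
  \<open>L\<^sup>p(I; W\<^sup>k\<^sup>,\<^sup>p(S))\<close> is an \<open>L\<^sup>p(I \<times> S)\<close> function whose time slices have weak spatial derivatives
  up to order \<open>k\<close> which together form \<open>L\<^sup>p(I \<times> S)\<close> functions.\<close>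

primrec Lp_time_sobolev ::
    "nat \<Rightarrow> real \<Rightarrow> real set \<Rightarrow> 'a::euclidean_space set \<Rightarrow> (real \<Rightarrow> 'a \<Rightarrow> real) \<Rightarrow> bool" where
  "Lp_time_sobolev 0 p I S u \<longleftrightarrow> Lp p (I \<times> S) (\<lambda>(t, x). u t x)"
| "Lp_time_sobolev (Suc k) p I S u \<longleftrightarrow> Lp p (I \<times> S) (\<lambda>(t, x). u t x) \<and>
     (\<forall>b\<in>Basis. \<exists>v. (AE t in lebesgue_on I. weak_deriv S b (u t) (v t)) \<and>
                     Lp_time_sobolev k p I S v)"

text \<open>\<open>W\<^sup>1\<^sup>,\<^sup>p(I; L\<^sup>p(S))\<close>: the identity defining the weak time derivative \<open>w\<close> is an identity between
  Bochner integrals in \<open>L\<^sup>p(S)\<close>, that is, it holds for almost every \<open>x\<close>.\<close>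

definition W1p_time_Lp ::
    "real \<Rightarrow> real set \<Rightarrow> 'a::euclidean_space set \<Rightarrow> (real \<Rightarrow> 'a \<Rightarrow> real) \<Rightarrow> bool" where
  "W1p_time_Lp p I S u \<longleftrightarrow> Lp p (I \<times> S) (\<lambda>(t, x). u t x) \<and>
     (\<exists>w. Lp p (I \<times> S) (\<lambda>(t, x). w t x) \<and>
        (\<forall>\<psi>. test_fun I \<psi> \<longrightarrow> (AE x in lebesgue_on S.
           (LINT t|lebesgue_on I. u t x * deriv \<psi> t) = - (LINT t|lebesgue_on I. w t x * \<psi> t))))"


section \<open>The root system\<close>

text \<open>A point of \<open>\<real>\<^sup>N\<^sup>-\<^sup>1\<close> or \<open>\<real>\<^sup>N\<close> is a function on \<open>nat\<close>, of which only the values at the indices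
  \<open>1, \<dots>, N - 1\<close> or \<open>1, \<dots>, N\<close> matter.\<close>

definition root_region :: "nat \<Rightarrow> (nat \<Rightarrow> real) \<Rightarrow> (nat \<Rightarrow> real) set" where
  "root_region N g = {z. \<forall>j\<in>{1..N-1}. g j < z j \<and> z j < g (j + 1)}"

definition lam :: "nat \<Rightarrow> (nat \<Rightarrow> real) \<Rightarrow> (nat \<Rightarrow> real) \<Rightarrow> nat \<Rightarrow> real" where
  "lam N g z j = (\<Sum>i\<in>{1..N}. g i) - (\<Sum>l\<in>{1..N-1} - {j}. z l)"

definition time_interval :: "ereal \<Rightarrow> real set" where
  "time_interval T = {t. 0 \<le> t \<and> ereal t < T}"

text \<open>The \<open>j\<close>-th equation on \<open>I \<times> S\<close>, tested against smooth compactly supported functions.\<close>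

definition root_eq_distr ::
    "nat \<Rightarrow> (nat \<Rightarrow> real) \<Rightarrow> real set \<Rightarrow> 'a::euclidean_space set \<Rightarrow>
     (nat \<Rightarrow> real \<Rightarrow> 'a \<Rightarrow> real) \<Rightarrow> nat \<Rightarrow> bool" where
  "root_eq_distr N g I S z j \<longleftrightarrow>
     (\<forall>\<phi> :: real \<times> 'a \<Rightarrow> real. test_fun (I \<times> S) \<phi> \<longrightarrow>
        (LINT (t, x)|lebesgue_on (I \<times> S).
           (let \<Lambda> = lam N g (\<lambda>l. z l t x) in
              - z j t x * deriv (\<lambda>s. \<phi> (s, x)) t
              + (1 / \<Lambda> j) * (grad (z j t) x \<bullet> grad (\<lambda>y. \<phi> (t, y)) x)
              + (\<Sum>k\<in>{1..N-1} - {j}.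
                   (\<Lambda> j + \<Lambda> k) / (\<Lambda> j * \<Lambda> k * (\<Lambda> j - \<Lambda> k)) * (grad (z j t) x \<bullet> grad (z k t) x))
                * \<phi> (t, x))) = 0)"

text \<open>Compositions are set to 0 outside \<open>{1..N}\<close>, so that the product topology on \<open>nat \<Rightarrow> real\<close>
  induces on them the topology of \<open>\<real>\<^sup>N\<close>.\<close>

definition composition :: "nat \<Rightarrow> (nat \<Rightarrow> real) \<Rightarrow> (nat \<Rightarrow> real) \<Rightarrow> nat \<Rightarrow> real" where
  "composition N g z i =
     (if i \<in> {1..N} then (\<Prod>j\<in>{1..N-1}. g i - z j) / (\<Prod>m\<in>{1..N} - {i}. g i - g m) else 0)"

definition open_simplex :: "nat \<Rightarrow> (nat \<Rightarrow> real) set" where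
  "open_simplex N = {y. (\<forall>i\<in>{1..N}. 0 < y i \<and> y i < 1) \<and> (\<forall>i. i \<notin> {1..N} \<longrightarrow> y i = 0) \<and>
     (\<Sum>i\<in>{1..N}. y i) = 1}"

text \<open>Minimum and maximum of a function on a set, in the literal sense of attained values.\<close>

definition min_on :: "'a set \<Rightarrow> ('a \<Rightarrow> real) \<Rightarrow> real" where
  "min_on K f = (LEAST v. v \<in> f ` K)"

definition max_on :: "'a set \<Rightarrow> ('a \<Rightarrow> real) \<Rightarrow> real" where
  "max_on K f = (GREATEST v. v \<in> f ` K)"


section \<open>The Hausdorff measure is a Borel measure\<close>


lemma hausdorff_pre_mono: "A \<subseteq> B \<Longrightarrow> hausdorff_pre s \<delta> A \<le> hausdorff_pre s \<delta> B"
  unfolding hausdorff_pre_def by (rule INF_superset_mono) auto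

lemma hausdorff_pre_antimono: "\<delta> \<le> \<delta>' \<Longrightarrow> hausdorff_pre s \<delta>' A \<le> hausdorff_pre s \<delta> A"
  unfolding hausdorff_pre_def by (rule INF_superset_mono) (auto intro: order_trans)

lemma hausdorff_pre_le:
  assumes "A \<subseteq> (\<Union>n. C n)" "\<And>n. bounded (C n)" "\<And>n. diameter (C n) \<le> \<delta>"
  shows "hausdorff_pre s \<delta> A \<le> (\<Sum>n. ennreal (unit_ball_vol (real s) * (diameter (C n) / 2) ^ s))"
  unfolding hausdorff_pre_def by (rule INF_lower) (use assms in auto)

lemma hausdorff_pre_empty:
  assumes "s > 0" "\<delta> > 0" shows "hausdorff_pre s \<delta> ({} :: 'a::metric_space set) = 0"
proof -
  have "hausdorff_pre s \<delta> ({} :: 'a set) \<le> (\<Sum>n. ennreal (unit_ball_vol (real s) * (diameter ({}::'a set) / 2) ^ s))"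
    by (rule hausdorff_pre_le[where C="\<lambda>_. {}"]) (use assms in auto)
  thus ?thesis using assms by (simp add: zero_power)
qed

lemma hausdorff_pre_UN:
  fixes A :: "nat \<Rightarrow> 'a::metric_space set"
  shows "hausdorff_pre s \<delta> (\<Union>i. A i) \<le> (\<Sum>i. hausdorff_pre s \<delta> (A i))"
proof (cases "\<forall>i. hausdorff_pre s \<delta> (A i) < top")
  case False
  then obtain i where "hausdorff_pre s \<delta> (A i) = top" using top.not_eq_extremum by blast
  hence "(\<Sum>i. hausdorff_pre s \<delta> (A i)) = top"
    using sum_le_suminf[of "\<lambda>i. hausdorff_pre s \<delta> (A i)" "{i}"] by (auto simp: top_unique)
  thus ?thesis by simp
next
  case True
  define w where "w C = ennreal (unit_ball_vol (real s) * (diameter C / 2) ^ s)" for C :: "'a set"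
  show ?thesis
  proof (rule ennreal_le_epsilon)
    fix e :: real assume e: "0 < e"
    have "\<exists>C. A i \<subseteq> (\<Union>n. C n) \<and> (\<forall>n. bounded (C n) \<and> diameter (C n) \<le> \<delta>) \<and>
        (\<Sum>n. w (C n)) \<le> hausdorff_pre s \<delta> (A i) + e * (1/2) ^ Suc i" for i
    proof -
      have "hausdorff_pre s \<delta> (A i) < hausdorff_pre s \<delta> (A i) + ennreal (e * (1/2) ^ Suc i)"
        using spec[OF True, of i] e
        by (cases "hausdorff_pre s \<delta> (A i)") (auto simp: ennreal_less_iff simp flip: ennreal_plus)
      then obtain C where "A i \<subseteq> (\<Union>n. C n)" "\<forall>n. bounded (C n) \<and> diameter (C n) \<le> \<delta>"
          "(\<Sum>n. w (C n)) < hausdorff_pre s \<delta> (A i) + ennreal (e * (1/2) ^ Suc i)"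
        by (subst (asm) (1) hausdorff_pre_def) (auto simp: INF_less_iff w_def)
      thus ?thesis by (intro exI[of _ C]) auto
    qed
    then obtain C where C: "\<And>i. A i \<subseteq> (\<Union>n. C i n)" "\<And>i n. bounded (C i n)"
        "\<And>i n. diameter (C i n) \<le> \<delta>"
        "\<And>i. (\<Sum>n. w (C i n)) \<le> hausdorff_pre s \<delta> (A i) + ennreal (e * (1/2) ^ Suc i)"
      by metis
    have "hausdorff_pre s \<delta> (\<Union>i. A i) \<le> (\<Sum>k. w (case_prod C (prod_decode k)))"
      unfolding w_def
    proof (rule hausdorff_pre_le)
      show "(\<Union>i. A i) \<subseteq> (\<Union>k. case_prod C (prod_decode k))"
      proof (clarify)
        fix x i assume "x \<in> A i"
        then obtain n where "x \<in> C i n" using C(1) by blast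
        thus "x \<in> (\<Union>k. case_prod C (prod_decode k))"
          by (intro UN_I[of "prod_encode (i,n)"]) auto
      qed
    qed (use C in \<open>auto split: prod.split\<close>)
    also have "\<dots> = (\<Sum>i. \<Sum>n. w (C i n))"
      using suminf_ennreal_2dimen[of "\<lambda>i. \<Sum>n. w (C i n)" "\<lambda>(i,n). w (C i n)"]
      by (simp add: case_prod_unfold)
    also have "\<dots> \<le> (\<Sum>i. hausdorff_pre s \<delta> (A i) + ennreal (e * (1/2) ^ Suc i))"
      by (intro suminf_le C) auto
    also have "\<dots> = (\<Sum>i. hausdorff_pre s \<delta> (A i)) + (\<Sum>i. ennreal (e * (1/2) ^ Suc i))"
      by (intro suminf_add[symmetric]) auto
    also have "(\<Sum>i. ennreal (e * (1/2) ^ Suc i)) = ennreal e"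
    proof (rule suminf_ennreal_eq)
      show "(\<lambda>i. e * (1/2) ^ Suc i) sums e"
        using sums_mult[OF power_half_series, of e] by simp
    qed (use e in auto)
    finally show "hausdorff_pre s \<delta> (\<Union>i. A i) \<le> (\<Sum>i. hausdorff_pre s \<delta> (A i)) + ennreal e" .
  qed
qed

lemma hausdorff_pre_le_outer: "\<delta> > 0 \<Longrightarrow> hausdorff_pre s \<delta> A \<le> hausdorff_outer s A"
  unfolding hausdorff_outer_def by (rule SUP_upper) auto

lemma hausdorff_outer_measure_space:
  assumes "s > 0"
  shows "outer_measure_space UNIV (hausdorff_outer s :: 'a::metric_space set \<Rightarrow> ennreal)"
  unfolding outer_measure_space_def
proof (intro conjI)
  show "positive UNIV (hausdorff_outer s :: 'a set \<Rightarrow> ennreal)"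
    using assms by (auto simp: positive_def hausdorff_outer_def hausdorff_pre_empty)
  show "increasing UNIV (hausdorff_outer s :: 'a set \<Rightarrow> ennreal)"
    unfolding hausdorff_outer_def by (auto simp: increasing_def intro!: SUP_mono hausdorff_pre_mono)
  show "countably_subadditive UNIV (hausdorff_outer s :: 'a set \<Rightarrow> ennreal)"
    unfolding countably_subadditive_def
  proof (intro allI impI)
    fix A :: "nat \<Rightarrow> 'a set"
    show "hausdorff_outer s (\<Union>i. A i) \<le> (\<Sum>i. hausdorff_outer s (A i))"
      unfolding hausdorff_outer_def[of s "\<Union>i. A i"]
    proof (rule SUP_least)
      fix \<delta> :: real assume "\<delta> \<in> {0<..}"
      hence "(\<Sum>i. hausdorff_pre s \<delta> (A i)) \<le> (\<Sum>i. hausdorff_outer s (A i))"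
        by (intro suminf_le hausdorff_pre_le_outer) auto
      thus "hausdorff_pre s \<delta> (\<Union>i. A i) \<le> (\<Sum>i. hausdorff_outer s (A i))"
        using hausdorff_pre_UN order_trans by blast
    qed
  qed
qed

lemma hausdorff_outer_eq_seq:
  "hausdorff_outer s A = (SUP n. hausdorff_pre s (1 / real (Suc n)) A)"
  unfolding hausdorff_outer_def
proof (rule SUP_eq)
  fix \<delta> :: real assume "\<delta> \<in> {0<..}"
  then obtain n where "1 / real (Suc n) < \<delta>" using nat_approx_posE by auto
  thus "\<exists>n\<in>UNIV. hausdorff_pre s \<delta> A \<le> hausdorff_pre s (1 / real (Suc n)) A"
    by (intro bexI[of _ n] hausdorff_pre_antimono) auto
qed auto

lemma hausdorff_outer_metric:
  fixes A B :: "'a::metric_space set"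
  assumes s: "s > 0" and r: "r > 0" and sep: "\<And>x y. x \<in> A \<Longrightarrow> y \<in> B \<Longrightarrow> r \<le> dist x y"
  shows "hausdorff_outer s A + hausdorff_outer s B \<le> hausdorff_outer s (A \<union> B)"
proof -
  define w where "w C = ennreal (unit_ball_vol (real s) * (diameter C / 2) ^ s)" for C :: "'a set"
  have w0: "w {} = 0" using s by (simp add: w_def)
  have pre: "hausdorff_pre s \<delta> A + hausdorff_pre s \<delta> B \<le> hausdorff_pre s \<delta> (A \<union> B)"
    if \<delta>: "0 < \<delta>" "\<delta> < r" for \<delta>
    unfolding hausdorff_pre_def[of s \<delta> "A \<union> B"]
  proof (rule INF_greatest)
    fix C :: "nat \<Rightarrow> 'a set"
    assume "C \<in> {C. A \<union> B \<subseteq> (\<Union>n. C n) \<and> (\<forall>n. bounded (C n) \<and> diameter (C n) \<le> \<delta>)}"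
    hence C: "A \<union> B \<subseteq> (\<Union>n. C n)" "\<And>n. bounded (C n)" "\<And>n. diameter (C n) \<le> \<delta>" by auto
    define CA where "CA n = (if C n \<inter> A = {} then {} else C n)" for n
    define CB where "CB n = (if C n \<inter> B = {} then {} else C n)" for n
    have "hausdorff_pre s \<delta> A \<le> (\<Sum>n. w (CA n))" unfolding w_def
      by (rule hausdorff_pre_le) (use C \<delta> in \<open>auto simp: CA_def split: if_splits\<close>, blast)
    moreover have "hausdorff_pre s \<delta> B \<le> (\<Sum>n. w (CB n))" unfolding w_def
      by (rule hausdorff_pre_le) (use C \<delta> in \<open>auto simp: CB_def split: if_splits\<close>, blast)
    ultimately have "hausdorff_pre s \<delta> A + hausdorff_pre s \<delta> B \<le> (\<Sum>n. w (CA n)) + (\<Sum>n. w (CB n))"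
      by (rule add_mono)
    also have "\<dots> = (\<Sum>n. w (CA n) + w (CB n))" by (intro suminf_add) auto
    also have "\<dots> \<le> (\<Sum>n. w (C n))"
    proof (intro suminf_le)
      fix n
      have "C n \<inter> A = {} \<or> C n \<inter> B = {}"
      proof (rule ccontr)
        assume "\<not> ?thesis"
        then obtain x y where xy: "x \<in> C n" "x \<in> A" "y \<in> C n" "y \<in> B" by blast
        hence "dist x y \<le> diameter (C n)" using C(2) by (intro diameter_bounded_bound) auto
        thus False using sep[of x y] xy C(3)[of n] \<delta> by linarith
      qed
      thus "w (CA n) + w (CB n) \<le> w (C n)" by (auto simp: CA_def CB_def w0)
    qed auto
    finally show "hausdorff_pre s \<delta> A + hausdorff_pre s \<delta> B \<le>
        (\<Sum>n. ennreal (unit_ball_vol (real s) * (diameter (C n) / 2) ^ s))" by (simp add: w_def)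
  qed
  have inc: "incseq (\<lambda>n. hausdorff_pre s (1 / real (Suc n)) X)" for X :: "'a set"
    by (intro incseq_SucI hausdorff_pre_antimono) (simp add: field_simps)
  obtain m where m: "1 / real (Suc m) < r" using nat_approx_posE[OF r] by auto
  have "hausdorff_outer s A + hausdorff_outer s B =
      (SUP n. hausdorff_pre s (1 / real (Suc n)) A + hausdorff_pre s (1 / real (Suc n)) B)"
    unfolding hausdorff_outer_eq_seq by (intro ennreal_SUP_add[symmetric] inc)
  also have "\<dots> \<le> hausdorff_outer s (A \<union> B)"
  proof (rule SUP_least)
    fix n
    define k where "k = max n m"
    have k: "1 / real (Suc k) \<le> 1 / real (Suc n)" "1 / real (Suc k) \<le> 1 / real (Suc m)"
      by (auto simp: k_def intro!: divide_left_mono)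
    have "hausdorff_pre s (1 / real (Suc n)) A + hausdorff_pre s (1 / real (Suc n)) B
        \<le> hausdorff_pre s (1 / real (Suc k)) A + hausdorff_pre s (1 / real (Suc k)) B"
      by (intro add_mono hausdorff_pre_antimono k)
    also have "\<dots> \<le> hausdorff_pre s (1 / real (Suc k)) (A \<union> B)"
      by (rule pre) (use k m in auto)
    also have "\<dots> \<le> hausdorff_outer s (A \<union> B)"
      by (rule hausdorff_pre_le_outer) auto
    finally show "hausdorff_pre s (1 / real (Suc n)) A + hausdorff_pre s (1 / real (Suc n)) B
        \<le> hausdorff_outer s (A \<union> B)" .
  qed
  finally show ?thesis .
qed

lemma outer_measure_space_UN:
  assumes "outer_measure_space UNIV f"
  shows "f (\<Union>i. X i) \<le> (\<Sum>i::nat. f (X i))"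
proof -
  have "f (\<Union>i. X i) \<le> (\<Sum>i. f (disjointed X i))"
    using assms disjoint_family_disjointed[of X] unfolding outer_measure_space_def
      countably_subadditive_def by (metis UN_disjointed_eq subset_UNIV UNIV_I)
  also have "\<dots> \<le> (\<Sum>i. f (X i))"
    using assms disjointed_subset[of X]
    by (intro suminf_le) (auto simp: outer_measure_space_def increasing_def)
  finally show ?thesis .
qed

text \<open>Caratheodory's criterion for metric outer measures.\<close>

lemma metric_outer_measure_closed:
  fixes f :: "'a::metric_space set \<Rightarrow> ennreal"
  assumes oms: "outer_measure_space UNIV f"
    and met: "\<And>A B r. r > 0 \<Longrightarrow> (\<And>x y. x \<in> A \<Longrightarrow> y \<in> B \<Longrightarrow> r \<le> dist x y) \<Longrightarrow> f A + f B \<le> f (A \<union> B)"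
    and F: "closed F" "F \<noteq> {}"
  shows "f (A \<inter> F) + f (A - F) \<le> f A"
proof (cases "f A = top")
  case False
  have f0: "f {} = 0" using oms by (auto simp: outer_measure_space_def positive_def)
  have mono: "f X \<le> f Y" if "X \<subseteq> Y" for X Y
    using oms that by (auto simp: outer_measure_space_def increasing_def)
  have csa: "f (\<Union>i. X i) \<le> (\<Sum>i. f (X i))" for X :: "nat \<Rightarrow> 'a set"
    by (rule outer_measure_space_UN[OF oms])
  have un2: "f (X \<union> Y) \<le> f X + f Y" for X Y
  proof -
    have "f (\<Union>i. binaryset X Y i) \<le> (\<Sum>i. f (binaryset X Y i))" by (rule csa)
    thus ?thesis using suminf_binaryset_eq[of f X Y] f0 by (simp add: UN_binaryset_eq)
  qed
  define B where "B k = {x \<in> A - F. 1 / real (Suc k) \<le> infdist x F}" for k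
  define R where "R k = B (Suc k) - B k" for k
  have B_mono: "B k \<subseteq> B l" if "k \<le> l" for k l
  proof -
    have "1 / real (Suc l) \<le> 1 / real (Suc k)" using that by (intro divide_left_mono) auto
    thus ?thesis by (auto simp: B_def)
  qed
  have dist_lower: "infdist x F - infdist y F \<le> dist x y" for x y
    using infdist_triangle[of x F y] by linarith
  have cover: "A - F = B k \<union> (\<Union>i. R (i + k))" for k
  proof (intro set_eqI iffI)
    fix x assume x: "x \<in> A - F"
    hence "infdist x F > 0"
      using F by (metis DiffD2 in_closed_iff_infdist_zero infdist_nonneg less_eq_real_def)
    then obtain n where n: "1 / real (Suc n) < infdist x F" using nat_approx_posE by blast
    hence ex: "x \<in> B n" using x by (auto simp: B_def)
    define m where "m = (LEAST m. x \<in> B m)"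
    have m: "x \<in> B m" unfolding m_def using ex by (rule LeastI)
    show "x \<in> B k \<union> (\<Union>i. R (i + k))"
    proof (cases "m \<le> k")
      case True thus ?thesis using m B_mono by blast
    next
      case False
      then obtain i where i: "m = Suc (i + k)" by (metis add.commute less_iff_Suc_add not_le)
      have "x \<notin> B (i + k)" using i not_less_Least[of "i + k" "\<lambda>m. x \<in> B m"] by (auto simp: m_def[symmetric])
      hence "x \<in> R (i + k)" using m i by (auto simp: R_def)
      thus ?thesis by blast
    qed
  qed (auto simp: B_def R_def)
  have R_sum: "(\<Sum>i<k. f (R (2 * i + c))) \<le> f (\<Union>i<k. R (2 * i + c))" for k c :: nat
  proof (induction k)
    case (Suc k)
    show ?case
    proof (cases "k = 0")
      case False
      have "(\<Sum>i<Suc k. f (R (2 * i + c))) \<le> f (\<Union>i<k. R (2 * i + c)) + f (R (2 * k + c))"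
        using Suc.IH by (simp add: add_right_mono)
      also have "\<dots> \<le> f ((\<Union>i<k. R (2 * i + c)) \<union> R (2 * k + c))"
      proof (rule met)
        show "0 < 1 / real (2 * k + c) - 1 / real (Suc (2 * k + c))"
          using False by (simp only: diff_gt_0_iff_gt, intro divide_strict_left_mono) auto
        fix x y assume xy: "x \<in> (\<Union>i<k. R (2 * i + c))" "y \<in> R (2 * k + c)"
        from xy(1) obtain i where i: "i < k" "x \<in> R (2 * i + c)" by blast
        have "1 / real (2 * k + c) \<le> 1 / real (Suc (Suc (2 * i + c)))"
          using i(1) by (intro divide_left_mono) auto
        also have "\<dots> \<le> infdist x F" using i(2) by (auto simp: R_def B_def)
        finally have 1: "1 / real (2 * k + c) \<le> infdist x F" .
        have 2: "infdist y F < 1 / real (Suc (2 * k + c))"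
          using xy(2) by (auto simp: R_def B_def)
        show "1 / real (2 * k + c) - 1 / real (Suc (2 * k + c)) \<le> dist x y"
          using 1 2 dist_lower[of x y] by linarith
      qed
      also have "(\<Union>i<k. R (2 * i + c)) \<union> R (2 * k + c) = (\<Union>i<Suc k. R (2 * i + c))"
        by (auto simp: lessThan_Suc)
      finally show ?thesis .
    qed (simp add: lessThan_Suc)
  qed (simp add: f0)
  have R_fin: "(\<Sum>i. f (R (2 * i + c))) \<le> f A" for c :: nat
  proof (rule suminf_le_const)
    fix k
    have "f (\<Union>i<k. R (2 * i + c)) \<le> f A" by (rule mono) (auto simp: R_def B_def)
    thus "(\<Sum>i<k. f (R (2 * i + c))) \<le> f A" using R_sum order_trans by blast
  qed auto
  define S where "S = (\<Sum>i. f (R i))"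
  have "S \<le> f A + f A" unfolding S_def
  proof (rule suminf_le_const)
    fix k
    have "(\<Sum>i<k. f (R i)) \<le> (\<Sum>i<2*k. f (R i))" by (intro sum_mono2) auto
    also have "\<dots> = (\<Sum>i<k. f (R (2 * i + 0))) + (\<Sum>i<k. f (R (2 * i + 1)))"
      by (induction k) (simp_all add: ac_simps)
    also have "\<dots> \<le> (\<Sum>i. f (R (2 * i + 0))) + (\<Sum>i. f (R (2 * i + 1)))"
      by (intro add_mono sum_le_suminf) auto
    also have "\<dots> \<le> f A + f A" by (intro add_mono R_fin)
    finally show "(\<Sum>i<k. f (R i)) \<le> f A + f A" .
  qed auto
  hence S_fin: "S \<noteq> top" using False by (auto simp: top_unique)
  define L where "L = (SUP k. f (B k))"
  have step: "f (A - F) + (\<Sum>i<k. f (R i)) \<le> L + S" for k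
  proof -
    have "f (A - F) \<le> f (B k) + f (\<Union>i. R (i + k))" by (subst cover[of k]) (rule un2)
    also have "\<dots> \<le> L + (\<Sum>i. f (R (i + k)))"
      unfolding L_def by (intro add_mono csa SUP_upper) auto
    finally have "f (A - F) + (\<Sum>i<k. f (R i)) \<le> L + ((\<Sum>i. f (R (i + k))) + (\<Sum>i<k. f (R i)))"
      by (simp add: add_right_mono flip: add.assoc)
    also have "(\<Sum>i. f (R (i + k))) + (\<Sum>i<k. f (R i)) = S"
      unfolding S_def by (subst suminf_offset[of _ k]) auto
    finally show ?thesis .
  qed
  have "f (A - F) + S = (SUP k. f (A - F) + (\<Sum>i<k. f (R i)))"
    unfolding S_def by (subst suminf_eq_SUP) (simp add: ennreal_SUP_add_right)
  also have "\<dots> \<le> L + S" by (rule SUP_least) (rule step)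
  finally have AF: "f (A - F) \<le> L" using S_fin by (simp add: add.commute[of _ S] ennreal_add_left_cancel_le)
  have "f (A \<inter> F) + f (A - F) \<le> f (A \<inter> F) + L" using AF by (rule add_left_mono)
  also have "\<dots> = (SUP k. f (A \<inter> F) + f (B k))" unfolding L_def by (simp add: ennreal_SUP_add_right)
  also have "\<dots> \<le> f A"
  proof (rule SUP_least)
    fix k
    have "f (A \<inter> F) + f (B k) \<le> f (A \<inter> F \<union> B k)"
    proof (rule met)
      show "0 < 1 / real (Suc k)" by simp
      fix x y assume "x \<in> A \<inter> F" "y \<in> B k"
      thus "1 / real (Suc k) \<le> dist x y"
        using dist_lower[of y x] by (auto simp: B_def dist_commute)
    qed
    also have "\<dots> \<le> f A" by (rule mono) (auto simp: B_def)
    finally show "f (A \<inter> F) + f (B k) \<le> f A" .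
  qed
  finally show ?thesis .
qed simp

lemma emeasure_hausdorff_measure:
  fixes A :: "'a::metric_space set"
  assumes "s > 0" "A \<in> sets borel"
  shows "emeasure (hausdorff_measure s) A = hausdorff_outer s A"
proof -
  let ?f = "hausdorff_outer s :: 'a set \<Rightarrow> ennreal"
  let ?L = "lambda_system UNIV UNIV ?f"
  interpret sigma_algebra "UNIV :: 'a set" UNIV using sigma_algebra_Pow[of "UNIV :: 'a set"] by simp
  have oms: "outer_measure_space UNIV ?f" by (rule hausdorff_outer_measure_space[OF assms(1)])
  hence f0: "?f {} = 0" by (simp add: outer_measure_space_def positive_def)
  have L: "measure_space UNIV ?L ?f" by (rule caratheodory_lemma[OF oms])
  hence saL: "sigma_algebra UNIV ?L" by (simp add: measure_space_def)
  have "Collect closed \<subseteq> ?L"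
  proof clarify
    fix F :: "'a set" assume F: "closed F"
    show "F \<in> ?L"
    proof (cases "F = {}")
      case True thus ?thesis using oms lambda_system_empty by (auto simp: outer_measure_space_def)
    next
      case False
      have "?f (X \<inter> F) + ?f (X - F) = ?f X" for X
      proof (rule antisym)
        show "?f (X \<inter> F) + ?f (X - F) \<le> ?f X"
          by (rule metric_outer_measure_closed[OF oms hausdorff_outer_metric[OF assms(1)] F False])
        have "?f (\<Union>i. binaryset (X \<inter> F) (X - F) i) \<le> (\<Sum>i. ?f (binaryset (X \<inter> F) (X - F) i))"
          by (rule outer_measure_space_UN[OF oms])
        thus "?f X \<le> ?f (X \<inter> F) + ?f (X - F)"
          unfolding suminf_binaryset_eq[of ?f, OF f0] by (simp add: UN_binaryset_eq Int_Diff_Un)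
      qed
      thus ?thesis by (simp add: lambda_system_eq)
    qed
  qed
  hence "sigma_sets UNIV (Collect closed) \<subseteq> ?L"
    by (rule sigma_algebra.sigma_sets_subset[OF saL])
  hence sub: "sets (borel :: 'a measure) \<subseteq> ?L" by (simp add: borel_eq_closed)
  have "sigma_algebra UNIV (sets (borel :: 'a measure))"
    using sets.sigma_algebra_axioms[of "borel :: 'a measure"] by simp
  hence "measure_space UNIV (sets (borel :: 'a measure)) ?f"
    using measure_down[OF L _ sub] by blast
  thus ?thesis unfolding hausdorff_measure_def
    by (intro emeasure_measure_of_sigma) (use assms in \<open>auto simp: measure_space_def\<close>)
qed


end

theory Submission
  imports Defs
begin

text \<open>
  Since the components of \<open>z\<close> are continuous in time with values in C1 up to the boundary, the energy
  \<open>\<integral> (z\<^sub>j - k)\<^sub>+\<^sup>3 / 3\<close> can be differentiated classically: the equation tested with a fixed \<open>\<psi>(x)\<close>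
  says that \<open>\<integral> z\<^sub>j \<psi>\<close> is a C1 function of time, and convexity of the cube compares increments of the
  energy with increments of \<open>\<integral> z\<^sub>j \<psi>\<close> for \<open>\<psi> = (z\<^sub>j - k)\<^sub>+\<^sup>2\<close> frozen at either end. The coupling terms
  are all multiples of \<open>\<nabla>z\<^sub>j\<close>, so they are absorbed by the diffusion and Gronwall's lemma gives the
  maximum principle from any initial time.

  Test functions must reach the boundary. The trace condition on \<open>\<partial>\<^sub>\<nu> z\<^sub>j\<close> is first turned into a
  pointwise one: along almost every line transversal to the boundary the approximating functions
  converge in W11, so the trace of the gradient is its continuous boundary value; this uses that
  the cylinder over a set of vanishing Hausdorff measure is a Lebesgue null set. Cutting off with
  a function of \<open>n\<close> times the chart function is then harmless, and no divergence theorem on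
  the domain is needed.
\<close>

section \<open>Smooth functions and mollification\<close>

text \<open>The third power is dictated by admissibility: a test function must be C1 up to the
  boundary. For \<open>z j t\<close> in C1 the square \<open>(max 0 (z j t - k))\<^sup>2\<close> has
  this property, the positive part itself does not, and the cube over three is its primitive.

  The coupling coefficients blow up where two roots meet, and no uniform distance from the boundary
  of the root region is known in advance. Continuity on a compact time slab gives bounds that depend
  on the solution. This suffices, because the energy starts at zero and the size of the constant in
  Gronwall's inequality is then irrelevant. Lower bounds are upper bounds for \<open>- z j\<close>,
  whose drift is again controlled by its own gradient. Monotonicity of the extrema is the same
  principle started at \<open>t1\<close>, with the extremum at \<open>t1\<close> as the
  level.\<close>

lemma grad_eq: "GDERIV f x :> D \<Longrightarrow> grad f x = D"
  unfolding grad_def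
proof (rule the_equality)
  fix D' assume "GDERIV f x :> D" "GDERIV f x :> D'"
  hence "(\<lambda>h. h \<bullet> D') = (\<lambda>h. h \<bullet> D)"
    unfolding gderiv_def by (rule has_derivative_unique[rotated])
  thus "D' = D" by (metis inner_eq_zero_iff inner_diff_right right_minus_eq)
qed

lemma differentiable_GDERIV:
  fixes f :: "'a::euclidean_space \<Rightarrow> real"
  assumes "f differentiable (at x)" shows "GDERIV f x :> grad f x"
proof -
  from assms obtain f' where f': "(f has_derivative f') (at x)" by (auto simp: differentiable_def)
  then interpret bounded_linear f' by (rule has_derivative_bounded_linear)
  have "f' = (\<lambda>h. h \<bullet> (\<Sum>b\<in>Basis. f' b *\<^sub>R b))"
  proof
    fix h
    have "f' h = f' (\<Sum>b\<in>Basis. (h \<bullet> b) *\<^sub>R b)" by (simp add: euclidean_representation)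
    thus "f' h = h \<bullet> (\<Sum>b\<in>Basis. f' b *\<^sub>R b)"
      by (simp add: sum scaleR inner_sum_right mult.commute)
  qed
  with f' have "GDERIV f x :> (\<Sum>b\<in>Basis. f' b *\<^sub>R b)" by (simp add: gderiv_def)
  thus ?thesis using grad_eq by metis
qed

lemma GDERIV_differentiable: "GDERIV f x :> D \<Longrightarrow> f differentiable (at x)"
  by (auto simp: gderiv_def differentiable_def)

lemma GDERIV_continuous: "GDERIV f x :> D \<Longrightarrow> isCont f x"
  unfolding gderiv_def by (rule has_derivative_continuous)

lemma GDERIV_transform_open:
  assumes "GDERIV f x :> D" "open U" "x \<in> U" "\<And>y. y \<in> U \<Longrightarrow> f y = h y"
  shows "GDERIV h x :> D"
  using assms has_derivative_transform_within_open unfolding gderiv_def by blast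

section \<open>Calculus of functions of class Ck\<close>

lemma Ck_on_SucI:
  assumes "\<And>x. GDERIV f x :> G x" "\<And>b. b \<in> Basis \<Longrightarrow> Ck_on k UNIV (\<lambda>x. G x \<bullet> b)"
  shows "Ck_on (Suc k) UNIV f"
proof -
  have "grad f = G" using grad_eq[OF assms(1)] by auto
  thus ?thesis using assms by (auto dest: GDERIV_differentiable)
qed

lemma Ck_on_Suc_iff:
  "Ck_on (Suc k) UNIV f \<longleftrightarrow> (\<forall>x. GDERIV f x :> grad f x) \<and> (\<forall>b\<in>Basis. Ck_on k UNIV (\<lambda>x. grad f x \<bullet> b))"
  unfolding Ck_on.simps using differentiable_GDERIV GDERIV_differentiable by blast

lemma Ck_on_Suc_imp: "Ck_on (Suc k) UNIV f \<Longrightarrow> Ck_on k UNIV f"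
proof (induction k arbitrary: f)
  case 0
  hence "\<forall>x. GDERIV f x :> grad f x" unfolding Ck_on_Suc_iff by simp
  thus ?case by (auto intro!: continuous_at_imp_continuous_on GDERIV_continuous)
next
  case (Suc k)
  have "\<forall>x. GDERIV f x :> grad f x" "\<forall>b\<in>Basis. Ck_on (Suc k) UNIV (\<lambda>x. grad f x \<bullet> b)"
    using Suc.prems Ck_on_Suc_iff[of "Suc k" f] by blast+
  thus ?case using Ck_on_Suc_iff[of k f] Suc.IH by blast
qed

lemma Ck_on_const: "Ck_on k UNIV (\<lambda>x. c)"
proof (induction k arbitrary: c)
  case (Suc k)
  show ?case by (rule Ck_on_SucI[where G="\<lambda>_. 0"]) (simp_all add: GDERIV_const Suc)
qed (simp)

lemma Ck_on_add: "Ck_on k UNIV f \<Longrightarrow> Ck_on k UNIV h \<Longrightarrow> Ck_on k UNIV (\<lambda>x. f x + h x)"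
proof (induction k arbitrary: f h)
  case (Suc k)
  show ?case
    by (rule Ck_on_SucI[where G="\<lambda>x. grad f x + grad h x"])
      (use Suc in \<open>auto simp: Ck_on_Suc_iff inner_add_left intro!: GDERIV_add Suc.IH simp del: Ck_on.simps\<close>)
qed (auto intro: continuous_intros)

lemma Ck_on_mult: "Ck_on k UNIV f \<Longrightarrow> Ck_on k UNIV h \<Longrightarrow> Ck_on k UNIV (\<lambda>x. f x * h x)"
proof (induction k arbitrary: f h)
  case (Suc k)
  have k: "Ck_on k UNIV f" "Ck_on k UNIV h" using Suc.prems Ck_on_Suc_imp by auto
  show ?case
  proof (rule Ck_on_SucI[where G="\<lambda>x. f x *\<^sub>R grad h x + h x *\<^sub>R grad f x"])
    show "GDERIV (\<lambda>x. f x * h x) x :> f x *\<^sub>R grad h x + h x *\<^sub>R grad f x" for x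
      using Suc.prems by (intro GDERIV_mult) (auto simp: Ck_on_Suc_iff simp del: Ck_on.simps)
    show "Ck_on k UNIV (\<lambda>x. (f x *\<^sub>R grad h x + h x *\<^sub>R grad f x) \<bullet> b)" if "b \<in> Basis" for b
      using Suc.prems that k
      by (auto simp: Ck_on_Suc_iff inner_add_left intro!: Ck_on_add Suc.IH simp del: Ck_on.simps)
  qed
qed (auto intro: continuous_intros)

lemma Ck_on_sum: "finite A \<Longrightarrow> (\<And>a. a \<in> A \<Longrightarrow> Ck_on k UNIV (f a)) \<Longrightarrow> Ck_on k UNIV (\<lambda>x. \<Sum>a\<in>A. f a x)"
  by (induction rule: finite_induct) (simp_all add: Ck_on_const Ck_on_add)

lemma Ck_on_prod: "finite A \<Longrightarrow> (\<And>a. a \<in> A \<Longrightarrow> Ck_on k UNIV (f a)) \<Longrightarrow> Ck_on k UNIV (\<lambda>x. \<Prod>a\<in>A. f a x)"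
  by (induction rule: finite_induct) (simp_all add: Ck_on_const Ck_on_mult)

text \<open>The sum is the transpose of \<open>l\<close> applied to \<open>D\<close>, written in
  coordinates. The offset \<open>c\<close> lets one lemma cover translations, single coordinates,
  the factors of a product space and the projection in a chart.\<close>

lemma GDERIV_affine:
  fixes l :: "'a::euclidean_space \<Rightarrow> 'b::euclidean_space"
  assumes "bounded_linear l" "GDERIV f (c + l x) :> D"
  shows "GDERIV (\<lambda>x. f (c + l x)) x :> (\<Sum>b\<in>Basis. (l b \<bullet> D) *\<^sub>R b)"
proof -
  have "((\<lambda>x. c + l x) has_derivative l) (at x)"
    using has_derivative_add[OF has_derivative_const bounded_linear_imp_has_derivative[OF assms(1)], of c]
    by simp
  with assms(2) have "((\<lambda>x. f (c + l x)) has_derivative (\<lambda>h. l h \<bullet> D)) (at x)"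
    unfolding gderiv_def using diff_chain_at[of "\<lambda>x. c + l x" l x f] by (simp add: o_def)
  moreover have "(\<lambda>h. l h \<bullet> D) = (\<lambda>h. h \<bullet> (\<Sum>b\<in>Basis. (l b \<bullet> D) *\<^sub>R b))"
  proof
    fix h
    interpret bounded_linear l by fact
    have "l h = l (\<Sum>b\<in>Basis. (h \<bullet> b) *\<^sub>R b)" by (simp add: euclidean_representation)
    also have "\<dots> = (\<Sum>b\<in>Basis. (h \<bullet> b) *\<^sub>R l b)" by (simp only: sum scaleR)
    finally show "l h \<bullet> D = h \<bullet> (\<Sum>b\<in>Basis. (l b \<bullet> D) *\<^sub>R b)"
      by (simp add: inner_sum_right inner_sum_left mult.commute)
  qed
  ultimately show ?thesis by (simp only: gderiv_def)
qed

lemma Ck_on_affine: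
  fixes l :: "'a::euclidean_space \<Rightarrow> 'b::euclidean_space"
  assumes l: "bounded_linear l"
  shows "Ck_on k UNIV f \<Longrightarrow> Ck_on k UNIV (\<lambda>x. f (c + l x))"
proof (induction k arbitrary: f)
  case 0
  thus ?case
    by (auto intro!: continuous_on_compose2[of UNIV f] continuous_intros
        linear_continuous_on[OF l])
next
  case (Suc k)
  show ?case
  proof (rule Ck_on_SucI)
    show "GDERIV (\<lambda>x. f (c + l x)) x :> (\<Sum>b\<in>Basis. (l b \<bullet> grad f (c + l x)) *\<^sub>R b)" for x
      using Suc.prems by (intro GDERIV_affine[OF l]) (simp add: Ck_on_Suc_iff del: Ck_on.simps)
    fix b :: 'a assume b: "b \<in> Basis"
    have "Ck_on k UNIV (\<lambda>x. \<Sum>d\<in>Basis. (l b \<bullet> d) * (grad f (c + l x) \<bullet> d))"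
      by (intro Ck_on_sum Ck_on_mult Ck_on_const)
        (use Suc in \<open>auto simp: Ck_on_Suc_iff simp del: Ck_on.simps\<close>)
    moreover have "(\<Sum>d\<in>Basis. (l b \<bullet> d) * (grad f (c + l x) \<bullet> d)) =
        (\<Sum>b'\<in>Basis. (l b' \<bullet> grad f (c + l x)) *\<^sub>R b') \<bullet> b" for x
      using b by (simp add: inner_sum_left inner_Basis if_distrib cong: if_cong)
        (simp add: euclidean_inner[symmetric])
    ultimately show "Ck_on k UNIV (\<lambda>x. (\<Sum>b'\<in>Basis. (l b' \<bullet> grad f (c + l x)) *\<^sub>R b') \<bullet> b)"
      by simp
  qed
qed

section \<open>Smooth functions of compact support\<close>

definition exp_glue :: "real poly \<Rightarrow> real \<Rightarrow> real" where
  "exp_glue P x = (if x > 0 then poly P (1 / x) * exp (- 1 / x) else 0)"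

lemma poly_div_exp_tendsto_0: "((\<lambda>x::real. poly P x / exp x) \<longlongrightarrow> 0) at_top"
proof -
  have "((\<lambda>x::real. \<Sum>i\<le>degree P. coeff P i * (x ^ i / exp x)) \<longlongrightarrow> (\<Sum>i\<le>degree P. coeff P i * 0)) at_top"
    by (intro tendsto_intros tendsto_power_div_exp_0)
  thus ?thesis by (simp add: poly_altdef sum_divide_distrib)
qed

text \<open>The functions \<open>P (1/x) exp (-1/x)\<close> form a family closed under
  differentiation: with \<open>s = 1/x\<close> the chain rule gives
  \<open>s^2 (P s - P' s) exp (- s)\<close>, and \<open>[:0, 0, 1:]\<close> is the polynomial
  \<open>s^2\<close>. Having all \<open>P\<close> at once is what lets smoothness go through by
  induction.\<close>

lemma DERIV_exp_glue:
  "(exp_glue P has_real_derivative exp_glue ([:0, 0, 1:] * (P - pderiv P)) x) (at x)"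
proof -
  consider "x > 0" | "x < 0" | "x = 0" by linarith
  thus ?thesis
  proof cases
    case 1
    have "((\<lambda>x. poly P (1 / x) * exp (- 1 / x)) has_real_derivative
        exp_glue ([:0, 0, 1:] * (P - pderiv P)) x) (at x)"
      using 1 by (auto simp: exp_glue_def field_simps power2_eq_square
          intro!: derivative_eq_intros DERIV_chain2[of "poly P"] poly_DERIV)
    thus ?thesis
      by (rule has_field_derivative_transform_within_open[of _ _ _ "{0<..}"])
        (use 1 in \<open>auto simp: exp_glue_def\<close>)
  next
    case 2
    have "((\<lambda>x::real. 0) has_real_derivative exp_glue ([:0, 0, 1:] * (P - pderiv P)) x) (at x)"
      using 2 by (auto simp: exp_glue_def)
    thus ?thesis
      by (rule has_field_derivative_transform_within_open[of _ _ _ "{..<0}"])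
        (use 2 in \<open>auto simp: exp_glue_def\<close>)
  next
    case 3
    \<comment> \<open>With \<open>s = 1/h\<close> the difference quotient is
      \<open>s P(s) / exp s\<close>, whence the factor \<open>[:0, 1:]\<close>.\<close>
    have "((\<lambda>h. exp_glue P h / h) \<longlongrightarrow> 0) (at_right 0)"
    proof (rule Lim_transform_eventually)
      show "((\<lambda>h::real. poly ([:0, 1:] * P) (inverse h) / exp (inverse h)) \<longlongrightarrow> 0) (at_right 0)"
        by (rule filterlim_compose[OF poly_div_exp_tendsto_0 filterlim_inverse_at_top_right])
      show "\<forall>\<^sub>F h in at_right 0. poly ([:0, 1:] * P) (inverse h) / exp (inverse h) = exp_glue P h / h"
        by (auto simp: eventually_at_right_field exp_glue_def exp_minus field_simps intro!: exI[of _ 1])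
    qed
    moreover have "((\<lambda>h. exp_glue P h / h) \<longlongrightarrow> 0) (at_left 0)"
      by (rule Lim_transform_eventually[OF tendsto_const])
        (auto simp: eventually_at_left_field exp_glue_def intro!: exI[of _ "-1"])
    ultimately have "((\<lambda>h. exp_glue P h / h) \<longlongrightarrow> 0) (at 0)"
      by (simp add: filterlim_at_split)
    thus ?thesis using 3 by (simp add: DERIV_def exp_glue_def)
  qed
qed

lemma Ck_on_exp_glue: "Ck_on k UNIV (exp_glue P)"
proof (induction k arbitrary: P)
  case 0
  show ?case using DERIV_isCont[OF DERIV_exp_glue] by (auto intro!: continuous_at_imp_continuous_on)
next
  case (Suc k)
  show ?case
    by (rule Ck_on_SucI[where G="exp_glue ([:0, 0, 1:] * (P - pderiv P))"])
      (use DERIV_exp_glue Suc in \<open>auto simp: \<close>)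
qed

text \<open>A product of one-dimensional profiles is supported in a cube of half side
  \<open>\<delta>\<close>. Dividing \<open>\<epsilon>\<close> by the dimension makes the sum of the
  absolute coordinates, which dominates the norm, smaller than \<open>\<epsilon>\<close>.\<close>

lemma smooth_bump_exists:
  fixes \<epsilon> :: real assumes "\<epsilon> > 0"
  obtains \<beta> :: "'a::euclidean_space \<Rightarrow> real" where "\<And>k. Ck_on k UNIV \<beta>" "\<And>x. \<beta> x \<ge> 0"
    "\<beta> 0 > 0" "\<And>x. \<beta> x \<noteq> 0 \<Longrightarrow> norm x < \<epsilon>"
proof -
  define \<delta> where "\<delta> = \<epsilon> / DIM('a)"
  have \<delta>: "\<delta> > 0" using assms by (simp add: \<delta>_def)
  define \<beta> where "\<beta> x = (\<Prod>b\<in>Basis. exp_glue 1 (\<delta> + x \<bullet> b) * exp_glue 1 (\<delta> + - (x \<bullet> b)))" for x :: 'a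
  have pos: "exp_glue 1 s > 0 \<longleftrightarrow> s > 0" "exp_glue 1 s \<ge> 0" "exp_glue 1 s = 0 \<longleftrightarrow> s \<le> 0" for s
    by (auto simp: exp_glue_def)
  show ?thesis
  proof
    show "Ck_on k UNIV \<beta>" for k unfolding \<beta>_def
      by (intro Ck_on_prod Ck_on_mult Ck_on_affine Ck_on_exp_glue finite_Basis
          bounded_linear_minus bounded_linear_inner_left)
    show "\<beta> x \<ge> 0" for x unfolding \<beta>_def by (intro prod_nonneg mult_nonneg_nonneg pos ballI)
    show "\<beta> 0 > 0" unfolding \<beta>_def using \<delta> by (auto intro!: prod_pos simp: pos)
    show "norm x < \<epsilon>" if "\<beta> x \<noteq> 0" for x
    proof -
      have "\<bar>x \<bullet> b\<bar> < \<delta>" if "b \<in> Basis" for b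
        using \<open>\<beta> x \<noteq> 0\<close> that by (auto simp: \<beta>_def pos)
      hence "(\<Sum>b\<in>Basis. \<bar>x \<bullet> b\<bar>) < (\<Sum>b\<in>(Basis::'a set). \<delta>)" by (intro sum_strict_mono) auto
      with norm_le_l1[of x] show ?thesis by (simp add: \<delta>_def)
    qed
  qed
qed

section \<open>Convolution\<close>

lemma integrable_continuous_compact_support:
  fixes f :: "'a::euclidean_space \<Rightarrow> 'b::{banach, second_countable_topology}"
  assumes "continuous_on UNIV f" "compact K" "\<And>x. x \<notin> K \<Longrightarrow> f x = 0"
  shows "integrable lborel f"
proof -
  have "integrable lborel (\<lambda>x. indicator K x *\<^sub>R f x)"
    by (rule borel_integrable_compact[OF assms(2)]) (rule continuous_on_subset[OF assms(1)], simp)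
  moreover have "(\<lambda>x. indicator K x *\<^sub>R f x) = f" using assms(3) by (auto simp: indicator_def)
  ultimately show ?thesis by simp
qed

lemma integral_lborel_reflect:
  fixes f :: "'a::euclidean_space \<Rightarrow> real"
  assumes [measurable]: "f \<in> borel_measurable borel"
  shows "(LINT y|lborel. f (c - y)) = (LINT y|lborel. f y)"
proof -
  have "(LINT y|lborel. f y) = (LINT y|density (distr lborel borel (\<lambda>x. c + (-1) *\<^sub>R x)) (\<lambda>_. ennreal (\<bar>-1\<bar>^DIM('a))). f y)"
    by (subst lborel_affine[of "-1" c, symmetric]) auto
  also have "\<dots> = (LINT y|lborel. f (c - y))"
    by (simp add: density_1 integral_distr)
  finally show ?thesis by simp
qed

definition conv :: "('a::euclidean_space \<Rightarrow> real) \<Rightarrow> ('a \<Rightarrow> real) \<Rightarrow> 'a \<Rightarrow> real" where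
  "conv k f x = (LINT y|lborel. k y * f (x - y))"

text \<open>Differentiation under the integral always hits the second factor of \<open>conv\<close>.
  Exchanging the factors moves it from the function to the smooth kernel.\<close>

lemma conv_commute:
  assumes "continuous_on UNIV k" "continuous_on UNIV f"
  shows "conv k f = conv f k"
proof
  fix x
  have [measurable]: "k \<in> borel_measurable borel" "f \<in> borel_measurable borel"
    using assms by (auto intro: borel_measurable_continuous_onI)
  show "conv k f x = conv f k x"
    unfolding conv_def using integral_lborel_reflect[of "\<lambda>y. k y * f (x - y)" x]
    by (simp add: mult.commute)
qed

lemma conv_cbox:
  fixes k f :: "'a::euclidean_space \<Rightarrow> real"
  assumes "continuous_on UNIV k" "continuous_on UNIV f" "\<And>y. y \<notin> cbox a b \<Longrightarrow> k y = 0"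
  shows "conv k f x = integral (cbox a b) (\<lambda>y. k y * f (x - y))"
proof -
  have "continuous_on UNIV (\<lambda>y. k y * f (x - y))"
    by (intro continuous_intros continuous_on_compose2[OF assms(2)] assms(1)) auto
  hence "integrable lborel (\<lambda>y. k y * f (x - y))"
    by (rule integrable_continuous_compact_support[where K="cbox a b"]) (use assms in auto)
  hence "conv k f x = integral UNIV (\<lambda>y. k y * f (x - y))"
    unfolding conv_def by (simp add: integral_lborel)
  also have "\<dots> = integral (cbox a b) (\<lambda>y. k y * f (x - y))"
    by (subst integral_restrict_UNIV[symmetric], rule integral_cong) (use assms in auto)
  finally show ?thesis .
qed

text \<open>The compact support of \<open>k\<close> turns the convolution into an integral over a
  fixed box, where differentiation under the integral sign applies. The derivative is handled as a
  bounded linear function and read back in coordinates at the end.\<close>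

lemma conv_GDERIV:
  fixes k f :: "'a::euclidean_space \<Rightarrow> real"
  assumes k: "continuous_on UNIV k" "\<And>y. y \<notin> cbox a b \<Longrightarrow> k y = 0"
    and f: "\<And>x. GDERIV f x :> F x" "continuous_on UNIV F"
  shows "GDERIV (conv k f) x :> (\<Sum>c\<in>Basis. conv k (\<lambda>y. F y \<bullet> c) x *\<^sub>R c)"
proof -
  have cf: "continuous_on UNIV f"
    using f(1) by (auto intro!: continuous_at_imp_continuous_on GDERIV_continuous)
  define fx where "fx x y = k y *\<^sub>R blinfun_inner_left (F (x - y))" for x y
  have 1: "conv k f = (\<lambda>x. integral (cbox a b) (\<lambda>y. k y * f (x - y)))"
    using conv_cbox[OF k(1) cf k(2)] by auto
  have 2: "((\<lambda>x. integral (cbox a b) (\<lambda>y. k y * f (x - y))) has_derivative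
      integral (cbox a b) (fx x)) (at x within UNIV)"
  proof (rule leibniz_rule)
    fix x y :: 'a
    have "((\<lambda>x. x - y) has_derivative (\<lambda>h. h)) (at x)" by (auto intro!: derivative_eq_intros)
    hence "((\<lambda>x. f (x - y)) has_derivative (\<lambda>h. h \<bullet> F (x - y))) (at x)"
      using f(1)[of "x - y"] has_derivative_compose[of "\<lambda>x. x - y" "\<lambda>h. h" x UNIV f "\<lambda>h. h \<bullet> F (x - y)"]
      by (simp add: gderiv_def)
    hence "((\<lambda>x. k y * f (x - y)) has_derivative (\<lambda>h. k y * (h \<bullet> F (x - y)))) (at x)"
      by (rule has_derivative_mult_right)
    thus "((\<lambda>x. k y * f (x - y)) has_derivative blinfun_apply (fx x y)) (at x within UNIV)"
      by (simp add: fx_def scaleR_blinfun.rep_eq)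
  next
    fix x
    show "(\<lambda>y. k y * f (x - y)) integrable_on cbox a b"
      by (intro integrable_continuous continuous_intros continuous_on_compose2[OF cf]
          continuous_on_subset[OF k(1)]) auto
  next
    show "continuous_on (UNIV \<times> cbox a b) (\<lambda>(x, t). fx x t)"
      unfolding fx_def case_prod_unfold
      by (intro continuous_intros continuous_on_compose2[OF k(1)]
          bounded_linear.continuous_on[OF bounded_linear_blinfun_inner_left]
          continuous_on_compose2[OF f(2)]) auto
  qed auto
  have int: "fx x integrable_on cbox a b" unfolding fx_def
    by (intro integrable_continuous continuous_intros continuous_on_subset[OF k(1)]
          bounded_linear.continuous_on[OF bounded_linear_blinfun_inner_left]
          continuous_on_compose2[OF f(2)]) auto
  have 3: "blinfun_apply (integral (cbox a b) (fx x)) h = h \<bullet> (\<Sum>c\<in>Basis. conv k (\<lambda>y. F y \<bullet> c) x *\<^sub>R c)" for h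
  proof -
    have cF: "continuous_on UNIV (\<lambda>y. F y \<bullet> c)" for c by (intro continuous_intros f(2))
    have "blinfun_apply (integral (cbox a b) (fx x)) h = integral (cbox a b) (\<lambda>y. fx x y h)"
      by (rule blinfun_apply_integral[OF int])
    also have "\<dots> = integral (cbox a b) (\<lambda>y. \<Sum>c\<in>Basis. (h \<bullet> c) * (k y * (F (x - y) \<bullet> c)))"
      by (rule integral_cong, simp only: fx_def scaleR_blinfun.rep_eq blinfun_inner_left.rep_eq,
        subst euclidean_inner) (simp add: sum_distrib_left algebra_simps)
    also have "\<dots> = (\<Sum>c\<in>Basis. (h \<bullet> c) * integral (cbox a b) (\<lambda>y. k y * (F (x - y) \<bullet> c)))"
      by (subst integral_sum)
        (auto intro!: integrable_continuous continuous_intros continuous_on_subset[OF k(1)]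
          continuous_on_compose2[OF f(2)])
    also have "\<dots> = (\<Sum>c\<in>Basis. (h \<bullet> c) * conv k (\<lambda>y. F y \<bullet> c) x)"
      using conv_cbox[OF k(1) cF k(2)] by simp
    finally show ?thesis by (simp add: inner_sum_right mult.commute)
  qed
  from 2 show ?thesis by (simp add: gderiv_def 1 3[abs_def])
qed

lemma Ck_on_conv:
  fixes k f :: "'a::euclidean_space \<Rightarrow> real"
  assumes k: "continuous_on UNIV k" "\<And>y. y \<notin> cbox a b \<Longrightarrow> k y = 0"
  shows "(\<And>m. Ck_on m UNIV f) \<Longrightarrow> Ck_on m UNIV (conv k f)"
proof (induction m arbitrary: f)
  have GD: "GDERIV (conv k f) x :> (\<Sum>c\<in>Basis. conv k (\<lambda>y. grad f y \<bullet> c) x *\<^sub>R c)"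
    if "\<And>m. Ck_on m UNIV f" for f x
  proof (rule conv_GDERIV[OF k])
    have "Ck_on (Suc 0) UNIV f" by fact
    hence *: "(\<forall>x. GDERIV f x :> grad f x)" "\<And>b. b \<in> Basis \<Longrightarrow> continuous_on UNIV (\<lambda>x. grad f x \<bullet> b)"
      unfolding Ck_on_Suc_iff by auto
    show "GDERIV f x :> grad f x" for x using * by blast
    show "continuous_on UNIV (grad f)" using * by (subst continuous_on_componentwise) auto
  qed
  {
    case 0
    show ?case using GD[OF 0] by (auto intro!: continuous_at_imp_continuous_on GDERIV_continuous)
  next
    case (Suc m)
    show ?case
    proof (rule Ck_on_SucI[OF GD[OF Suc.prems]])
      fix b :: 'a assume b: "b \<in> Basis"
      have "Ck_on m UNIV (conv k (\<lambda>y. grad f y \<bullet> b))"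
        by (rule Suc.IH) (use Suc.prems b in \<open>metis Ck_on_Suc_iff\<close>)
      moreover have "(\<Sum>c\<in>Basis. conv k (\<lambda>y. grad f y \<bullet> c) x *\<^sub>R c) \<bullet> b = conv k (\<lambda>y. grad f y \<bullet> b) x" for x
        using b by (simp add: inner_sum_left inner_Basis if_distrib cong: if_cong)
      ultimately show "Ck_on m UNIV (\<lambda>x. (\<Sum>c\<in>Basis. conv k (\<lambda>y. grad f y \<bullet> c) x *\<^sub>R c) \<bullet> b)"
        by simp
    qed
  }
qed


text \<open>Continuity is uniform on the compact set of points within distance one of
  \<open>K\<close>. If neither \<open>x\<close> nor \<open>x - y\<close> lies in \<open>K\<close>,
  both values vanish.\<close>

lemma compact_support_uniformly_continuous:
  fixes f :: "'a::euclidean_space \<Rightarrow> 'b::real_normed_vector"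
  assumes f: "continuous_on UNIV f" and K: "compact K" "\<And>x. x \<notin> K \<Longrightarrow> f x = 0" and e: "e > 0"
  obtains d where "d > 0" "\<And>x y. norm y < d \<Longrightarrow> norm (f (x - y) - f x) < e"
proof -
  define L where "L = {x + y |x y. x \<in> K \<and> y \<in> cball (0::'a) 1}"
  have "compact L" unfolding L_def by (rule compact_sums[OF K(1)]) simp
  hence "uniformly_continuous_on L f"
    by (rule compact_uniformly_continuous[OF continuous_on_subset[OF f], rotated]) simp
  then obtain d where d: "d > 0" "\<And>x x'. x \<in> L \<Longrightarrow> x' \<in> L \<Longrightarrow> dist x' x < d \<Longrightarrow> dist (f x') (f x) < e"
    using e unfolding uniformly_continuous_on_def by metis
  have L: "x \<in> L" "x - y \<in> L" if "norm y < 1" "x \<in> K \<or> x - y \<in> K" for x y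
  proof -
    have "u + v \<in> L" if "u \<in> K" "norm v \<le> 1" for u v using that by (auto simp: L_def)
    from this[of x 0] this[of x "- y"] this[of "x - y" 0] this[of "x - y" y]
    show "x \<in> L" "x - y \<in> L" using that by auto
  qed
  show ?thesis
  proof
    show "min d 1 > 0" using d by simp
    show "norm (f (x - y) - f x) < e" if "norm y < min d 1" for x y
    proof (cases "x \<in> K \<or> x - y \<in> K")
      case True
      thus ?thesis using d(2)[of x "x - y"] L[of y x] that by (auto simp: dist_norm)
    qed (use K e in auto)
  qed
qed

text \<open>The set where \<open>f\<close> differs from zero is open, and a nonempty open set is not
  null. This turns the almost-everywhere conclusions about traces, weak derivatives and energies
  into pointwise ones.\<close>

lemma continuous_AE_zero:
  fixes f :: "'a::euclidean_space \<Rightarrow> real"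
  assumes "open U" "continuous_on U f" "AE x in lborel. x \<in> U \<longrightarrow> f x = 0" "x \<in> U"
  shows "f x = 0"
proof (rule ccontr)
  assume "f x \<noteq> 0"
  define V where "V = U \<inter> f -` (- {0})"
  have V: "open V" "x \<in> V"
    unfolding V_def using assms \<open>f x \<noteq> 0\<close> by (auto intro: continuous_open_preimage)
  have "V \<in> null_sets lborel"
    using assms(3) V(1) by (subst AE_iff_null_sets) (auto simp: V_def elim: AE_mp)
  hence "negligible V" by (simp add: negligible_iff_null_sets null_sets_completionI)
  thus False using open_not_negligible[OF V(1)] V(2) by auto
qed

lemma mollifier_exists:
  fixes \<epsilon> :: real assumes "\<epsilon> > 0"
  obtains \<rho> :: "'a::euclidean_space \<Rightarrow> real" where "\<And>k. Ck_on k UNIV \<rho>" "\<And>x. \<rho> x \<ge> 0"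
    "\<And>x. norm x \<ge> \<epsilon> \<Longrightarrow> \<rho> x = 0" "integrable lborel \<rho>" "(LINT x|lborel. \<rho> x) = 1"
proof -
  obtain \<beta> :: "'a \<Rightarrow> real" where \<beta>: "\<And>k. Ck_on k UNIV \<beta>" "\<And>x. \<beta> x \<ge> 0"
    "\<beta> 0 > 0" "\<And>x. \<beta> x \<noteq> 0 \<Longrightarrow> norm x < \<epsilon>"
    by (rule smooth_bump_exists[OF assms]) blast
  have c: "continuous_on UNIV \<beta>" using \<beta>(1)[of 0] by simp
  have i: "integrable lborel \<beta>"
    by (rule integrable_continuous_compact_support[OF c, of "cball 0 \<epsilon>"]) (use \<beta>(4) in force)+
  have "(LINT x|lborel. \<beta> x) \<noteq> 0"
  proof
    assume "(LINT x|lborel. \<beta> x) = 0"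
    hence "AE x in lborel. \<beta> x = 0" using integral_nonneg_eq_0_iff_AE[OF i] \<beta>(2) by auto
    hence "\<beta> 0 = 0" using continuous_AE_zero[of UNIV \<beta> 0] c by simp
    thus False using \<beta>(3) by simp
  qed
  hence pos: "(LINT x|lborel. \<beta> x) > 0" using \<beta>(2) by (simp add: order_less_le)
  show ?thesis
  proof
    show "Ck_on k UNIV (\<lambda>x. inverse (LINT x|lborel. \<beta> x) * \<beta> x)" for k
      by (intro Ck_on_mult Ck_on_const \<beta>)
    show "inverse (LINT x|lborel. \<beta> x) * \<beta> x = 0" if "norm x \<ge> \<epsilon>" for x
      using \<beta>(4)[of x] that by force
    show "inverse (LINT x|lborel. \<beta> x) * \<beta> x \<ge> 0" for x using pos \<beta>(2)[of x] by simp
  qed (use i pos in auto)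
qed

text \<open>The difference is the average of \<open>f (x - y) - f x\<close> with weight
  \<open>\<rho> y\<close>, and the weight vanishes where no bound on the increment is
  available.\<close>

lemma conv_approx:
  fixes f \<rho> :: "'a::euclidean_space \<Rightarrow> real"
  assumes \<rho>: "continuous_on UNIV \<rho>" "\<And>x. \<rho> x \<ge> 0" "\<And>x. norm x \<ge> \<epsilon> \<Longrightarrow> \<rho> x = 0"
      "(LINT x|lborel. \<rho> x) = 1"
    and f: "continuous_on UNIV f" "\<And>y. norm y < \<epsilon> \<Longrightarrow> \<bar>f (x - y) - f x\<bar> \<le> e"
  shows "\<bar>conv \<rho> f x - f x\<bar> \<le> e"
proof -
  have z: "y \<notin> cball 0 \<epsilon> \<Longrightarrow> \<rho> y = 0" for y using \<rho>(3)[of y] by auto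
  have ci: "integrable lborel (\<lambda>y. \<rho> y * h y)" if "continuous_on UNIV h" for h
    by (rule integrable_continuous_compact_support[of _ "cball 0 \<epsilon>"])
      (use that z in \<open>auto intro!: continuous_intros \<rho>(1)\<close>)
  have c: "continuous_on UNIV (\<lambda>y. f (x - y))"
    by (intro continuous_intros continuous_on_compose2[OF f(1)]) auto
  have "conv \<rho> f x - f x = (LINT y|lborel. \<rho> y * f (x - y)) - (LINT y|lborel. \<rho> y * f x)"
    using \<rho>(4) by (simp add: conv_def)
  also have "\<dots> = (LINT y|lborel. \<rho> y * (f (x - y) - f x))"
    using ci[OF c] ci[of "\<lambda>_. f x"] by (simp add: algebra_simps)
  also have "\<bar>\<dots>\<bar> \<le> (LINT y|lborel. \<bar>\<rho> y * (f (x - y) - f x)\<bar>)"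
    by (rule integral_abs_bound)
  also have "\<dots> \<le> (LINT y|lborel. \<rho> y * e)"
  proof (rule integral_mono)
    show "integrable lborel (\<lambda>y. \<bar>\<rho> y * (f (x - y) - f x)\<bar>)"
      by (intro integrable_abs ci continuous_intros c)
    show "integrable lborel (\<lambda>y. \<rho> y * e)" by (intro ci continuous_intros)
    fix y
    show "\<bar>\<rho> y * (f (x - y) - f x)\<bar> \<le> \<rho> y * e"
      using \<rho>(2,3)[of y] f(2)[of y] by (cases "norm y < \<epsilon>") (auto simp: abs_mult mult_left_mono)
  qed
  also have "\<dots> = e" using \<rho>(4) by simp
  finally show ?thesis .
qed

lemma gradient_zero_outside:
  fixes f :: "'a::euclidean_space \<Rightarrow> real"
  assumes "\<And>x. GDERIV f x :> F x" "closed K" "\<And>x. x \<notin> K \<Longrightarrow> f x = 0" "x \<notin> K"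
  shows "F x = 0"
proof -
  have "GDERIV (\<lambda>_. 0) x :> F x"
    by (rule GDERIV_transform_open[where U="- K", OF assms(1)]) (use assms in auto)
  moreover have "GDERIV (\<lambda>_. 0) x :> 0" by (rule GDERIV_const)
  ultimately show ?thesis using grad_eq[of "\<lambda>_. 0" x "F x"] grad_eq[of "\<lambda>_. 0" x 0] by simp
qed

text \<open>The gradient clause is quantified over \<open>F\<close> so that one statement serves a
  merely continuous \<open>f\<close>, for which the clause may be void, and a C1 function, whose
  gradient is then approximated by the same \<open>\<phi>\<close>. The mollification radius is at
  most half the distance from \<open>K\<close> to the complement of \<open>S\<close>, which keeps
  the supports inside.\<close>

lemma mollify:
  fixes S K :: "'a::euclidean_space set"
  assumes S: "open S" and K: "compact K" "K \<subseteq> S"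
  obtains K' where "compact K'" "K \<subseteq> K'" "K' \<subseteq> S"
    "\<And>f e. \<lbrakk>continuous_on UNIV f; \<And>x. x \<notin> K \<Longrightarrow> f x = 0; e > 0\<rbrakk> \<Longrightarrow>
      \<exists>\<phi>. test_fun S \<phi> \<and> (\<forall>x. x \<notin> K' \<longrightarrow> \<phi> x = 0) \<and> (\<forall>x. \<bar>\<phi> x - f x\<bar> \<le> e) \<and>
        (\<forall>F. continuous_on UNIV F \<longrightarrow> (\<forall>x. GDERIV f x :> F x) \<longrightarrow> (\<forall>x. norm (grad \<phi> x - F x) \<le> e))"
proof -
  obtain d where d: "d > 0" "\<And>x y. x \<in> K \<Longrightarrow> y \<notin> S \<Longrightarrow> d \<le> dist x y"
  proof -
    have "closed (- S)" "K \<inter> - S = {}" using S K(2) by auto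
    thus ?thesis using separate_compact_closed[OF K(1), of "- S"] that by blast
  qed
  define K' where "K' = {x + y |x y. x \<in> K \<and> y \<in> cball (0::'a) (d/2)}"
  have cK': "compact K'" unfolding K'_def by (rule compact_sums[OF K(1)]) simp
  show ?thesis
  proof (rule that[OF cK'])
    have K'I: "u + v \<in> K'" if "u \<in> K" "norm v \<le> d/2" for u v using that by (auto simp: K'_def)
    thus "K \<subseteq> K'" using d(1) K'I[of _ 0] by auto
    show K'S: "K' \<subseteq> S"
    proof
      fix z assume "z \<in> K'"
      then obtain x y where "z = x + y" "x \<in> K" "norm y \<le> d/2" by (auto simp: K'_def)
      thus "z \<in> S" using d(1) d(2)[of x z] by (auto simp: dist_norm)
    qed
    fix f :: "'a \<Rightarrow> real" and e :: real
    assume f: "continuous_on UNIV f" "\<And>x. x \<notin> K \<Longrightarrow> f x = 0" and e: "e > 0"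
    obtain d1 where d1: "d1 > 0" "\<And>x y. norm y < d1 \<Longrightarrow> norm (f (x - y) - f x) < e"
      using compact_support_uniformly_continuous[OF f(1) K(1) f(2) e] by metis
    \<comment> \<open>Gradients are unique, so the only candidate for \<open>F\<close> is
      \<open>grad f\<close>. If \<open>f\<close> is not C1 there is no candidate and any radius
      does. The division by the dimension is undone when the components are summed.\<close>
    have "\<exists>d2>0. \<forall>F. continuous_on UNIV F \<longrightarrow> (\<forall>x. GDERIV f x :> F x) \<longrightarrow>
        (\<forall>x y. norm y < d2 \<longrightarrow> norm (F (x - y) - F x) < e / DIM('a))"
    proof (cases "continuous_on UNIV (grad f) \<and> (\<forall>x. GDERIV f x :> grad f x)")
      case True
      hence "grad f x = 0" if "x \<notin> K" for x
        using gradient_zero_outside[of f "grad f" K] f(2) that K(1) by (auto intro: compact_imp_closed)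
      then obtain d2 where "d2 > 0" "\<And>x y. norm y < d2 \<Longrightarrow> norm (grad f (x - y) - grad f x) < e / DIM('a)"
        using compact_support_uniformly_continuous[of "grad f" K "e / DIM('a)"] True K e by auto
      moreover have "F = grad f" if "\<forall>x. GDERIV f x :> F x" for F
        using grad_eq that by (metis ext)
      ultimately show ?thesis by blast
    next
      case False
      moreover have "F = grad f" if "\<forall>x. GDERIV f x :> F x" for F
        using grad_eq that by (metis ext)
      ultimately show ?thesis by (intro exI[of _ 1]) auto
    qed
    then obtain d2 where d2: "d2 > 0" "\<And>F x y. continuous_on UNIV F \<Longrightarrow> (\<And>x. GDERIV f x :> F x) \<Longrightarrow>
        norm y < d2 \<Longrightarrow> norm (F (x - y) - F x) < e / DIM('a)" by metis
    define \<epsilon> where "\<epsilon> = min (d/2) (min d1 d2)"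
    have \<epsilon>: "\<epsilon> > 0" "\<epsilon> \<le> d/2" "\<epsilon> \<le> d1" "\<epsilon> \<le> d2" using d d1 d2 by (auto simp: \<epsilon>_def)
    obtain \<rho> :: "'a \<Rightarrow> real" where \<rho>: "\<And>k. Ck_on k UNIV \<rho>" "\<And>x. \<rho> x \<ge> 0"
      "\<And>x. norm x \<ge> \<epsilon> \<Longrightarrow> \<rho> x = 0" "integrable lborel \<rho>" "(LINT x|lborel. \<rho> x) = 1"
      by (rule mollifier_exists[OF \<epsilon>(1)]) blast
    have c\<rho>: "continuous_on UNIV \<rho>" using \<rho>(1)[of 0] by simp
    obtain a where a: "K \<subseteq> cbox (- a) a" using bounded_subset_cbox_symmetric[OF compact_imp_bounded[OF K(1)]] .
    obtain b :: 'a where b: "cball 0 \<epsilon> \<subseteq> cbox (- b) b" using bounded_subset_cbox_symmetric[OF bounded_cball] .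
    \<comment> \<open>Smoothness wants the derivatives on \<open>\<rho>\<close>, hence the exchange
      of factors; the approximation of the gradient below wants them on \<open>f\<close>.\<close>
    have sm: "Ck_on k UNIV (conv \<rho> f)" for k
      unfolding conv_commute[OF c\<rho> f(1)] by (rule Ck_on_conv[OF f(1) _ \<rho>(1), of "- a" a]) (use a f(2) in auto)
    have supp: "conv \<rho> f x = 0" if "x \<notin> K'" for x
    proof -
      have "\<rho> y * f (x - y) = 0" for y
      proof (rule ccontr)
        assume *: "\<rho> y * f (x - y) \<noteq> 0"
        hence "norm y < \<epsilon>" using \<rho>(3)[of y] by force
        moreover have "x - y \<in> K" using f(2) * by auto
        ultimately have "(x - y) + y \<in> K'" using \<epsilon> by (intro K'I) auto
        thus False using that by simp
      qed
      hence "(\<lambda>y. \<rho> y * f (x - y)) = (\<lambda>_. 0)" by blast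
      thus ?thesis by (simp add: conv_def)
    qed
    have cl: "closure {x. conv \<rho> f x \<noteq> 0} \<subseteq> K'"
      by (rule closure_minimal) (use supp cK' in \<open>auto intro: compact_imp_closed\<close>)
    have "test_fun S (conv \<rho> f)" unfolding test_fun_def
      using sm cl K'S cK' compact_Int_closed[OF cK', of "closure {x. conv \<rho> f x \<noteq> 0}"]
      by (auto simp: Int_absorb1)
    moreover have "\<bar>conv \<rho> f x - f x\<bar> \<le> e" for x
      by (rule conv_approx[OF c\<rho> \<rho>(2,3,5) f(1)]) (use \<epsilon> d1(2)[THEN less_imp_le] in auto)
    moreover have "norm (grad (conv \<rho> f) x - F x) \<le> e"
      if F: "continuous_on UNIV F" "\<And>x. GDERIV f x :> F x" for F x
    proof -
      have "GDERIV (conv \<rho> f) x :> (\<Sum>c\<in>Basis. conv \<rho> (\<lambda>y. F y \<bullet> c) x *\<^sub>R c)"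
        by (rule conv_GDERIV[OF c\<rho> _ F(2,1), of "-b" b]) (use \<rho>(3) b in force)
      hence "grad (conv \<rho> f) x - F x =
          (\<Sum>c\<in>Basis. conv \<rho> (\<lambda>y. F y \<bullet> c) x *\<^sub>R c) - (\<Sum>c\<in>Basis. (F x \<bullet> c) *\<^sub>R c)"
        by (simp only: grad_eq euclidean_representation)
      also have "\<dots> = (\<Sum>c\<in>Basis. (conv \<rho> (\<lambda>y. F y \<bullet> c) x - F x \<bullet> c) *\<^sub>R c)"
        by (simp only: scaleR_left_diff_distrib sum_subtractf)
      finally have "norm (grad (conv \<rho> f) x - F x) =
          norm (\<Sum>c\<in>Basis. (conv \<rho> (\<lambda>y. F y \<bullet> c) x - F x \<bullet> c) *\<^sub>R c)" by simp
      also have "\<dots> \<le> (\<Sum>c\<in>(Basis::'a set). e / DIM('a))"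
      proof (rule sum_norm_le)
        fix c :: 'a assume c: "c \<in> Basis"
        have "\<bar>conv \<rho> (\<lambda>y. F y \<bullet> c) x - F x \<bullet> c\<bar> \<le> e / DIM('a)"
        proof (rule conv_approx[OF c\<rho> \<rho>(2,3,5)])
          fix y :: 'a assume "norm y < \<epsilon>"
          hence "norm (F (x - y) - F x) < e / DIM('a)" using d2(2)[OF F] \<epsilon> by auto
          moreover have "\<bar>F (x - y) \<bullet> c - F x \<bullet> c\<bar> \<le> norm (F (x - y) - F x)"
            using Basis_le_norm[OF c, of "F (x - y) - F x"] by (simp add: inner_diff_left)
          ultimately show "\<bar>F (x - y) \<bullet> c - F x \<bullet> c\<bar> \<le> e / DIM('a)" by simp
        qed (auto intro!: continuous_intros F)
        thus "norm ((conv \<rho> (\<lambda>y. F y \<bullet> c) x - F x \<bullet> c) *\<^sub>R c) \<le> e / DIM('a)" using c by simp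
      qed
      finally show ?thesis by simp
    qed
    ultimately show "\<exists>\<phi>. test_fun S \<phi> \<and> (\<forall>x. x \<notin> K' \<longrightarrow> \<phi> x = 0) \<and> (\<forall>x. \<bar>\<phi> x - f x\<bar> \<le> e) \<and>
        (\<forall>F. continuous_on UNIV F \<longrightarrow> (\<forall>x. GDERIV f x :> F x) \<longrightarrow> (\<forall>x. norm (grad \<phi> x - F x) \<le> e))"
      using supp by blast
  qed
qed

section \<open>Integration by parts and uniqueness of weak derivatives\<close>

text \<open>On the overlap of \<open>S\<close> and the complement of \<open>K\<close> the function
  is zero, so the two local descriptions agree on open sets that cover the space.\<close>

lemma C1_extend_zero:
  fixes f :: "'a::euclidean_space \<Rightarrow> real"
  assumes S: "open S" and K: "compact K" "K \<subseteq> S"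
    and f: "\<And>x. x \<in> S \<Longrightarrow> GDERIV f x :> F x" "continuous_on S F" "\<And>x. x \<in> S \<Longrightarrow> x \<notin> K \<Longrightarrow> f x = 0"
  shows "GDERIV (\<lambda>x. if x \<in> S then f x else 0) x :> (if x \<in> S then F x else 0)"
    and "continuous_on UNIV (\<lambda>x. if x \<in> S then F x else 0)"
    and "x \<in> S \<Longrightarrow> x \<notin> K \<Longrightarrow> F x = 0"
proof -
  have oK: "open (- K)" using K(1) by (simp add: compact_imp_closed open_Compl)
  have G: "GDERIV (\<lambda>x. if x \<in> S then f x else 0) x :> F x" if "x \<in> S" for x
    by (rule GDERIV_transform_open[where U=S, OF f(1)]) (use that S in auto)
  have Z: "GDERIV (\<lambda>x. if x \<in> S then f x else 0) x :> 0" if "x \<notin> K" for x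
    by (rule GDERIV_transform_open[where U="- K", OF GDERIV_const[where k=0]]) (use that oK f(3) in auto)
  show F0: "F x = 0" if "x \<in> S" "x \<notin> K" for x
    using grad_eq[OF G[OF that(1)]] grad_eq[OF Z[OF that(2)]] by simp
  show "GDERIV (\<lambda>x. if x \<in> S then f x else 0) x :> (if x \<in> S then F x else 0)"
  proof (cases "x \<in> S")
    case False
    hence "x \<notin> K" using K by auto
    thus ?thesis using Z False by simp
  qed (use G in simp)
  have "continuous_on (S \<union> - K) (\<lambda>x. if x \<in> S then F x else 0)"
  proof (rule continuous_on_open_Un[OF S oK])
    show "continuous_on S (\<lambda>x. if x \<in> S then F x else 0)"
      by (rule continuous_on_eq[OF f(2)]) simp
    show "continuous_on (- K) (\<lambda>x. if x \<in> S then F x else 0)"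
      by (rule continuous_on_eq[OF continuous_on_const[of _ 0]]) (use F0 in auto)
  qed
  moreover have "S \<union> - K = UNIV" using K by auto
  ultimately show "continuous_on UNIV (\<lambda>x. if x \<in> S then F x else 0)" by simp
qed

text \<open>By translation invariance the integral of \<open>f (x + t b)\<close> does not depend on
  \<open>t\<close>, and its derivative at \<open>t = 0\<close> is the integral in question.
  Integration by parts below rests on this.\<close>

lemma integral_partial_derivative_zero:
  fixes f :: "'a::euclidean_space \<Rightarrow> real"
  assumes f: "\<And>x. GDERIV f x :> F x" "continuous_on UNIV F" and K: "compact K" "\<And>x. x \<notin> K \<Longrightarrow> f x = 0"
    and b: "norm b = 1"
  shows "(LINT x|lborel. F x \<bullet> b) = 0"
proof -
  have cf: "continuous_on UNIV f"
    using f(1) by (auto intro!: continuous_at_imp_continuous_on GDERIV_continuous)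
  \<comment> \<open>The unit margin keeps the supports of all translates with
    \<open>\<bar>t\<bar> \<le> 1\<close> inside one box.\<close>
  define L where "L = {x + y |x y. x \<in> K \<and> y \<in> cball (0::'a) 1}"
  have "compact L" unfolding L_def by (rule compact_sums[OF K(1)]) simp
  then obtain a where a: "L \<subseteq> cbox (- a) a" using bounded_subset_cbox_symmetric compact_imp_bounded by metis
  have L: "u + v \<in> L" if "u \<in> K" "norm v \<le> 1" for u v using that by (auto simp: L_def)
  have f0: "f (x + t *\<^sub>R b) = 0" if "x \<notin> cbox (- a) a" "\<bar>t\<bar> \<le> 1" for x t
  proof (rule ccontr)
    assume "f (x + t *\<^sub>R b) \<noteq> 0"
    hence "x + t *\<^sub>R b \<in> K" using K(2) by auto
    from L[OF this, of "- t *\<^sub>R b"] have "x \<in> L" using that(2) b by simp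
    thus False using a that by auto
  qed
  have F0: "F x = 0" if "x \<notin> cbox (- a) a" for x
    using gradient_zero_outside[of f F K x] f(1) K compact_imp_closed[OF K(1)] L[of x 0] a that by auto
  have ci: "integrable lborel (\<lambda>x. f (x + t *\<^sub>R b))" if "\<bar>t\<bar> \<le> 1" for t
    by (rule integrable_continuous_compact_support[of _ "cbox (-a) a"])
      (use f0 that in \<open>auto intro!: continuous_on_compose2[OF cf] continuous_intros\<close>)
  have J: "integral (cbox (- a) a) (\<lambda>x. f (x + t *\<^sub>R b)) = (LINT x|lborel. f x)" if "\<bar>t\<bar> \<le> 1" for t
  proof -
    have "integral (cbox (- a) a) (\<lambda>x. f (x + t *\<^sub>R b)) = integral UNIV (\<lambda>x. f (x + t *\<^sub>R b))"
      by (subst integral_restrict_UNIV[symmetric], rule integral_cong) (use f0 that in auto)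
    also have "\<dots> = (LINT x|lborel. f (t *\<^sub>R b + x))" using integral_lborel[OF ci[OF that]] by (simp add: add.commute)
    also have "\<dots> = (LINT x|distr lborel borel ((+) (t *\<^sub>R b)). f x)"
      by (subst integral_distr) (auto intro: borel_measurable_continuous_onI[OF cf])
    finally show ?thesis by (simp add: lborel_distr_plus)
  qed
  have "((\<lambda>t. integral (cbox (- a) a) (\<lambda>x. f (x + t *\<^sub>R b))) has_real_derivative
      integral (cbox (- a) a) (\<lambda>x. F (x + 0 *\<^sub>R b) \<bullet> b)) (at 0 within UNIV)"
  proof (rule leibniz_rule_field_derivative)
    fix t :: real and x
    have "((\<lambda>t. x + t *\<^sub>R b) has_derivative (\<lambda>h. h *\<^sub>R b)) (at t)"
      by (auto intro!: derivative_eq_intros)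
    moreover have "(f has_derivative (\<lambda>h. h \<bullet> F (x + t *\<^sub>R b))) (at (x + t *\<^sub>R b))"
      using f(1) by (simp add: gderiv_def)
    ultimately have "((\<lambda>t. f (x + t *\<^sub>R b)) has_derivative (\<lambda>h. (h *\<^sub>R b) \<bullet> F (x + t *\<^sub>R b))) (at t)"
      by (rule has_derivative_compose)
    thus "((\<lambda>t. f (x + t *\<^sub>R b)) has_real_derivative F (x + t *\<^sub>R b) \<bullet> b) (at t within UNIV)"
      by (simp add: has_field_derivative_def inner_commute mult_commute_abs)
  next
    show "(\<lambda>x. f (x + t *\<^sub>R b)) integrable_on cbox (- a) a" for t
      by (intro integrable_continuous continuous_on_compose2[OF cf] continuous_intros) auto
  next
    show "continuous_on (UNIV \<times> cbox (- a) a) (\<lambda>(t, x). F (x + t *\<^sub>R b) \<bullet> b)"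
      unfolding case_prod_unfold
      by (intro continuous_intros continuous_on_compose2[OF f(2)]) auto
  qed auto
  moreover have "((\<lambda>t. integral (cbox (- a) a) (\<lambda>x. f (x + t *\<^sub>R b))) has_real_derivative 0) (at 0)"
    by (rule has_field_derivative_transform_within_open[of "\<lambda>_. LINT x|lborel. f x" _ _ "{-1<..<1}"])
      (use J in \<open>auto simp: \<close>)
  ultimately have "integral (cbox (- a) a) (\<lambda>x. F x \<bullet> b) = 0"
    by (auto dest: DERIV_unique)
  moreover have "integral (cbox (- a) a) (\<lambda>x. F x \<bullet> b) = integral UNIV (\<lambda>x. F x \<bullet> b)"
    by (subst integral_restrict_UNIV[symmetric], rule integral_cong) (use F0 in auto)
  moreover have "integral UNIV (\<lambda>x. F x \<bullet> b) = (LINT x|lborel. F x \<bullet> b)"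
    by (rule integral_lborel, rule integrable_continuous_compact_support[of _ "cbox (-a) a"])
      (use F0 in \<open>auto intro!: continuous_intros f(2)\<close>)
  ultimately show ?thesis by simp
qed

lemma integral_lebesgue_on_lborel:
  fixes h :: "'a::euclidean_space \<Rightarrow> real"
  assumes "open S" "(\<lambda>x. if x \<in> S then h x else 0) \<in> borel_measurable borel"
  shows "(LINT x|lebesgue_on S. h x) = (LINT x|lborel. (if x \<in> S then h x else 0))"
proof -
  have "(LINT x|lebesgue_on S. h x) = (LINT x|lebesgue. indicator S x *\<^sub>R h x)"
    by (rule integral_restrict_space) (use assms in auto)
  also have "(\<lambda>x. indicator S x *\<^sub>R h x) = (\<lambda>x. if x \<in> S then h x else 0)" by (auto simp: indicator_def)
  also have "(LINT x|lebesgue. (if x \<in> S then h x else 0)) = (LINT x|lborel. (if x \<in> S then h x else 0))"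
    by (rule integral_completion) (use assms in auto)
  finally show ?thesis .
qed

lemma continuous_extend_zero:
  fixes f :: "'a::euclidean_space \<Rightarrow> 'b::real_normed_vector"
  assumes S: "open S" and K: "compact K" "K \<subseteq> S" and f: "continuous_on S f" "\<And>x. x \<in> S \<Longrightarrow> x \<notin> K \<Longrightarrow> f x = 0"
  shows "continuous_on UNIV (\<lambda>x. if x \<in> S then f x else 0)"
proof -
  have oK: "open (- K)" using K(1) by (simp add: compact_imp_closed open_Compl)
  have "continuous_on (S \<union> - K) (\<lambda>x. if x \<in> S then f x else 0)"
  proof (rule continuous_on_open_Un[OF S oK])
    show "continuous_on S (\<lambda>x. if x \<in> S then f x else 0)"
      by (rule continuous_on_eq[OF f(1)]) simp
    show "continuous_on (- K) (\<lambda>x. if x \<in> S then f x else 0)"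
      by (rule continuous_on_eq[OF continuous_on_const[of _ 0]]) (use f(2) in auto)
  qed
  moreover have "S \<union> - K = UNIV" using K by auto
  ultimately show ?thesis by simp
qed

lemma test_fun_C1:
  assumes "test_fun S \<phi>"
  shows "GDERIV \<phi> x :> grad \<phi> x" "continuous_on UNIV (grad \<phi>)" "continuous_on UNIV \<phi>"
    "compact (closure {x. \<phi> x \<noteq> 0})" "closure {x. \<phi> x \<noteq> 0} \<subseteq> S"
    "x \<notin> closure {x. \<phi> x \<noteq> 0} \<Longrightarrow> \<phi> x = 0" "x \<notin> closure {x. \<phi> x \<noteq> 0} \<Longrightarrow> grad \<phi> x = 0"
proof -
  from assms have "Ck_on (Suc 0) UNIV \<phi>" "Ck_on 0 UNIV \<phi>" by (auto simp only: test_fun_def)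
  hence *: "\<And>x. GDERIV \<phi> x :> grad \<phi> x" "\<And>b. b \<in> Basis \<Longrightarrow> continuous_on UNIV (\<lambda>x. grad \<phi> x \<bullet> b)"
     "continuous_on UNIV \<phi>"
    unfolding Ck_on_Suc_iff by auto
  show "GDERIV \<phi> x :> grad \<phi> x" "continuous_on UNIV \<phi>" using * by blast+
  show "continuous_on UNIV (grad \<phi>)" using * by (subst continuous_on_componentwise) auto
  show "compact (closure {x. \<phi> x \<noteq> 0})" "closure {x. \<phi> x \<noteq> 0} \<subseteq> S" using assms by (auto simp: test_fun_def)
  show 0: "\<phi> x = 0" if "x \<notin> closure {x. \<phi> x \<noteq> 0}" for x
    using that closure_subset[of "{x. \<phi> x \<noteq> 0}"] by auto
  show "grad \<phi> x = 0" if "x \<notin> closure {x. \<phi> x \<noteq> 0}" for x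
    by (rule gradient_zero_outside[OF *(1) closed_closure 0 that])
qed

text \<open>The gradient of the product with a test function, extended by zero, is continuous with
  compact support, so its partial derivatives integrate to zero. The lemma serves the space
  variables and, on an interval, the time variable.\<close>

lemma weak_deriv_C1:
  fixes u :: "'a::euclidean_space \<Rightarrow> real"
  assumes S: "open S" and u: "\<And>x. x \<in> S \<Longrightarrow> GDERIV u x :> G x" "continuous_on S G" and b: "b \<in> Basis"
  shows "weak_deriv S b u (\<lambda>x. G x \<bullet> b)"
  unfolding weak_deriv_def
proof (intro allI impI)
  fix \<phi> assume \<phi>0: "test_fun S \<phi>"
  define K where "K = closure {x. \<phi> x \<noteq> 0}"
  note \<phi> = test_fun_C1[OF \<phi>0, folded K_def]
  have cu: "continuous_on S u" using u(1) by (auto intro!: continuous_at_imp_continuous_on GDERIV_continuous)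
  define F where "F x = u x *\<^sub>R grad \<phi> x + \<phi> x *\<^sub>R G x" for x
  have c1: "continuous_on UNIV (\<lambda>x. if x \<in> S then u x * (grad \<phi> x \<bullet> b) else 0)"
    by (rule continuous_extend_zero[OF S \<phi>(4,5)])
      (auto intro!: continuous_intros cu continuous_on_subset[OF \<phi>(2)] simp: \<phi>(7))
  have c2: "continuous_on UNIV (\<lambda>x. if x \<in> S then (G x \<bullet> b) * \<phi> x else 0)"
    by (rule continuous_extend_zero[OF S \<phi>(4,5)])
      (auto intro!: continuous_intros u(2) continuous_on_subset[OF \<phi>(3)] simp: \<phi>(6))
  have i: "integrable lborel (\<lambda>x. if x \<in> S then u x * (grad \<phi> x \<bullet> b) else 0)"
     "integrable lborel (\<lambda>x. if x \<in> S then (G x \<bullet> b) * \<phi> x else 0)"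
    by (rule integrable_continuous_compact_support[OF _ \<phi>(4)]; use c1 c2 \<phi>(6,7) in auto)+
  have P: "GDERIV (\<lambda>x. u x * \<phi> x) x :> F x" if "x \<in> S" for x
    unfolding F_def by (rule GDERIV_mult[OF u(1)[OF that] \<phi>(1)])
  have Q: "continuous_on S F"
    unfolding F_def by (intro continuous_intros cu u(2) continuous_on_subset[OF \<phi>(3)] continuous_on_subset[OF \<phi>(2)]) auto
  have "(LINT x|lborel. (if x \<in> S then F x else 0) \<bullet> b) = 0"
    by (rule integral_partial_derivative_zero[OF C1_extend_zero(1,2)[OF S \<phi>(4,5) P Q] \<phi>(4)])
      (use \<phi>(6) b in auto)
  also have "(\<lambda>x. (if x \<in> S then F x else 0) \<bullet> b) = (\<lambda>x. (if x \<in> S then u x * (grad \<phi> x \<bullet> b) else 0) +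
      (if x \<in> S then (G x \<bullet> b) * \<phi> x else 0))"
    by (auto simp: F_def inner_add_left)
  also have "(LINT x|lborel. \<dots> x) = (LINT x|lborel. (if x \<in> S then u x * (grad \<phi> x \<bullet> b) else 0)) +
     (LINT x|lborel. (if x \<in> S then (G x \<bullet> b) * \<phi> x else 0))"
    by (rule Bochner_Integration.integral_add[OF i])
  also have "\<dots> = (LINT x|lebesgue_on S. u x * (grad \<phi> x \<bullet> b)) + (LINT x|lebesgue_on S. (G x \<bullet> b) * \<phi> x)"
    by (simp add: integral_lebesgue_on_lborel[OF S] borel_measurable_continuous_onI c1 c2)
  finally show "(LINT x|lebesgue_on S. u x * (grad \<phi> x \<bullet> b)) = - (LINT x|lebesgue_on S. (G x \<bullet> b) * \<phi> x)"
    by simp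
qed

section \<open>Integrals over bounded open sets\<close>

lemma finite_measure_lebesgue_on_bounded:
  "open S \<Longrightarrow> bounded S \<Longrightarrow> finite_measure (lebesgue_on (S::'a::euclidean_space set))"
  by (intro finite_measure_lebesgue_on bounded_set_imp_lmeasurable) auto

lemma integrable_continuous_bounded:
  fixes f :: "'a::euclidean_space \<Rightarrow> 'b::euclidean_space"
  assumes "open S" "bounded S" "continuous_on S f" "\<And>x. x \<in> S \<Longrightarrow> norm (f x) \<le> B"
  shows "integrable (lebesgue_on S) f"
proof -
  interpret finite_measure "lebesgue_on S" by (rule finite_measure_lebesgue_on_bounded) fact+
  show ?thesis
    by (rule integrable_const_bound[of _ B])
      (use assms in \<open>auto intro: continuous_imp_measurable_on_sets_lebesgue\<close>)
qed

lemma integrable_continuous_closure: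
  fixes f :: "'a::euclidean_space \<Rightarrow> 'b::euclidean_space"
  assumes "open S" "bounded S" "continuous_on (closure S) f"
  shows "integrable (lebesgue_on S) f"
proof -
  have "compact (closure S)" using assms by (simp add: compact_closure)
  hence "bounded (f ` closure S)" using assms compact_continuous_image compact_imp_bounded by blast
  then obtain B where "\<And>x. x \<in> closure S \<Longrightarrow> norm (f x) \<le> B" by (auto simp: bounded_iff)
  thus ?thesis
    by (intro integrable_continuous_bounded[where B=B])
      (use assms continuous_on_subset closure_subset in \<open>blast+\<close>)
qed

lemma Lp_imp_integrable:
  assumes "open S" "bounded S" "p \<ge> 1" "Lp p S u"
  shows "integrable (lebesgue_on S) u"
proof -
  interpret finite_measure "lebesgue_on S" by (rule finite_measure_lebesgue_on_bounded) fact+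
  show ?thesis
  proof (rule Bochner_Integration.integrable_bound[of _ "\<lambda>x. 1 + \<bar>u x\<bar> powr p"])
    show "integrable (lebesgue_on S) (\<lambda>x. 1 + \<bar>u x\<bar> powr p)"
      using assms(4) by (auto simp: Lp_def)
    show "u \<in> borel_measurable (lebesgue_on S)" using assms(4) by (auto simp: Lp_def)
    have "\<bar>y\<bar> \<le> 1 + \<bar>y\<bar> powr p" for y :: real
    proof (cases "\<bar>y\<bar> \<le> 1")
      case True
      thus ?thesis using powr_ge_zero[of "\<bar>y\<bar>" p] by linarith
    next
      case False
      hence "\<bar>y\<bar> powr 1 \<le> \<bar>y\<bar> powr p" using assms(3) by (intro powr_mono) auto
      thus ?thesis using False by simp
    qed
    thus "AE x in lebesgue_on S. norm (u x) \<le> norm (1 + \<bar>u x\<bar> powr p)"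
      by (auto intro!: AE_I2)
  qed
qed

lemma integrable_times_continuous:
  fixes w :: "'a::euclidean_space \<Rightarrow> real"
  assumes S: "open S" and w: "integrable (lebesgue_on S) w" and f: "continuous_on S f" "\<And>x. x \<in> S \<Longrightarrow> \<bar>f x\<bar> \<le> B"
  shows "integrable (lebesgue_on S) (\<lambda>x. w x * f x)"
proof (rule Bochner_Integration.integrable_bound[of _ "\<lambda>x. \<bar>B\<bar> * \<bar>w x\<bar>"])
  have [measurable]: "f \<in> borel_measurable (lebesgue_on S)"
    using S f(1) by (auto intro: continuous_imp_measurable_on_sets_lebesgue)
  show "(\<lambda>x. w x * f x) \<in> borel_measurable (lebesgue_on S)" using w by measurable
  show "AE x in lebesgue_on S. norm (w x * f x) \<le> norm (\<bar>B\<bar> * \<bar>w x\<bar>)"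
  proof (rule AE_I2)
    fix x assume "x \<in> space (lebesgue_on S)"
    hence "\<bar>f x\<bar> \<le> \<bar>B\<bar>" using f(2)[of x] by auto
    thus "norm (w x * f x) \<le> norm (\<bar>B\<bar> * \<bar>w x\<bar>)"
      using mult_mono[of "\<bar>w x\<bar>" "\<bar>w x\<bar>" "\<bar>f x\<bar>" "\<bar>B\<bar>"] by (auto simp: abs_mult mult.commute)
  qed
qed (use w in auto)

lemma bounded_compact_support:
  fixes f :: "'a::euclidean_space \<Rightarrow> 'b::real_normed_vector"
  assumes "continuous_on UNIV f" "compact K" "\<And>x. x \<notin> K \<Longrightarrow> f x = 0"
  obtains B where "\<And>x. norm (f x) \<le> B" "B \<ge> 0"
proof -
  have "bounded (f ` K)" using assms continuous_on_subset[OF assms(1)] by (intro compact_imp_bounded compact_continuous_image) auto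
  then obtain B where B: "\<And>x. x \<in> K \<Longrightarrow> norm (f x) \<le> B" by (auto simp: bounded_iff)
  have "norm (f x) \<le> max B 0" for x using B[of x] assms(3)[of x] by (cases "x \<in> K") auto
  thus ?thesis using that[of "max B 0"] by auto
qed

text \<open>Fundamental lemma of the calculus of variations. Mollification replaces test functions
  by continuous functions of compact support, dominated convergence replaces these by indicators of
  compact sets, and inner regularity exhausts the sets where \<open>w\<close> has a sign.\<close>

lemma test_fun_integrals_zero_imp_AE_zero:
  fixes w :: "'a::euclidean_space \<Rightarrow> real"
  assumes S: "open S" "bounded S" and w: "integrable (lebesgue_on S) w"
    and z: "\<And>\<phi>. test_fun S \<phi> \<Longrightarrow> (LINT x|lebesgue_on S. w x * \<phi> x) = 0"
  shows "AE x in lebesgue_on S. w x = 0"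
proof -
  have step1: "(LINT x|lebesgue_on S. w x * f x) = 0"
    if f: "continuous_on UNIV f" "compact K" "K \<subseteq> S" "\<And>x. x \<notin> K \<Longrightarrow> f x = 0" for f K
  proof -
    obtain K' where K': "\<And>f e. \<lbrakk>continuous_on UNIV f; \<And>x. x \<notin> K \<Longrightarrow> f x = 0; e > 0\<rbrakk> \<Longrightarrow>
      \<exists>\<phi>. test_fun S \<phi> \<and> (\<forall>x. \<bar>\<phi> x - f x\<bar> \<le> e)"
      by (rule mollify[OF S(1) f(2,3)]) metis
    have "\<bar>LINT x|lebesgue_on S. w x * f x\<bar> \<le> 0 + e" if "e > 0" for e
    proof -
      define A where "A = (LINT x|lebesgue_on S. \<bar>w x\<bar>)"
      have A: "A \<ge> 0" unfolding A_def by simp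
      obtain \<phi> where \<phi>: "test_fun S \<phi>" "\<forall>x. \<bar>\<phi> x - f x\<bar> \<le> e / (A + 1)"
        using K'[OF f(1) f(4), of "e / (A + 1)"] A \<open>e > 0\<close> by auto
      define K2 where "K2 = closure {x. \<phi> x \<noteq> 0}"
      note t = test_fun_C1[OF \<phi>(1), folded K2_def]
      obtain B1 where B1: "\<And>x. norm (f x) \<le> B1" using bounded_compact_support[OF f(1,2,4)] by metis
      obtain B2 where B2: "\<And>x. norm (\<phi> x) \<le> B2" using bounded_compact_support[OF t(3,4,6)] by metis
      have i: "integrable (lebesgue_on S) (\<lambda>x. w x * f x)" "integrable (lebesgue_on S) (\<lambda>x. w x * \<phi> x)"
        by (rule integrable_times_continuous[OF S(1) w continuous_on_subset[OF f(1)]], use B1 in auto)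
          (rule integrable_times_continuous[OF S(1) w continuous_on_subset[OF t(3)]], use B2 in auto)
      have "(LINT x|lebesgue_on S. w x * f x) = (LINT x|lebesgue_on S. w x * f x) - (LINT x|lebesgue_on S. w x * \<phi> x)"
        using z[OF \<phi>(1)] by simp
      also have "\<dots> = (LINT x|lebesgue_on S. w x * f x - w x * \<phi> x)" using i by simp
      also have "\<bar>\<dots>\<bar> \<le> (LINT x|lebesgue_on S. \<bar>w x * f x - w x * \<phi> x\<bar>)" by (rule integral_abs_bound)
      also have "\<dots> \<le> (LINT x|lebesgue_on S. \<bar>w x\<bar> * (e / (A + 1)))"
      proof (rule integral_mono)
        fix x
        have "\<bar>w x * f x - w x * \<phi> x\<bar> = \<bar>w x\<bar> * \<bar>\<phi> x - f x\<bar>"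
          by (simp add: right_diff_distrib[symmetric] abs_mult abs_minus_commute)
        also have "\<dots> \<le> \<bar>w x\<bar> * (e / (A + 1))" using \<phi>(2) by (intro mult_left_mono) auto
        finally show "\<bar>w x * f x - w x * \<phi> x\<bar> \<le> \<bar>w x\<bar> * (e / (A + 1))" .
      qed (use i w in \<open>auto intro!: integrable_abs Bochner_Integration.integrable_diff integrable_mult_left\<close>)
      also have "\<dots> = A * (e / (A + 1))" by (simp add: A_def)
      also have "\<dots> \<le> e" using A \<open>e > 0\<close> by (simp add: field_simps)
      finally show ?thesis by simp
    qed
    hence "\<bar>LINT x|lebesgue_on S. w x * f x\<bar> \<le> 0" by (rule field_le_epsilon)
    thus ?thesis by simp
  qed
  have step2: "(LINT x|lebesgue_on S. w x * indicator K x) = 0" if K: "compact K" "K \<subseteq> S" "K \<noteq> {}" for K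
  proof -
    obtain d where d: "d > 0" "{x + y |x y. x \<in> K \<and> y \<in> cball (0::'a) d} \<subseteq> S"
    proof -
      have "closed (- S)" "K \<inter> - S = {}" using S K(2) by auto
      then obtain d where d: "d > 0" "\<And>x y. x \<in> K \<Longrightarrow> y \<notin> S \<Longrightarrow> d \<le> dist x y"
        using separate_compact_closed[OF K(1), of "- S"] by blast
      show ?thesis
      proof (rule that[of "d/2"])
        show "{x + y |x y. x \<in> K \<and> y \<in> cball 0 (d/2)} \<subseteq> S"
        proof clarify
          fix x y :: 'a assume "x \<in> K" "y \<in> cball 0 (d/2)"
          thus "x + y \<in> S" using d(1) d(2)[of x "x + y"] by (auto simp: dist_norm)
        qed
      qed (use d in auto)
    qed
    define L where "L = {x + y |x y. x \<in> K \<and> y \<in> cball (0::'a) d}"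
    have L: "compact L" "L \<subseteq> S" unfolding L_def using d compact_sums[OF K(1) compact_cball, of 0 d] by blast+
    obtain m :: nat where m: "1 / d \<le> real m" using real_arch_simple by blast
    \<comment> \<open>The offset \<open>m\<close> makes the slope at least \<open>1 / d\<close>
      already for \<open>n = 0\<close>, so every \<open>f n\<close> vanishes outside
      \<open>L\<close>.\<close>
    define f where "f n x = max 0 (1 - real (n + m) * infdist x K)" for n x
    have cf: "continuous_on A (f n)" for n A unfolding f_def by (intro continuous_intros)
    have f0: "f n x = 0" if "x \<notin> L" for n x
    proof -
      obtain y where y: "y \<in> K" "infdist x K = dist x y"
        using infdist_attains_inf[OF compact_imp_closed[OF K(1)] K(3), of x] by auto
      have "\<not> norm (x - y) \<le> d"
      proof
        assume "norm (x - y) \<le> d"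
        hence "y + (x - y) \<in> L" unfolding L_def using y(1) by (intro CollectI exI[of _ y] exI[of _ "x - y"]) auto
        thus False using that by simp
      qed
      hence "1 / d * d \<le> real (n + m) * infdist x K"
        using m d(1) y(2) by (intro mult_mono) (auto simp: dist_norm)
      thus ?thesis using d(1) by (simp add: f_def)
    qed
    have fb: "\<bar>f n x\<bar> \<le> 1" for n x using infdist_nonneg[of x K] by (auto simp: f_def)
    have "(\<lambda>n. LINT x|lebesgue_on S. w x * f n x) \<longlonglongrightarrow> (LINT x|lebesgue_on S. w x * indicator K x)"
    proof (rule integral_dominated_convergence[where w="\<lambda>x. \<bar>w x\<bar>"])
      have [measurable]: "f n \<in> borel_measurable (lebesgue_on S)" for n
        using S(1) cf by (auto intro: continuous_imp_measurable_on_sets_lebesgue)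
      have [measurable]: "w \<in> borel_measurable (lebesgue_on S)" using w by auto
      have KL: "K \<in> sets lebesgue" using compact_imp_closed[OF K(1)] by simp
      hence [measurable]: "K \<in> sets (lebesgue_on S)" using S(1) K(2) by (auto simp: sets_restrict_space_iff)
      show "(\<lambda>x. w x * indicator K x) \<in> borel_measurable (lebesgue_on S)" by measurable
      show "(\<lambda>x. w x * f i x) \<in> borel_measurable (lebesgue_on S)" for i by measurable
      show "integrable (lebesgue_on S) (\<lambda>x. \<bar>w x\<bar>)" using w by auto
      show "AE x in lebesgue_on S. norm (w x * f i x) \<le> \<bar>w x\<bar>" for i
        using fb by (auto intro!: AE_I2 simp: abs_mult mult_left_le)
      have "(\<lambda>n. f n x) \<longlonglongrightarrow> indicator K x" for x
      proof (cases "x \<in> K")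
        case True
        hence "f n x = 1" for n by (simp add: f_def)
        thus ?thesis using True by simp
      next
        case False
        hence pos: "infdist x K > 0"
          using infdist_pos_not_in_closed[OF compact_imp_closed[OF K(1)] K(3)] by auto
        obtain n0 :: nat where n0: "1 / infdist x K \<le> real n0" using real_arch_simple by blast
        have "f n x = 0" if "n \<ge> n0" for n
        proof -
          have "1 / infdist x K * infdist x K \<le> real (n + m) * infdist x K"
            using n0 that pos by (intro mult_right_mono) auto
          thus ?thesis using pos by (simp add: f_def)
        qed
        hence "(\<lambda>n. f n x) \<longlonglongrightarrow> 0"
          by (intro tendsto_eventually) (auto simp: eventually_sequentially)
        thus ?thesis using False by simp
      qed
      thus "AE x in lebesgue_on S. (\<lambda>i. w x * f i x) \<longlonglongrightarrow> w x * indicator K x"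
        by (intro AE_I2 tendsto_mult tendsto_const)
    qed
    moreover have "(LINT x|lebesgue_on S. w x * f n x) = 0" for n
      by (rule step1[OF cf L f0])
    ultimately show ?thesis by (simp add: LIMSEQ_const_iff)
  qed
  have step3: "AE x in lebesgue_on S. \<not> w' x > 0"
    if w': "w' = w \<or> w' = (\<lambda>x. - w x)" for w'
  proof -
    have wi: "integrable (lebesgue_on S) w'" using w w' by auto
    have wK: "(LINT x|lebesgue_on S. w' x * indicator K x) = 0" if "compact K" "K \<subseteq> S" for K
      using step2[OF that] w' by (cases "K = {}") auto
    define P where "P = {x \<in> S. w' x > 0}"
    have [measurable]: "w' \<in> borel_measurable (lebesgue_on S)" using wi by auto
    have "{x \<in> space (lebesgue_on S). w' x > 0} \<in> sets (lebesgue_on S)" by measurable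
    hence PS: "P \<in> sets (lebesgue_on S)" by (simp add: P_def)
    hence P: "P \<in> sets lebesgue" using S(1) by (auto simp: sets_restrict_space_iff)
    have "negligible P" unfolding negligible_outer
    proof (intro allI impI)
      fix e :: real assume "e > 0"
      \<comment> \<open>On a closed \<open>T\<close> inside \<open>P\<close> the integral of
        \<open>w'\<close> is zero although the integrand is positive. Hence \<open>T\<close> is null
        and \<open>P\<close> inherits the small measure of \<open>P - T\<close>.\<close>
      obtain T where T: "closed T" "T \<subseteq> P" "P - T \<in> lmeasurable" "emeasure lebesgue (P - T) < ennreal e"
        using sets_lebesgue_inner_closed[OF P \<open>e > 0\<close>] .
      have TS: "T \<subseteq> S" using T(2) by (auto simp: P_def)
      have cT: "compact T" using T(1) bounded_subset[OF S(2) TS] by (simp add: compact_eq_bounded_closed)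
      have TL: "T \<in> sets (lebesgue_on S)" using T(1) TS S(1) by (auto simp: sets_restrict_space_iff)
      have "integrable (lebesgue_on S) (\<lambda>x. w' x * indicator T x)"
        by (rule integrable_mult_indicator[OF TL wi, unfolded real_scaleR_def, simplified mult.commute])
      moreover have nn: "AE x in lebesgue_on S. 0 \<le> w' x * indicator T x"
        using T(2) by (auto intro!: AE_I2 simp: indicator_def P_def)
      ultimately have "AE x in lebesgue_on S. w' x * indicator T x = 0"
        using integral_nonneg_eq_0_iff_AE wK[OF cT TS] by blast
      hence "AE x in lebesgue_on S. x \<notin> T"
        by eventually_elim (use T(2) in \<open>auto simp: P_def indicator_def split: if_splits\<close>)
      hence "T \<in> null_sets (lebesgue_on S)" using TL by (simp add: AE_iff_null_sets)
      hence "T \<in> null_sets lebesgue" using S(1) by (auto simp: null_sets_restrict_space)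
      hence "measure lebesgue ((P - T) \<union> T) = measure lebesgue (P - T)"
        using T(3) by (intro measure_Un_null_set) auto
      moreover have "(P - T) \<union> T = P" using T(2) by auto
      moreover have "P \<in> lmeasurable" using P S(2)
        by (auto intro!: bounded_set_imp_lmeasurable bounded_subset[OF S(2)] simp: P_def)
      moreover have "measure lebesgue (P - T) < e"
        by (metis T(3,4) emeasure_eq_measure2 ennreal_less_iff measure_nonneg)
      ultimately show "\<exists>T. P \<subseteq> T \<and> T \<in> lmeasurable \<and> measure lebesgue T < e" by auto
    qed
    hence "P \<in> null_sets lebesgue" by (simp add: negligible_iff_null_sets)
    hence "P \<in> null_sets (lebesgue_on S)" using S(1) by (auto simp: null_sets_restrict_space P_def)
    thus ?thesis by (rule AE_I') (auto simp: P_def)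
  qed
  have "AE x in lebesgue_on S. \<not> w x > 0" "AE x in lebesgue_on S. \<not> - w x > 0"
    by (intro step3 disjI1 disjI2 refl)+
  thus ?thesis by eventually_elim simp
qed

text \<open>Two weak derivatives pair equally with all test functions. This identifies the
  unspecified function in the trace condition with a component of the classical gradient.\<close>

lemma weak_deriv_C1_unique:
  fixes u :: "'a::euclidean_space \<Rightarrow> real"
  assumes S: "open S" "bounded S" and u: "\<And>x. x \<in> S \<Longrightarrow> GDERIV u x :> G x" "continuous_on (closure S) G"
    and b: "b \<in> Basis" and w: "weak_deriv S b u w" "integrable (lebesgue_on S) w"
  shows "AE x in lebesgue_on S. w x = G x \<bullet> b"
proof -
  have iG: "integrable (lebesgue_on S) (\<lambda>x. G x \<bullet> b)"
    by (rule integrable_continuous_closure[OF S]) (intro continuous_intros u(2))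
  have "AE x in lebesgue_on S. w x - G x \<bullet> b = 0"
  proof (rule test_fun_integrals_zero_imp_AE_zero[OF S])
    fix \<phi> assume \<phi>: "test_fun S \<phi>"
    define K2 where "K2 = closure {x. \<phi> x \<noteq> 0}"
    note t = test_fun_C1[OF \<phi>, folded K2_def]
    obtain B where B: "\<And>x. norm (\<phi> x) \<le> B" using bounded_compact_support[OF t(3,4,6)] by metis
    have i: "integrable (lebesgue_on S) (\<lambda>x. w x * \<phi> x)" "integrable (lebesgue_on S) (\<lambda>x. (G x \<bullet> b) * \<phi> x)"
      by (rule integrable_times_continuous[OF S(1) _ continuous_on_subset[OF t(3)]], use B w(2) iG in auto)+
    have "(LINT x|lebesgue_on S. (w x - G x \<bullet> b) * \<phi> x) =
        (LINT x|lebesgue_on S. w x * \<phi> x) - (LINT x|lebesgue_on S. (G x \<bullet> b) * \<phi> x)"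
      using i by (simp add: left_diff_distrib)
    also have "\<dots> = 0"
    proof -
      have "weak_deriv S b u (\<lambda>x. G x \<bullet> b)"
        by (rule weak_deriv_C1[OF S(1) u(1) continuous_on_subset[OF u(2) closure_subset] b])
      thus ?thesis using w(1) \<phi> by (simp add: weak_deriv_def)
    qed
    finally show "(LINT x|lebesgue_on S. (w x - G x \<bullet> b) * \<phi> x) = 0" .
  qed (use w iG in auto)
  thus ?thesis by eventually_elim simp
qed

section \<open>Boundary charts and Sobolev traces\<close>

lemma ennreal_tendsto_zeroI:
  fixes f :: "'b \<Rightarrow> ennreal"
  assumes "\<And>e::real. e > 0 \<Longrightarrow> eventually (\<lambda>n. f n \<le> ennreal e) F"
  shows "(f \<longlongrightarrow> 0) F"
proof (rule order_tendstoI)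
  fix a :: ennreal assume "0 < a"
  then obtain y where y: "0 < y" "y < a" using dense by blast
  hence "y < top" by (simp add: less_top order_less_le_trans)
  then obtain e where e: "y = ennreal e" "e \<ge> 0" by (cases y) auto
  hence "e > 0" using y(1) by (simp add: ennreal_less_zero_iff)
  from assms[OF this] show "eventually (\<lambda>n. f n < a) F"
    by eventually_elim (use e y(2) in auto)
qed simp

lemma ennreal_tendsto_zeroD:
  fixes f :: "'b \<Rightarrow> ennreal"
  assumes "(f \<longlongrightarrow> 0) F" "e > 0"
  shows "eventually (\<lambda>n. f n < ennreal e) F"
  using order_tendstoD(2)[OF assms(1), of "ennreal e"] assms(2) by simp

text \<open>Along a subsequence whose integrals are below \<open>2^-n\<close> the series of the
  functions has finite integral, so it converges almost everywhere and its terms tend to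
  zero.\<close>

lemma nn_integral_tendsto_zero_AE_subseq:
  fixes f :: "nat \<Rightarrow> 'a \<Rightarrow> ennreal"
  assumes [measurable]: "\<And>n. f n \<in> borel_measurable M"
    and lim: "(\<lambda>n. \<integral>\<^sup>+x. f n x \<partial>M) \<longlonglongrightarrow> 0"
  obtains r :: "nat \<Rightarrow> nat" where "strict_mono r" "AE x in M. (\<lambda>n. f (r n) x) \<longlonglongrightarrow> 0"
proof -
  have "\<exists>m>k. (\<integral>\<^sup>+x. f m x \<partial>M) < ennreal ((1/2) ^ n)" for k n
  proof -
    have "eventually (\<lambda>m. m > k \<and> (\<integral>\<^sup>+x. f m x \<partial>M) < ennreal ((1/2) ^ n)) sequentially"
      by (intro eventually_conj eventually_gt_at_top ennreal_tendsto_zeroD[OF lim]) auto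
    thus ?thesis by (auto simp: eventually_sequentially)
  qed
  hence "\<exists>r. \<forall>n. (\<integral>\<^sup>+x. f (r n) x \<partial>M) < ennreal ((1/2) ^ n) \<and> r n < r (Suc n)"
    using dependent_nat_choice[of "\<lambda>n m. (\<integral>\<^sup>+x. f m x \<partial>M) < ennreal ((1/2) ^ n)" "\<lambda>_ m m'. m < m'"] by metis
  then obtain r where r: "\<And>n. (\<integral>\<^sup>+x. f (r n) x \<partial>M) < ennreal ((1/2) ^ n)" "\<And>n. r n < r (Suc n)" by blast
  have "(\<integral>\<^sup>+x. (\<Sum>n. f (r n) x) \<partial>M) = (\<Sum>n. \<integral>\<^sup>+x. f (r n) x \<partial>M)"
    by (rule nn_integral_suminf) simp
  also have "\<dots> \<le> (\<Sum>n. ennreal ((1/2) ^ n))" using r(1) by (intro suminf_le) (auto intro: less_imp_le)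
  also have "\<dots> = ennreal 2" by (rule suminf_ennreal_eq) (use geometric_sums[of "1/2::real"] in auto)
  finally have "(\<integral>\<^sup>+x. (\<Sum>n. f (r n) x) \<partial>M) \<noteq> \<infinity>" by (auto simp: top_unique)
  hence "AE x in M. (\<Sum>n. f (r n) x) \<noteq> \<infinity>" by (intro nn_integral_PInf_AE) auto
  hence "AE x in M. (\<lambda>n. f (r n) x) \<longlonglongrightarrow> 0"
  proof eventually_elim
    case (elim x)
    have fin: "f (r n) x \<noteq> top" for n
      using sum_le_suminf[of "\<lambda>n. f (r n) x" "{n}"] elim by (auto simp: top_unique)
    hence eq: "f (r n) x = ennreal (enn2real (f (r n) x))" for n using fin[of n] by (simp add: ennreal_enn2real_if)
    have "summable (\<lambda>n. enn2real (f (r n) x))"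
      by (rule summable_suminf_not_top) (use elim eq in auto)
    from summable_LIMSEQ_zero[OF this] have "(\<lambda>n. ennreal (enn2real (f (r n) x))) \<longlonglongrightarrow> ennreal 0"
      by (rule tendsto_ennrealI)
    thus ?case using eq by simp
  qed
  thus ?thesis using that[of r] r(2) by (auto simp: strict_mono_Suc_iff)
qed

text \<open>Averaging over translates along \<open>e\<close> replaces the splitting of the space
  into lines and a hyperplane: by Fubini and translation invariance the double integral is
  \<open>2 R\<close> times the original one. The bad lines are then described by a null set of base
  points in the full space.\<close>

lemma AE_lines_subseq:
  fixes f :: "nat \<Rightarrow> 'a::euclidean_space \<Rightarrow> ennreal"
  assumes [measurable]: "\<And>n. f n \<in> borel_measurable borel"
    and lim: "(\<lambda>n. \<integral>\<^sup>+x. f n x \<partial>lborel) \<longlonglongrightarrow> 0" and R: "R > 0"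
  obtains r :: "nat \<Rightarrow> nat" where "strict_mono r"
    "AE x in lborel. (\<lambda>n. \<integral>\<^sup>+t. f (r n) (x + t *\<^sub>R e) * indicator {-R..R} t \<partial>lborel) \<longlonglongrightarrow> 0"
proof -
  define F where "F n x = (\<integral>\<^sup>+t. f n (x + t *\<^sub>R e) * indicator {-R..R} t \<partial>lborel)" for n x
  have [measurable]: "F n \<in> borel_measurable lborel" for n unfolding F_def by measurable
  have "(\<integral>\<^sup>+x. F n x \<partial>lborel) = ennreal (2 * R) * (\<integral>\<^sup>+x. f n x \<partial>lborel)" for n
  proof -
    have "(\<integral>\<^sup>+x. F n x \<partial>lborel) =
      (\<integral>\<^sup>+t. (\<integral>\<^sup>+x. f n (x + t *\<^sub>R e) * indicator {-R..R} t \<partial>lborel) \<partial>lborel)"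
      unfolding F_def by (rule lborel_pair.Fubini'[symmetric]) measurable
    also have "\<dots> = (\<integral>\<^sup>+t. (\<integral>\<^sup>+x. f n x \<partial>lborel) * indicator {-R..R} t \<partial>lborel)"
    proof (intro nn_integral_cong)
      fix t
      have "(\<integral>\<^sup>+x. f n (x + t *\<^sub>R e) * indicator {-R..R} t \<partial>lborel) =
          (\<integral>\<^sup>+x. f n (t *\<^sub>R e + x) \<partial>lborel) * indicator {-R..R} t"
        by (subst nn_integral_multc) (auto simp: add.commute)
      also have "(\<integral>\<^sup>+x. f n (t *\<^sub>R e + x) \<partial>lborel) = (\<integral>\<^sup>+x. f n x \<partial>distr lborel borel ((+) (t *\<^sub>R e)))"
        by (subst nn_integral_distr) auto
      finally show "(\<integral>\<^sup>+x. f n (x + t *\<^sub>R e) * indicator {-R..R} t \<partial>lborel) =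
          (\<integral>\<^sup>+x. f n x \<partial>lborel) * indicator {-R..R} t" by (simp add: lborel_distr_plus)
    qed
    also have "\<dots> = ennreal (2 * R) * (\<integral>\<^sup>+x. f n x \<partial>lborel)"
      using R by (subst nn_integral_cmult_indicator) (auto simp: mult.commute)
    finally show ?thesis .
  qed
  hence "(\<lambda>n. \<integral>\<^sup>+x. F n x \<partial>lborel) = (\<lambda>n. ennreal (2 * R) * (\<integral>\<^sup>+x. f n x \<partial>lborel))" by auto
  moreover have "(\<lambda>n. ennreal (2 * R) * (\<integral>\<^sup>+x. f n x \<partial>lborel)) \<longlonglongrightarrow> ennreal (2 * R) * 0"
    by (rule ennreal_tendsto_cmult[OF _ lim]) simp
  ultimately have "(\<lambda>n. \<integral>\<^sup>+x. F n x \<partial>lborel) \<longlonglongrightarrow> 0" by simp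
  from nn_integral_tendsto_zero_AE_subseq[OF _ this]
  obtain r :: "nat \<Rightarrow> nat" where "strict_mono r" "AE x in lborel. (\<lambda>n. F (r n) x) \<longlonglongrightarrow> 0" by auto
  thus ?thesis using that unfolding F_def by blast
qed

text \<open>A set of diameter \<open>D \<le> 1\<close> is swept out along a segment of fixed length inside about \<open>1 / D\<close>
  balls of radius \<open>2 D\<close>, so one power of the diameter is lost.\<close>

lemma emeasure_cylinder_cover:
  fixes C :: "'a::euclidean_space set"
  assumes C: "c \<in> C" "bounded C" "diameter C \<le> D" and D: "0 < D" "D \<le> 1" and e: "norm e = 1" and R: "R > 0"
  obtains T where "T \<in> sets borel" "\<And>a t. a \<in> C \<Longrightarrow> \<bar>t\<bar> \<le> R \<Longrightarrow> a + t *\<^sub>R e \<in> T"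
    "emeasure lborel T \<le> ennreal ((2 * R + 3) * unit_ball_vol DIM('a) * 2 ^ DIM('a) * D ^ (DIM('a) - 1))"
proof -
  \<comment> \<open>Centres sit at spacing \<open>D\<close> along the segment. The radius
    \<open>2 D\<close> adds the diameter bound of \<open>C\<close> and the error of rounding
    \<open>t\<close> to a multiple of \<open>D\<close>.\<close>
  define K where "K = \<lceil>R / D\<rceil>"
  have "- 1 < R / D" using divide_pos_pos[OF R D(1)] by linarith
  hence K0: "K \<ge> 0" by (simp add: K_def)
  define T where "T = (\<Union>k\<in>{-K..K}. cball (c + (k * D) *\<^sub>R e) (2 * D))"
  show ?thesis
  proof (rule that[of T])
    show "T \<in> sets borel" unfolding T_def by (intro borel_closed closed_UN) auto
    show "a + t *\<^sub>R e \<in> T" if a: "a \<in> C" and t: "\<bar>t\<bar> \<le> R" for a t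
    proof -
      define k where "k = \<lfloor>t / D\<rfloor>"
      have k: "k * D \<le> t" "t \<le> (k + 1) * D"
      proof -
        have "k \<le> t / D" "t / D \<le> k + 1" unfolding k_def by linarith+
        thus "k * D \<le> t" "t \<le> (k + 1) * D" using D(1) by (simp_all add: pos_le_divide_eq pos_divide_le_eq)
      qed
      have "t / D \<le> R / D" "- (R / D) \<le> t / D" using t D(1) by (auto simp: field_simps abs_le_iff)
      hence "k \<in> {-K..K}" unfolding k_def K_def
        by (auto intro: floor_mono ceiling_mono) (linarith+)
      moreover have "dist (c + (k * D) *\<^sub>R e) (a + t *\<^sub>R e) \<le> 2 * D"
      proof -
        have "dist (c + (k * D) *\<^sub>R e) (a + t *\<^sub>R e) = norm ((c - a) + (k * D - t) *\<^sub>R e)"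
          by (simp add: dist_norm algebra_simps)
        also have "\<dots> \<le> norm (c - a) + norm ((k * D - t) *\<^sub>R e)" by (rule norm_triangle_ineq)
        also have "norm (c - a) \<le> D"
          using diameter_bounded_bound[OF C(2,1) a] C(3) by (simp add: dist_norm)
        also have "norm ((k * D - t) *\<^sub>R e) = \<bar>k * D - t\<bar>" using e by simp
        also have "\<bar>k * D - t\<bar> \<le> D" using k by (auto simp: abs_le_iff algebra_simps)
        finally show ?thesis by simp
      qed
      ultimately show ?thesis by (auto simp: T_def)
    qed
    have DD: "D * D ^ (DIM('a) - 1) = D ^ DIM('a)"
      using power_Suc[of D "DIM('a) - 1"] by simp
    let ?w = "unit_ball_vol DIM('a)"
    have "emeasure lborel T \<le> (\<Sum>k\<in>{-K..K}. emeasure lborel (cball (c + (k * D) *\<^sub>R e) (2 * D)))"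
      unfolding T_def by (rule emeasure_subadditive_finite) auto
    also have "\<dots> = (\<Sum>k\<in>{-K..K}. ennreal (?w * (2 * D) ^ DIM('a)))"
      using D by (simp add: emeasure_cball)
    also have "\<dots> = ennreal ((2 * K + 1) * (?w * (2 * D) ^ DIM('a)))"
    proof -
      have "real (nat (1 + 2 * K)) = 2 * real_of_int K + 1" using K0 by simp
      thus ?thesis using K0 D by (simp add: ennreal_mult' ennreal_of_nat_eq_real_of_nat mult.commute add.commute)
    qed
    also have "\<dots> \<le> ennreal ((2 * R + 3) * ?w * 2 ^ DIM('a) * D ^ (DIM('a) - 1))"
    proof (rule ennreal_leI)
      \<comment> \<open>There are \<open>2 K + 1\<close> balls, at most \<open>2 R / D + 3\<close>,
        and \<open>D \<le> 1\<close> turns this into \<open>(2 R + 3) / D\<close>. This is the lost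
        power of \<open>D\<close>.\<close>
      have "(2 * real_of_int K + 1) * D \<le> (2 * (R / D + 1) + 1) * D"
      proof (rule mult_right_mono)
        have "real_of_int K \<le> R / D + 1" unfolding K_def by (rule of_int_ceiling_le_add_one)
        thus "2 * real_of_int K + 1 \<le> 2 * (R / D + 1) + 1"
          by (intro add_right_mono mult_left_mono) simp_all
      qed (use D in simp)
      also have "\<dots> \<le> 2 * R + 3" using D by (simp add: field_simps)
      finally have *: "(2 * real_of_int K + 1) * D \<le> 2 * R + 3" .
      have "(2 * K + 1) * (?w * (2 * D) ^ DIM('a)) = ((2 * real_of_int K + 1) * D) * (?w * 2 ^ DIM('a) * D ^ (DIM('a) - 1))"
        by (simp add: power_mult_distrib DD[symmetric])
      also have "\<dots> \<le> (2 * R + 3) * (?w * 2 ^ DIM('a) * D ^ (DIM('a) - 1))"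
        using D by (intro mult_right_mono *) auto
      finally show "(2 * K + 1) * (?w * (2 * D) ^ DIM('a)) \<le> (2 * R + 3) * ?w * 2 ^ DIM('a) * D ^ (DIM('a) - 1)"
        by (simp add: mult.assoc)
    qed
    finally show "emeasure lborel T \<le> ennreal ((2 * R + 3) * ?w * 2 ^ DIM('a) * D ^ (DIM('a) - 1))" .
  qed
qed

text \<open>A cover of \<open>A\<close> whose diameters have a small sum of powers
  \<open>DIM('a) - 1\<close> yields, set by set, a cover of the cylinder of comparably small
  Lebesgue measure. This stands in for an area formula on the boundary graph.\<close>

lemma negligible_cylinder:
  fixes A :: "'a::euclidean_space set"
  assumes d: "DIM('a) \<ge> 2" and A: "hausdorff_outer (DIM('a) - 1) A = 0" and e: "norm e = 1" and R: "R > 0"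
  shows "negligible {a + t *\<^sub>R e |a t. a \<in> A \<and> \<bar>t\<bar> \<le> R}"
  unfolding negligible_outer
proof (intro allI impI)
  fix \<epsilon> :: real assume \<epsilon>: "\<epsilon> > 0"
  define m where "m = DIM('a) - 1"
  have m: "m \<ge> 1" using d by (simp add: m_def)
  define C0 where "C0 = (2 * R + 3) * unit_ball_vol DIM('a) * 2 ^ DIM('a)"
  have C0: "C0 > 0" unfolding C0_def using R by (auto intro!: mult_pos_pos)
  \<comment> \<open>\<open>\<kappa>\<close> times the power of the diameter is the weight in
    \<open>hausdorff_pre\<close>, and \<open>C0\<close> is the constant of the cylinder estimate.
    With \<open>\<delta>\<close> and \<open>\<eta>\<close> as below, the two error sums are at most
    \<open>\<epsilon> / 4\<close> each.\<close>
  define \<kappa> where "\<kappa> = unit_ball_vol (real m) / 2 ^ m"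
  have \<kappa>: "\<kappa> > 0" by (simp add: \<kappa>_def)
  define \<delta> where "\<delta> = min 1 (\<epsilon> / (4 * C0))"
  have \<delta>: "\<delta> > 0" "\<delta> \<le> 1" "C0 * \<delta> \<le> \<epsilon> / 4" using \<epsilon> C0 by (auto simp: \<delta>_def min_def field_simps)
  define \<eta> where "\<eta> = \<epsilon> * \<kappa> / (4 * C0)"
  have \<eta>: "\<eta> > 0" "C0 / \<kappa> * \<eta> = \<epsilon> / 4" using \<epsilon> C0 \<kappa> by (auto simp: \<eta>_def)
  have "hausdorff_pre m 1 A \<le> 0" using hausdorff_pre_le_outer[of 1 m A] A by (simp add: m_def)
  hence "hausdorff_pre m 1 A < ennreal \<eta>" using \<eta>(1) by (simp add: order_le_less_trans)
  then obtain C where C: "A \<subseteq> (\<Union>n. C n)" "\<And>n. bounded (C n)" "\<And>n. diameter (C n) \<le> 1"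
      "(\<Sum>n. ennreal (unit_ball_vol (real m) * (diameter (C n) / 2) ^ m)) < ennreal \<eta>"
    unfolding hausdorff_pre_def by (auto simp: INF_less_iff)
  \<comment> \<open>A covering set may have diameter zero, whereas the cylinder estimate wants
    \<open>D > 0\<close>. The summable floor \<open>\<tau> n\<close> repairs this; since
    \<open>m \<ge> 1\<close>, its power \<open>\<tau> n ^ m\<close> is at most
    \<open>\<tau> n\<close>.\<close>
  define \<tau> where "\<tau> n = \<delta> * (1/2) ^ Suc n" for n :: nat
  have \<tau>: "0 < \<tau> n" "\<tau> n \<le> 1" for n
    using \<delta> mult_mono[of \<delta> 1 "(1/2)^Suc n" 1] power_le_one[of "1/2::real" "Suc n"] by (auto simp: \<tau>_def)
  have "\<exists>T. T \<in> sets borel \<and> (\<forall>a t. a \<in> C n \<longrightarrow> \<bar>t\<bar> \<le> R \<longrightarrow> a + t *\<^sub>R e \<in> T) \<and>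
      emeasure lborel T \<le> ennreal (C0 / \<kappa>) * ennreal (unit_ball_vol (real m) * (diameter (C n) / 2) ^ m) + ennreal (C0 * \<tau> n)" for n
  proof (cases "C n = {}")
    case True
    thus ?thesis by (intro exI[of _ "{}"]) auto
  next
    case False
    then obtain c where c: "c \<in> C n" by blast
    define D where "D = max (diameter (C n)) (\<tau> n)"
    have dn: "0 \<le> diameter (C n)" using C(2) by (rule diameter_ge_0)
    obtain T where T: "T \<in> sets borel" "\<And>a t. a \<in> C n \<Longrightarrow> \<bar>t\<bar> \<le> R \<Longrightarrow> a + t *\<^sub>R e \<in> T"
        "emeasure lborel T \<le> ennreal (C0 * D ^ m)"
      unfolding C0_def m_def
      by (rule emeasure_cylinder_cover[OF c C(2), where D=D and e=e and R=R]) (use \<tau>[of n] C(3)[of n] e R in \<open>auto simp: D_def\<close>)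
    have "D ^ m \<le> diameter (C n) ^ m + \<tau> n"
    proof -
      have "\<tau> n ^ m \<le> \<tau> n ^ 1" using m \<tau>[of n] by (intro power_decreasing) auto
      thus ?thesis using zero_le_power[OF dn, of m] \<tau>[of n] unfolding D_def max_def by auto
    qed
    hence "C0 * D ^ m \<le> C0 * (diameter (C n) ^ m + \<tau> n)" using C0 by (intro mult_left_mono) auto
    also have "\<dots> = (C0 / \<kappa>) * (unit_ball_vol (real m) * (diameter (C n) / 2) ^ m) + C0 * \<tau> n"
      using unit_ball_vol_pos[of "real m"] by (simp add: \<kappa>_def field_simps power_divide del: unit_ball_vol_pos)
    finally have "ennreal (C0 * D ^ m) \<le> ennreal ((C0 / \<kappa>) * (unit_ball_vol (real m) * (diameter (C n) / 2) ^ m) + C0 * \<tau> n)"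
      by (rule ennreal_leI)
    also have "\<dots> = ennreal (C0 / \<kappa>) * ennreal (unit_ball_vol (real m) * (diameter (C n) / 2) ^ m) + ennreal (C0 * \<tau> n)"
    proof -
      have "0 \<le> C0 / \<kappa>" "0 \<le> unit_ball_vol (real m) * (diameter (C n) / 2) ^ m" "0 \<le> C0 * \<tau> n"
        using C0 \<kappa> \<tau>[of n] dn by (auto intro!: mult_nonneg_nonneg)
      thus ?thesis by (simp only: ennreal_plus ennreal_mult mult_nonneg_nonneg)
    qed
    finally show ?thesis using T by (intro exI[of _ T]) auto
  qed
  then obtain T where T: "\<And>n. T n \<in> sets borel" "\<And>n a t. a \<in> C n \<Longrightarrow> \<bar>t\<bar> \<le> R \<Longrightarrow> a + t *\<^sub>R e \<in> T n"
      "\<And>n. emeasure lborel (T n) \<le> ennreal (C0 / \<kappa>) * ennreal (unit_ball_vol (real m) * (diameter (C n) / 2) ^ m) + ennreal (C0 * \<tau> n)"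
    by metis
  let ?U = "\<Union>n. T n"
  have U: "?U \<in> sets borel" using T(1) by auto
  have \<tau>s: "(\<Sum>n. ennreal (C0 * \<tau> n)) = ennreal (C0 * \<delta>)"
  proof (rule suminf_ennreal_eq)
    show "0 \<le> C0 * \<tau> n" for n using C0 \<tau>(1)[of n] by simp
    show "(\<lambda>n. C0 * \<tau> n) sums (C0 * \<delta>)"
      using sums_mult[OF power_half_series, of "C0 * \<delta>"] by (simp add: \<tau>_def mult.assoc)
  qed
  have "emeasure lborel ?U \<le> (\<Sum>n. emeasure lborel (T n))"
    using T(1) by (intro emeasure_subadditive_countably) auto
  also have "\<dots> \<le> (\<Sum>n. ennreal (C0 / \<kappa>) * ennreal (unit_ball_vol (real m) * (diameter (C n) / 2) ^ m) + ennreal (C0 * \<tau> n))"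
    by (intro suminf_le T(3)) auto
  also have "\<dots> = ennreal (C0 / \<kappa>) * (\<Sum>n. ennreal (unit_ball_vol (real m) * (diameter (C n) / 2) ^ m)) + ennreal (C0 * \<delta>)"
    by (subst suminf_add[symmetric]) (auto simp: \<tau>s)
  also have "\<dots> \<le> ennreal (C0 / \<kappa>) * ennreal \<eta> + ennreal (\<epsilon> / 4)"
    by (intro add_mono mult_left_mono ennreal_leI less_imp_le[OF C(4)] \<delta>(3)) simp
  also have "\<dots> = ennreal (\<epsilon> / 4 + \<epsilon> / 4)"
    using C0 \<kappa> \<eta> \<epsilon> by (subst ennreal_plus) (auto simp: ennreal_mult[symmetric])
  finally have le: "emeasure lborel ?U \<le> ennreal (\<epsilon> / 4 + \<epsilon> / 4)" .
  have fm: "?U \<in> lmeasurable" using U le by (auto simp: fmeasurable_def top_unique intro: order_le_less_trans)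
  have "measure lebesgue ?U \<le> \<epsilon> / 4 + \<epsilon> / 4"
    unfolding measure_def by (rule enn2real_leI) (use le U \<epsilon> in \<open>simp_all del: ennreal_plus\<close>)
  hence "measure lebesgue ?U < \<epsilon>" using \<epsilon> by linarith
  moreover have "{a + t *\<^sub>R e |a t. a \<in> A \<and> \<bar>t\<bar> \<le> R} \<subseteq> ?U" using C(1) T(2) by blast
  ultimately show "\<exists>T. {a + t *\<^sub>R e |a t. a \<in> A \<and> \<bar>t\<bar> \<le> R} \<subseteq> T \<and> T \<in> lmeasurable \<and> measure lebesgue T < \<epsilon>"
    using fm by blast
qed

lemma sets_hausdorff_measure: "sets (hausdorff_measure k :: 'a::metric_space measure) = sets borel"
  unfolding hausdorff_measure_def
  using sets.sigma_sets_eq[of "borel :: 'a measure"] by (simp add: sets_measure_of)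

text \<open>The exceptional points of the boundary lie in a Borel set of Hausdorff measure zero, so
  the points whose line in direction \<open>e\<close> meets it within distance \<open>R\<close> form
  a null cylinder.\<close>

lemma AE_surface_measure_lines:
  fixes S :: "'a::euclidean_space set"
  assumes d: "DIM('a) \<ge> 2" and P: "AE x in surface_measure S. P x" and e: "norm e = 1" and R: "R > 0"
  shows "AE x in lborel. \<forall>t. \<bar>t\<bar> \<le> R \<longrightarrow> x + t *\<^sub>R e \<in> frontier S \<longrightarrow> P (x + t *\<^sub>R e)"
proof -
  note sb = sets_hausdorff_measure[of "DIM('a) - 1", where 'a='a]
  have sp: "space (hausdorff_measure (DIM('a) - 1) :: 'a measure) = UNIV"
    unfolding hausdorff_measure_def by (simp add: space_measure_of_conv)
  have fr: "frontier S \<in> sets (hausdorff_measure (DIM('a) - 1) :: 'a measure)" unfolding sb by auto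
  have spS: "space (surface_measure S) = frontier S"
    unfolding surface_measure_def space_restrict_space sp by simp
  obtain N where N: "N \<in> null_sets (surface_measure S)" "{x \<in> space (surface_measure S). \<not> P x} \<subseteq> N"
    using P unfolding eventually_ae_filter by auto
  have N': "N \<in> null_sets (hausdorff_measure (DIM('a) - 1))"
    using N(1) fr unfolding surface_measure_def by (subst (asm) null_sets_restrict_space) (auto simp: sp)
  have "N \<in> sets borel" using null_setsD2[OF N'] sb by blast
  hence "hausdorff_outer (DIM('a) - 1) N = 0"
    using null_setsD1[OF N'] emeasure_hausdorff_measure[of "DIM('a) - 1" N] d by simp
  from negligible_cylinder[OF d this e R] have "{a + t *\<^sub>R e |a t. a \<in> N \<and> \<bar>t\<bar> \<le> R} \<in> null_sets lebesgue"
    by (simp add: negligible_iff_null_sets)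
  hence "AE x in lebesgue. \<forall>t. \<bar>t\<bar> \<le> R \<longrightarrow> x + t *\<^sub>R e \<in> frontier S \<longrightarrow> P (x + t *\<^sub>R e)"
  proof (rule AE_I')
    show "{x \<in> space lebesgue. \<not> (\<forall>t. \<bar>t\<bar> \<le> R \<longrightarrow> x + t *\<^sub>R e \<in> frontier S \<longrightarrow> P (x + t *\<^sub>R e))}
        \<subseteq> {a + t *\<^sub>R e |a t. a \<in> N \<and> \<bar>t\<bar> \<le> R}"
    proof
      fix x assume "x \<in> {x \<in> space lebesgue. \<not> (\<forall>t. \<bar>t\<bar> \<le> R \<longrightarrow> x + t *\<^sub>R e \<in> frontier S \<longrightarrow> P (x + t *\<^sub>R e))}"
      then obtain t where t: "\<bar>t\<bar> \<le> R" "x + t *\<^sub>R e \<in> frontier S" "\<not> P (x + t *\<^sub>R e)" by auto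
      hence "x + t *\<^sub>R e \<in> N" using N(2) by (auto simp: spS)
      thus "x \<in> {a + t *\<^sub>R e |a t. a \<in> N \<and> \<bar>t\<bar> \<le> R}" using t(1)
        by (intro CollectI exI[of _ "x + t *\<^sub>R e"] exI[of _ "- t"]) auto
    qed
  qed
  thus ?thesis by (simp add: AE_completion_iff)
qed

text \<open>Hoelder's inequality is replaced by \<open>\<bar>a\<bar> \<le> \<delta> + \<delta> powr
  (1 - p) * \<bar>a\<bar> powr p\<close>: the first term is small because the measure is finite, the
  second tends to zero for fixed \<open>\<delta>\<close>.\<close>

lemma Lp_conv_imp_L1:
  fixes v :: "nat \<Rightarrow> 'a \<Rightarrow> real"
  assumes M: "finite_measure M" and p: "p \<ge> 1" and lim: "Lp_conv p M v u"
    and [measurable]: "\<And>n. v n \<in> borel_measurable M" "u \<in> borel_measurable M"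
  shows "(\<lambda>n. \<integral>\<^sup>+x. ennreal \<bar>v n x - u x\<bar> \<partial>M) \<longlonglongrightarrow> 0"
proof (rule ennreal_tendsto_zeroI)
  fix e :: real assume e: "e > 0"
  interpret finite_measure M by fact
  define m where "m = measure M (space M)"
  have m: "m \<ge> 0" by (simp add: m_def)
  define \<delta> where "\<delta> = e / (2 * (m + 1))"
  have \<delta>: "\<delta> > 0" "\<delta> * m \<le> e / 2" using e m by (auto simp: \<delta>_def field_simps)
  have bd: "\<bar>a\<bar> \<le> \<delta> + \<delta> powr (1 - p) * \<bar>a\<bar> powr p" for a :: real
  proof (cases "\<bar>a\<bar> \<le> \<delta>")
    case True
    moreover have "0 \<le> \<delta> powr (1 - p) * \<bar>a\<bar> powr p" by simp
    ultimately show ?thesis by linarith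
  next
    case False
    have "\<bar>a\<bar> = \<bar>a\<bar> powr (1 - p) * \<bar>a\<bar> powr p" using False \<delta> by (simp add: powr_add[symmetric])
    also have "\<dots> \<le> \<delta> powr (1 - p) * \<bar>a\<bar> powr p"
      using False \<delta> p by (intro mult_right_mono powr_mono2') auto
    finally show ?thesis using \<delta> by linarith
  qed
  have le: "(\<integral>\<^sup>+x. ennreal \<bar>v n x - u x\<bar> \<partial>M) \<le> ennreal (e / 2) +
      ennreal (\<delta> powr (1 - p)) * (\<integral>\<^sup>+x. ennreal (\<bar>v n x - u x\<bar> powr p) \<partial>M)" for n
  proof -
    have "(\<integral>\<^sup>+x. ennreal \<bar>v n x - u x\<bar> \<partial>M) \<le>
        (\<integral>\<^sup>+x. ennreal \<delta> + ennreal (\<delta> powr (1 - p)) * ennreal (\<bar>v n x - u x\<bar> powr p) \<partial>M)"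
    proof (rule nn_integral_mono)
      fix x
      have "ennreal \<bar>v n x - u x\<bar> \<le> ennreal (\<delta> + \<delta> powr (1 - p) * \<bar>v n x - u x\<bar> powr p)"
        by (rule ennreal_leI[OF bd])
      thus "ennreal \<bar>v n x - u x\<bar> \<le> ennreal \<delta> + ennreal (\<delta> powr (1 - p)) * ennreal (\<bar>v n x - u x\<bar> powr p)"
        using \<delta> by (simp add: ennreal_plus ennreal_mult)
    qed
    also have "\<dots> = ennreal \<delta> * emeasure M (space M) +
        ennreal (\<delta> powr (1 - p)) * (\<integral>\<^sup>+x. ennreal (\<bar>v n x - u x\<bar> powr p) \<partial>M)"
      by (subst nn_integral_add) (auto simp: nn_integral_cmult)
    also have "ennreal \<delta> * emeasure M (space M) \<le> ennreal (e / 2)"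
      using \<delta> m by (simp add: emeasure_eq_measure m_def[symmetric] ennreal_mult[symmetric] ennreal_leI)
    finally show ?thesis by (simp add: add_right_mono)
  qed
  have "(\<lambda>n. ennreal (\<delta> powr (1 - p)) * (\<integral>\<^sup>+x. ennreal (\<bar>v n x - u x\<bar> powr p) \<partial>M)) \<longlonglongrightarrow> ennreal (\<delta> powr (1 - p)) * 0"
    using lim by (intro ennreal_tendsto_cmult) (auto simp: Lp_conv_def)
  hence "eventually (\<lambda>n. ennreal (\<delta> powr (1 - p)) * (\<integral>\<^sup>+x. ennreal (\<bar>v n x - u x\<bar> powr p) \<partial>M) < ennreal (e / 2)) sequentially"
    using e by (intro ennreal_tendsto_zeroD) auto
  thus "\<forall>\<^sub>F n in sequentially. (\<integral>\<^sup>+x. ennreal \<bar>v n x - u x\<bar> \<partial>M) \<le> ennreal e"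
  proof eventually_elim
    case (elim n)
    have "ennreal (e / 2) + ennreal (e / 2) = ennreal e" using e by (simp flip: ennreal_plus)
    moreover have "(\<integral>\<^sup>+x. ennreal \<bar>v n x - u x\<bar> \<partial>M) \<le> ennreal (e / 2) + ennreal (e / 2)"
      by (rule order_trans[OF le]) (intro add_left_mono less_imp_le elim)
    ultimately show ?case by simp
  qed
qed

text \<open>The increments of \<open>v n\<close> from the endpoint are integrals of
  \<open>v' n\<close>, which converge in L1, so near the endpoint they are small uniformly for all
  large \<open>n\<close>. If \<open>h\<close> differed from \<open>u 0\<close>, then
  \<open>v n\<close> would stay away from \<open>u\<close> on a fixed interval, against the L1
  convergence.\<close>

lemma trace_on_segment:
  fixes v v' :: "nat \<Rightarrow> real \<Rightarrow> real" and u W :: "real \<Rightarrow> real"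
  assumes \<sigma>: "\<sigma> > 0"
    and v: "\<And>n. continuous_on {0..\<sigma>} (v n)" "\<And>n s. 0 < s \<Longrightarrow> s < \<sigma> \<Longrightarrow> (v n has_real_derivative v' n s) (at s)"
       "\<And>n. continuous_on {0..\<sigma>} (v' n)"
    and u: "continuous_on {0..\<sigma>} u" and h: "(\<lambda>n. v n 0) \<longlonglongrightarrow> h"
    and W: "W \<in> borel_measurable borel"
    and lim: "(\<lambda>n. \<integral>\<^sup>+s. ennreal (\<bar>v n s - u s\<bar> + \<bar>v' n s - W s\<bar>) * indicator {0<..<\<sigma>} s \<partial>lborel) \<longlonglongrightarrow> 0"
  shows "u 0 = h"
proof -
  define \<Phi> where "\<Phi> n = (\<integral>\<^sup>+s. ennreal (\<bar>v n s - u s\<bar> + \<bar>v' n s - W s\<bar>) * indicator {0<..<\<sigma>} s \<partial>lborel)" for n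
  have mb: "(\<lambda>s. indicator {0<..<\<sigma>} s *\<^sub>R f s) \<in> borel_measurable borel" if "continuous_on {0..\<sigma>} f" for f :: "real \<Rightarrow> real"
    by (rule borel_measurable_continuous_on_indicator) (use that continuous_on_subset in \<open>auto intro: continuous_on_subset\<close>)
  note [measurable] = mb[OF v(1)] mb[OF v(3)] mb[OF u] W
  have \<Phi>m: "(\<lambda>s. ennreal (\<bar>v n s - u s\<bar> + \<bar>v' n s - W s\<bar>) * indicator {0<..<\<sigma>} s) \<in> borel_measurable lborel" for n
  proof -
    have eq: "(\<lambda>s. ennreal (\<bar>v n s - u s\<bar> + \<bar>v' n s - W s\<bar>) * indicator {0<..<\<sigma>} s) =
      (\<lambda>s. ennreal (\<bar>indicator {0<..<\<sigma>} s *\<^sub>R v n s - indicator {0<..<\<sigma>} s *\<^sub>R u s\<bar> +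
        \<bar>indicator {0<..<\<sigma>} s *\<^sub>R v' n s - W s\<bar>) * indicator {0<..<\<sigma>} s)"
      by (auto simp: indicator_def)
    show ?thesis unfolding eq by measurable
  qed
  have AEne: "AE s in lborel. s \<noteq> 0 \<and> s \<noteq> \<sigma>" by (intro AE_conjI AE_lborel_singleton)
  have diff: "\<bar>(v n s - v n 0) - (v m s - v m 0)\<bar> \<le> e1 + e2"
    if "\<Phi> n \<le> ennreal e1" "\<Phi> m \<le> ennreal e2" "0 \<le> s" "s \<le> \<sigma>" "e1 > 0" "e2 > 0" for n m s e1 e2
  proof -
    have hi: "((\<lambda>\<tau>. v' k \<tau>) has_integral (v k s - v k 0)) {0..s}" for k
      by (rule fundamental_theorem_of_calculus_interior)
        (use that v(2) continuous_on_subset[OF v(1)] in \<open>auto simp: has_real_derivative_iff_has_vector_derivative[symmetric]\<close>)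
    have c: "continuous_on {0..s} (\<lambda>\<tau>. v' n \<tau> - v' m \<tau>)"
      using that by (intro continuous_intros continuous_on_subset[OF v(3)]) auto
    have ii: "(\<lambda>\<tau>. \<bar>v' n \<tau> - v' m \<tau>\<bar>) integrable_on {0..s}"
      by (intro integrable_continuous_real continuous_intros c)
    have "((\<lambda>\<tau>. v' n \<tau> - v' m \<tau>) has_integral (v n s - v n 0) - (v m s - v m 0)) {0..s}"
      by (intro has_integral_diff hi)
    hence "(v n s - v n 0) - (v m s - v m 0) = integral {0..s} (\<lambda>\<tau>. v' n \<tau> - v' m \<tau>)"
      by (simp add: integral_unique)
    also have "\<bar>\<dots>\<bar> \<le> integral {0..s} (\<lambda>\<tau>. \<bar>v' n \<tau> - v' m \<tau>\<bar>)"
      using integral_norm_bound_integral[of "\<lambda>\<tau>. v' n \<tau> - v' m \<tau>" "{0..s}" "\<lambda>\<tau>. \<bar>v' n \<tau> - v' m \<tau>\<bar>"]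
        integrable_continuous_real[OF c] ii by simp
    finally have "ennreal \<bar>(v n s - v n 0) - (v m s - v m 0)\<bar> \<le> ennreal (integral {0..s} (\<lambda>\<tau>. \<bar>v' n \<tau> - v' m \<tau>\<bar>))"
      by (rule ennreal_leI)
    also have "\<dots> = (\<integral>\<^sup>+\<tau>. ennreal \<bar>v' n \<tau> - v' m \<tau>\<bar> * indicator {0..s} \<tau> \<partial>lborel)"
      by (rule nn_integral_has_integral_lebesgue'[symmetric]) (use ii integrable_integral in auto)
    also have "\<dots> \<le> (\<integral>\<^sup>+\<tau>. ennreal (\<bar>v n \<tau> - u \<tau>\<bar> + \<bar>v' n \<tau> - W \<tau>\<bar>) * indicator {0<..<\<sigma>} \<tau> +
        ennreal (\<bar>v m \<tau> - u \<tau>\<bar> + \<bar>v' m \<tau> - W \<tau>\<bar>) * indicator {0<..<\<sigma>} \<tau> \<partial>lborel)"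
    proof (rule nn_integral_mono_AE)
      show "AE \<tau> in lborel. ennreal \<bar>v' n \<tau> - v' m \<tau>\<bar> * indicator {0..s} \<tau> \<le>
        ennreal (\<bar>v n \<tau> - u \<tau>\<bar> + \<bar>v' n \<tau> - W \<tau>\<bar>) * indicator {0<..<\<sigma>} \<tau> +
        ennreal (\<bar>v m \<tau> - u \<tau>\<bar> + \<bar>v' m \<tau> - W \<tau>\<bar>) * indicator {0<..<\<sigma>} \<tau>"
        using AEne
      proof eventually_elim
        case (elim \<tau>)
        have "ennreal \<bar>v' n \<tau> - v' m \<tau>\<bar> \<le> ennreal ((\<bar>v n \<tau> - u \<tau>\<bar> + \<bar>v' n \<tau> - W \<tau>\<bar>) + (\<bar>v m \<tau> - u \<tau>\<bar> + \<bar>v' m \<tau> - W \<tau>\<bar>))"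
          by (rule ennreal_leI) linarith
        also have "\<dots> = ennreal (\<bar>v n \<tau> - u \<tau>\<bar> + \<bar>v' n \<tau> - W \<tau>\<bar>) + ennreal (\<bar>v m \<tau> - u \<tau>\<bar> + \<bar>v' m \<tau> - W \<tau>\<bar>)"
          by (rule ennreal_plus) auto
        finally show ?case using elim that by (auto simp: indicator_def)
      qed
    qed
    also have "\<dots> = \<Phi> n + \<Phi> m" unfolding \<Phi>_def by (rule nn_integral_add[OF \<Phi>m \<Phi>m])
    also have "\<dots> \<le> ennreal e1 + ennreal e2" using that by (intro add_mono) auto
    also have "\<dots> = ennreal (e1 + e2)" using that by simp
    finally show ?thesis by (rule ennreal_le_iff[THEN iffD1, rotated]) (use that in auto)
  qed
  have "\<bar>u 0 - h\<bar> \<le> 0 + \<epsilon>" if \<epsilon>: "\<epsilon> > 0" for \<epsilon>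
  proof -
    \<comment> \<open>The budget: \<open>3 * e\<close> for the increment of \<open>v n\<close>, one
      \<open>e\<close> each for the increment of \<open>u\<close> and for \<open>v n 0\<close>
      against \<open>h\<close>, one for the L1 argument, and one to spare.\<close>
    define e where "e = \<epsilon> / 7"
    have e: "e > 0" using \<epsilon> by (simp add: e_def)
    have lim': "\<Phi> \<longlonglongrightarrow> 0" using lim by (simp add: \<Phi>_def[abs_def])
    from ennreal_tendsto_zeroD[OF lim' e] obtain M where M: "\<And>n. n \<ge> M \<Longrightarrow> \<Phi> n < ennreal e"
      by (auto simp: eventually_sequentially)
    have c: "continuous_on {0..\<sigma>} (\<lambda>s. \<bar>v M s - v M 0\<bar> + \<bar>u s - u 0\<bar>)" by (intro continuous_intros v u)
    obtain d where d: "d > 0" "\<And>s. s \<in> {0..\<sigma>} \<Longrightarrow> dist s 0 < d \<Longrightarrow> \<bar>v M s - v M 0\<bar> + \<bar>u s - u 0\<bar> < e"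
      using c[unfolded continuous_on_iff, rule_format, of 0 e] e \<sigma> by (auto simp: dist_real_def)
    define s1 where "s1 = min \<sigma> d / 2"
    have s1: "0 < s1" "s1 < \<sigma>" "s1 < d" using d \<sigma> by (auto simp: s1_def min_def)
    \<comment> \<open>Only the fixed index \<open>M\<close> contributes its modulus of continuity,
      so \<open>s1\<close> does not depend on \<open>n\<close>; comparing \<open>n\<close> with
      \<open>M\<close> costs \<open>2 * e\<close>.\<close>
    have near: "\<bar>v n s - v n 0\<bar> \<le> 3 * e" "\<bar>u s - u 0\<bar> \<le> e" if "n \<ge> M" "0 \<le> s" "s \<le> s1" for n s
    proof -
      have "\<bar>(v n s - v n 0) - (v M s - v M 0)\<bar> \<le> e + e"
        using M[OF that(1)] M[of M] that s1 e by (intro diff) auto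
      moreover have "\<bar>v M s - v M 0\<bar> + \<bar>u s - u 0\<bar> < e" using d(2)[of s] that s1 by auto
      ultimately show "\<bar>v n s - v n 0\<bar> \<le> 3 * e" "\<bar>u s - u 0\<bar> \<le> e" by linarith+
    qed
    have "eventually (\<lambda>n. n \<ge> M \<and> \<Phi> n < ennreal (e * s1) \<and> dist (v n 0) h < e) sequentially"
      using s1 e by (intro eventually_conj eventually_ge_at_top ennreal_tendsto_zeroD[OF lim'] tendstoD[OF h]) auto
    then obtain n where n: "n \<ge> M" "\<Phi> n < ennreal (e * s1)" "\<bar>v n 0 - h\<bar> < e"
      by (auto simp: eventually_sequentially dist_real_def)
    \<comment> \<open>\<open>c\<close> is a lower bound for \<open>\<bar>v n s - u s\<bar>\<close>
      on all of \<open>(0, s1)\<close>, while the integral over that interval is below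
      \<open>e * s1\<close>.\<close>
    define c where "c = \<bar>u 0 - h\<bar> - 5 * e"
    have "c \<le> e"
    proof (rule ccontr)
      assume "\<not> c \<le> e"
      hence c: "c > e" by simp
      have "ennreal (c * s1) = (\<integral>\<^sup>+s. ennreal c * indicator {0<..<s1} s \<partial>lborel)"
        using c e s1 by (subst nn_integral_cmult_indicator) (auto simp: ennreal_mult)
      also have "\<dots> \<le> \<Phi> n" unfolding \<Phi>_def
      proof (rule nn_integral_mono)
        fix s
        have "c \<le> \<bar>v n s - u s\<bar> + \<bar>v' n s - W s\<bar>" if "0 < s" "s < s1"
          using near[OF n(1), of s] that n(3) unfolding c_def by linarith
        thus "ennreal c * indicator {0<..<s1} s \<le> ennreal (\<bar>v n s - u s\<bar> + \<bar>v' n s - W s\<bar>) * indicator {0<..<\<sigma>} s"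
          using s1 by (auto simp: indicator_def intro!: ennreal_leI simp del: ennreal_plus)
      qed
      also have "\<dots> < ennreal (e * s1)" by (rule n(2))
      finally have "c * s1 < e * s1" using c e s1 by (simp add: ennreal_less_iff)
      thus False using c s1 by simp
    qed
    thus ?thesis using e by (simp add: c_def e_def)
  qed
  hence "\<bar>u 0 - h\<bar> \<le> 0" by (rule field_le_epsilon)
  thus ?thesis by simp
qed


section \<open>Boundary charts\<close>

definition chart_fun :: "('a::euclidean_space \<Rightarrow> real) \<Rightarrow> 'a \<Rightarrow> 'a \<Rightarrow> real" where
  "chart_fun \<gamma> e x = \<gamma> (x - (x \<bullet> e) *\<^sub>R e) - x \<bullet> e"

text \<open>Along \<open>e\<close> the chart function has slope -1. Hence
  \<open>x + chart_fun \<gamma> e x *\<^sub>R e\<close> is the foot point of \<open>x\<close>, where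
  the line through \<open>x\<close> in direction \<open>e\<close> meets the graph, and a further
  step \<open>s\<close> leads inwards to the level \<open>- s\<close>.\<close>

lemma chart_fun_shift: "norm e = 1 \<Longrightarrow> chart_fun \<gamma> e (x + s *\<^sub>R e) = chart_fun \<gamma> e x - s"
  by (simp add: chart_fun_def inner_add_left algebra_simps dot_square_norm)

lemma Ck_on_inner: "Ck_on k UNIV (\<lambda>x. x \<bullet> e)"
proof (cases k)
  case (Suc j)
  have "GDERIV (\<lambda>x. x \<bullet> e) x :> e" for x
    unfolding gderiv_def by (auto intro!: derivative_eq_intros)
  thus ?thesis unfolding Suc by (rule Ck_on_SucI) (rule Ck_on_const)
qed (auto intro!: continuous_intros)

lemma Ck_on_1_D:
  assumes "Ck_on (Suc 0) UNIV f"
  shows "GDERIV f x :> grad f x" "continuous_on UNIV (grad f)"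
proof -
  have *: "\<And>x. GDERIV f x :> grad f x" "\<And>b. b \<in> Basis \<Longrightarrow> continuous_on UNIV (\<lambda>x. grad f x \<bullet> b)"
    using assms unfolding Ck_on_Suc_iff by auto
  show "GDERIV f x :> grad f x" "continuous_on UNIV (grad f)"
    using * by (auto simp: continuous_on_componentwise[of _ "grad f"])
qed

lemma chart_fun_C1:
  assumes "Ck_on 2 UNIV \<gamma>"
  shows "GDERIV (chart_fun \<gamma> e) x :> grad (chart_fun \<gamma> e) x" "continuous_on UNIV (grad (chart_fun \<gamma> e))"
    "continuous_on A (chart_fun \<gamma> e)"
proof -
  have "Ck_on (Suc (Suc 0)) UNIV \<gamma>" using assms by (simp only: numeral_2_eq_2)
  hence \<gamma>: "Ck_on (Suc 0) UNIV \<gamma>" by (rule Ck_on_Suc_imp)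
  have l: "bounded_linear (\<lambda>x. x - (x \<bullet> e) *\<^sub>R e)"
    by (intro bounded_linear_sub bounded_linear_ident bounded_linear_scaleR_left[THEN bounded_linear_compose] bounded_linear_inner_left)
  have "Ck_on (Suc 0) UNIV (\<lambda>x. \<gamma> (0 + (x - (x \<bullet> e) *\<^sub>R e)) + (-1) * (x \<bullet> e))"
    by (intro Ck_on_add Ck_on_mult Ck_on_const Ck_on_inner Ck_on_affine[OF l] \<gamma>)
  moreover have "(\<lambda>x. \<gamma> (0 + (x - (x \<bullet> e) *\<^sub>R e)) + (-1) * (x \<bullet> e)) = chart_fun \<gamma> e"
    by (auto simp: chart_fun_def)
  ultimately have C: "Ck_on (Suc 0) UNIV (chart_fun \<gamma> e)" by simp
  show "GDERIV (chart_fun \<gamma> e) x :> grad (chart_fun \<gamma> e) x" "continuous_on UNIV (grad (chart_fun \<gamma> e))"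
    using Ck_on_1_D[OF C] by blast+
  show "continuous_on A (chart_fun \<gamma> e)"
    using Ck_on_1_D(1)[OF C] by (auto intro!: continuous_at_imp_continuous_on GDERIV_continuous)
qed

lemma chart_inside:
  assumes "C2_graph_chart S x0 r e \<gamma>" "x \<in> ball x0 r"
  shows "x \<in> S \<longleftrightarrow> chart_fun \<gamma> e x < 0"
proof -
  have "x \<in> S \<longleftrightarrow> x \<bullet> e > \<gamma> (x - (x \<bullet> e) *\<^sub>R e)"
    using assms unfolding C2_graph_chart_def by blast
  thus ?thesis by (simp add: chart_fun_def)
qed

text \<open>Points with positive chart value have a neighbourhood outside \<open>S\<close>; points
  with value zero enter \<open>S\<close> when moved by a small positive multiple of
  \<open>e\<close>.\<close>

lemma chart_frontier:
  assumes S: "open S" and ch: "C2_graph_chart S x0 r e \<gamma>" and x: "x \<in> ball x0 r"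
  shows "x \<in> frontier S \<longleftrightarrow> chart_fun \<gamma> e x = 0"
proof
  have e: "norm e = 1" and \<gamma>: "Ck_on 2 UNIV \<gamma>" using ch by (auto simp: C2_graph_chart_def)
  have fr: "frontier S = closure S - S" using S by (simp add: frontier_def interior_open)
  {
    assume "x \<in> frontier S"
    hence xS: "x \<in> closure S" "x \<notin> S" using fr by auto
    define U where "U = ball x0 r \<inter> chart_fun \<gamma> e -` {0<..}"
    have "open U" unfolding U_def
      by (rule continuous_open_preimage[OF chart_fun_C1(3)[OF \<gamma>]]) auto
    moreover have "U \<inter> S = {}" using chart_inside[OF ch] by (fastforce simp: U_def)
    ultimately have "U \<inter> closure S = {}" using open_Int_closure_eq_empty by blast
    hence "x \<notin> U" using xS by auto
    thus "chart_fun \<gamma> e x = 0" using chart_inside[OF ch x] xS x by (auto simp: U_def)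
  }
  {
    assume 0: "chart_fun \<gamma> e x = 0"
    have "x \<in> closure S" unfolding closure_approachable
    proof (intro allI impI)
      fix \<epsilon> :: real assume \<epsilon>: "\<epsilon> > 0"
      define s where "s = min (\<epsilon> / 2) ((r - dist x0 x) / 2)"
      have s: "s > 0" "s < \<epsilon>" "s < r - dist x0 x" using \<epsilon> x by (auto simp: s_def min_def)
      have "dist x0 (x + s *\<^sub>R e) \<le> dist x0 x + s"
        using dist_triangle[of x0 "x + s *\<^sub>R e" x] s e by (simp add: dist_norm)
      hence "x + s *\<^sub>R e \<in> S"
        using chart_inside[OF ch, of "x + s *\<^sub>R e"] s 0 chart_fun_shift[OF e, of \<gamma> x s] by auto
      moreover have "dist (x + s *\<^sub>R e) x < \<epsilon>" using s e by (simp add: dist_norm)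
      ultimately show "\<exists>y\<in>S. dist y x < \<epsilon>" by blast
    qed
    thus "x \<in> frontier S" using fr chart_inside[OF ch x] 0 by auto
  }
qed

text \<open>\<open>outer_unit_normal\<close> and the pointwise Neumann condition want a chart
  centred at the boundary point in question, so nearby points must inherit the direction and the
  graph on a smaller ball.\<close>

lemma chart_recenter:
  assumes ch: "C2_graph_chart S x0 r e \<gamma>" and y: "y \<in> ball x0 r"
  shows "C2_graph_chart S y (r - dist x0 y) e \<gamma>"
proof -
  have sub: "x \<in> ball x0 r" if "x \<in> ball y (r - dist x0 y)" for x
    using dist_triangle[of x0 x y] that by auto
  have eq: "x \<in> ball x0 r \<Longrightarrow> x \<in> S \<longleftrightarrow> x \<bullet> e > \<gamma> (x - (x \<bullet> e) *\<^sub>R e)" for x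
    using ch unfolding C2_graph_chart_def by blast
  have "S \<inter> ball y (r - dist x0 y) = {x \<in> ball y (r - dist x0 y). x \<bullet> e > \<gamma> (x - (x \<bullet> e) *\<^sub>R e)}"
    using sub eq by blast
  thus ?thesis using ch y unfolding C2_graph_chart_def by simp
qed

section \<open>Traces along transversal lines\<close>

lemma nn_integral_indicator_lebesgue_on:
  fixes a b :: "'a::euclidean_space \<Rightarrow> real"
  assumes "open S"
  shows "(\<integral>\<^sup>+x. ennreal \<bar>indicator S x * a x - indicator S x * b x\<bar> \<partial>lborel) =
    (\<integral>\<^sup>+x. ennreal \<bar>a x - b x\<bar> \<partial>lebesgue_on S)"
proof -
  have "(\<integral>\<^sup>+x. ennreal \<bar>a x - b x\<bar> \<partial>lebesgue_on S) = (\<integral>\<^sup>+x. ennreal \<bar>a x - b x\<bar> * indicator S x \<partial>lebesgue)"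
    by (rule nn_integral_restrict_space) (use assms in auto)
  also have "\<dots> = (\<integral>\<^sup>+x. ennreal \<bar>a x - b x\<bar> * indicator S x \<partial>lborel)" by (rule nn_integral_completion)
  also have "\<dots> = (\<integral>\<^sup>+x. ennreal \<bar>indicator S x * a x - indicator S x * b x\<bar> \<partial>lborel)"
    by (intro nn_integral_cong) (auto simp: indicator_def)
  finally show ?thesis by simp
qed

text \<open>Restrictions of a Lebesgue measurable function to lines need not be measurable, so weak
  derivatives are replaced by Borel functions before lines are considered.\<close>

lemma borel_version_lebesgue_on:
  fixes w :: "'a::euclidean_space \<Rightarrow> real"
  assumes S: "open S" and w: "w \<in> borel_measurable (lebesgue_on S)"
  obtains W where "W \<in> borel_measurable borel" "AE x in lebesgue_on S. w x = W x"
proof -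
  have "(\<lambda>x. indicator S x *\<^sub>R w x) \<in> borel_measurable (completion lborel)"
    using w S by (subst (asm) borel_measurable_restrict_space_iff) auto
  from completion_ex_borel_measurable_real[OF this] obtain W where
    W: "W \<in> borel_measurable lborel" "AE x in lborel. indicator S x *\<^sub>R w x = W x" by blast
  have "AE x in lebesgue. indicator S x *\<^sub>R w x = W x" using W(2) by (rule AE_completion)
  hence "AE x in lebesgue_on S. w x = W x"
    using S by (subst AE_restrict_space_iff) (auto elim!: eventually_mono simp: indicator_def split: if_splits)
  thus ?thesis using that W(1) by simp
qed

text \<open>For almost every \<open>x\<close> the line through \<open>x\<close> in direction
  \<open>e\<close> is good: on it the approximating functions and their gradients converge in L1,
  and at the foot point their values converge to \<open>h\<close>. There
  \<open>trace_on_segment\<close> applies. Labelling lines by points of a full-dimensional ball lets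
  \<open>lborel\<close> measure the bad ones.\<close>

lemma trace_eq_boundary_value:
  fixes S :: "'a::euclidean_space set" and u :: "'a \<Rightarrow> real"
  assumes S: "open S" "bounded S" and d: "DIM('a) \<ge> 2" and p: "p \<ge> 1"
    and ch: "C2_graph_chart S x0 r e \<gamma>" and u: "continuous_on (closure S) u"
    and tr: "sobolev_trace p S w h" and wu: "AE x in lebesgue_on S. w x = u x"
    and \<sigma>: "\<sigma> > 0"
    and dom: "\<And>x s. x \<in> ball x0 \<rho> \<Longrightarrow> 0 \<le> s \<Longrightarrow> s \<le> \<sigma> \<Longrightarrow> x + (chart_fun \<gamma> e x + s) *\<^sub>R e \<in> ball x0 r"
    and small: "\<And>x. x \<in> ball x0 \<rho> \<Longrightarrow> \<bar>chart_fun \<gamma> e x\<bar> \<le> \<sigma>"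
  shows "AE x in lborel. x \<in> ball x0 \<rho> \<longrightarrow> h (x + chart_fun \<gamma> e x *\<^sub>R e) = u (x + chart_fun \<gamma> e x *\<^sub>R e)"
proof -
  have e: "norm e = 1" and \<gamma>: "Ck_on 2 UNIV \<gamma>" using ch by (auto simp: C2_graph_chart_def)
  have fin: "finite_measure (lebesgue_on S)" by (rule finite_measure_lebesgue_on_bounded[OF S])
  from tr obtain v where sob: "sobolev 1 p S w" and hm: "h \<in> borel_measurable (surface_measure S)"
    and v: "\<And>n. C1_closure S (v n)" "Lp_conv p (lebesgue_on S) v w"
    and vb: "\<forall>b\<in>Basis. \<exists>wb. Lp p S wb \<and> Lp_conv p (lebesgue_on S) (\<lambda>n x. grad (v n) x \<bullet> b) wb"
    and vh: "Lp_conv p (surface_measure S) v h"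
    unfolding sobolev_trace_def by blast
  from vb obtain wb where wb: "\<And>b. b \<in> Basis \<Longrightarrow> Lp p S (wb b)"
    "\<And>b. b \<in> Basis \<Longrightarrow> Lp_conv p (lebesgue_on S) (\<lambda>n x. grad (v n) x \<bullet> b) (wb b)" by metis
  from v(1) obtain G where vc: "\<And>n. continuous_on (closure S) (v n)" and
    G: "\<And>n. continuous_on (closure S) (G n)" "\<And>n x. x \<in> S \<Longrightarrow> GDERIV (v n) x :> G n x"
    unfolding C1_closure_def by metis
  have "\<exists>W. W \<in> borel_measurable borel \<and> (AE x in lebesgue_on S. wb b x = W x)" if "b \<in> Basis" for b
    using borel_version_lebesgue_on[OF S(1), of "wb b"] wb(1)[OF that] unfolding Lp_def by metis
  then obtain W where W: "\<And>b. b \<in> Basis \<Longrightarrow> W b \<in> borel_measurable borel"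
    "\<And>b. b \<in> Basis \<Longrightarrow> AE x in lebesgue_on S. wb b x = W b x" by metis
  have cm: "f \<in> borel_measurable (lebesgue_on S)" if "continuous_on (closure S) f" for f :: "'a \<Rightarrow> real"
    using S(1) continuous_on_subset[OF that closure_subset] by (auto intro: continuous_imp_measurable_on_sets_lebesgue)
  have cb: "(\<lambda>x. indicator S x * f x) \<in> borel_measurable borel" if "continuous_on (closure S) f" for f :: "'a \<Rightarrow> real"
    using borel_measurable_continuous_on_indicator[OF _ continuous_on_subset[OF that closure_subset], of ] S(1) by auto
  have cG: "continuous_on (closure S) (\<lambda>x. G n x \<bullet> b)" for n b by (intro continuous_intros G(1))
  have wm: "w \<in> borel_measurable (lebesgue_on S)" using sob by (simp add: Lp_def)
  have lim0: "(\<lambda>n. \<integral>\<^sup>+x. ennreal \<bar>indicator S x * v n x - indicator S x * u x\<bar> \<partial>lborel) \<longlonglongrightarrow> 0"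
  proof -
    have "(\<integral>\<^sup>+x. ennreal \<bar>v n x - w x\<bar> \<partial>lebesgue_on S) = (\<integral>\<^sup>+x. ennreal \<bar>v n x - u x\<bar> \<partial>lebesgue_on S)" for n
      by (rule nn_integral_cong_AE) (use wu in \<open>eventually_elim, simp\<close>)
    thus ?thesis using Lp_conv_imp_L1[OF fin p v(2) cm[OF vc] wm]
      by (simp add: nn_integral_indicator_lebesgue_on[OF S(1)])
  qed
  have lim1: "(\<lambda>n. \<integral>\<^sup>+x. ennreal \<bar>indicator S x * (G n x \<bullet> b) - indicator S x * W b x\<bar> \<partial>lborel) \<longlonglongrightarrow> 0"
    if b: "b \<in> Basis" for b
  proof -
    have g: "grad (v n) x \<bullet> b = G n x \<bullet> b" if "x \<in> space (lebesgue_on S)" for n x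
      using grad_eq[OF G(2), of x n] that by simp
    have "(\<lambda>x. grad (v n) x \<bullet> b) \<in> borel_measurable (lebesgue_on S)" for n
      using cm[OF cG[of n b]] g by (subst measurable_cong[OF g]) auto
    from Lp_conv_imp_L1[OF fin p wb(2)[OF b] this]
    have "(\<lambda>n. \<integral>\<^sup>+x. ennreal \<bar>grad (v n) x \<bullet> b - wb b x\<bar> \<partial>lebesgue_on S) \<longlonglongrightarrow> 0"
      using wb(1)[OF b] by (simp add: Lp_def)
    moreover have "(\<integral>\<^sup>+x. ennreal \<bar>grad (v n) x \<bullet> b - wb b x\<bar> \<partial>lebesgue_on S) =
        (\<integral>\<^sup>+x. ennreal \<bar>G n x \<bullet> b - W b x\<bar> \<partial>lebesgue_on S)" for n
    proof (rule nn_integral_cong_AE)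
      show "AE x in lebesgue_on S. ennreal \<bar>grad (v n) x \<bullet> b - wb b x\<bar> = ennreal \<bar>G n x \<bullet> b - W b x\<bar>"
        using W(2)[OF b] AE_space by eventually_elim (simp only: g)
    qed
    ultimately show ?thesis by (simp add: nn_integral_indicator_lebesgue_on[OF S(1)])
  qed
  \<comment> \<open>Values and all partial derivatives are collected in one function, so that a
    single subsequence serves. The derivative along \<open>e\<close> combines the partial
    derivatives with coefficients of modulus at most one.\<close>
  define f where "f n x = ennreal \<bar>indicator S x * v n x - indicator S x * u x\<bar> +
      (\<Sum>b\<in>Basis. ennreal \<bar>indicator S x * (G n x \<bullet> b) - indicator S x * W b x\<bar>)" for n x
  have fm: "f n \<in> borel_measurable borel" for n
  proof -
    note [measurable] = cb[OF vc[of n]] cb[OF cG[of n]] cb[OF u] W(1)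
    have [measurable]: "S \<in> sets borel" using S(1) by auto
    show ?thesis unfolding f_def by measurable
  qed
  have flim: "(\<lambda>n. \<integral>\<^sup>+x. f n x \<partial>lborel) \<longlonglongrightarrow> 0"
  proof -
    have "(\<integral>\<^sup>+x. f n x \<partial>lborel) = (\<integral>\<^sup>+x. ennreal \<bar>indicator S x * v n x - indicator S x * u x\<bar> \<partial>lborel) +
      (\<Sum>b\<in>Basis. \<integral>\<^sup>+x. ennreal \<bar>indicator S x * (G n x \<bullet> b) - indicator S x * W b x\<bar> \<partial>lborel)" for n
    proof -
      note [measurable] = cb[OF vc[of n]] cb[OF cG[of n]] cb[OF u] W(1)
      have [measurable]: "S \<in> sets borel" using S(1) by auto
      show ?thesis unfolding f_def by (subst nn_integral_add; (subst nn_integral_sum)?) auto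
    qed
    moreover have "(\<lambda>n. (\<integral>\<^sup>+x. ennreal \<bar>indicator S x * v n x - indicator S x * u x\<bar> \<partial>lborel) +
      (\<Sum>b\<in>Basis. \<integral>\<^sup>+x. ennreal \<bar>indicator S x * (G n x \<bullet> b) - indicator S x * W b x\<bar> \<partial>lborel)) \<longlonglongrightarrow>
        0 + (\<Sum>b\<in>(Basis::'a set). 0)"
      by (intro tendsto_add tendsto_sum lim0 lim1)
    ultimately show ?thesis by simp
  qed
  have sm: "f \<in> borel_measurable (surface_measure S)" if "continuous_on (closure S) f" for f :: "'a \<Rightarrow> real"
  proof -
    note sb = sets_hausdorff_measure[of "DIM('a) - 1", where 'a='a]
    have "f \<in> borel_measurable (restrict_space borel (frontier S))"
      by (rule borel_measurable_continuous_on_restrict, rule continuous_on_subset[OF that])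
        (simp add: frontier_def)
    thus ?thesis unfolding surface_measure_def
      using measurable_cong_sets[OF sets_restrict_space_cong[OF sb] refl] by blast
  qed
  obtain r1 :: "nat \<Rightarrow> nat" where r1: "strict_mono r1"
    "AE x in surface_measure S. (\<lambda>n. ennreal (\<bar>v (r1 n) x - h x\<bar> powr p)) \<longlonglongrightarrow> 0"
  proof (rule nn_integral_tendsto_zero_AE_subseq[where M="surface_measure S" and f="\<lambda>n x. ennreal (\<bar>v n x - h x\<bar> powr p)"])
    note [measurable] = sm[OF vc] hm
    show "(\<lambda>x. ennreal (\<bar>v n x - h x\<bar> powr p)) \<in> borel_measurable (surface_measure S)" for n by measurable
    show "(\<lambda>n. \<integral>\<^sup>+x. ennreal (\<bar>v n x - h x\<bar> powr p) \<partial>surface_measure S) \<longlonglongrightarrow> 0"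
      using vh by (simp add: Lp_conv_def)
  qed blast
  have "AE x in surface_measure S. (\<lambda>n. v (r1 n) x) \<longlonglongrightarrow> h x"
    using r1(2)
  proof eventually_elim
    case (elim x)
    hence "(\<lambda>n. \<bar>v (r1 n) x - h x\<bar> powr p) \<longlonglongrightarrow> 0"
      using tendsto_ennreal_iff[of "\<lambda>n. \<bar>v (r1 n) x - h x\<bar> powr p" sequentially 0] by simp
    hence "(\<lambda>n. (\<bar>v (r1 n) x - h x\<bar> powr p) powr (1/p)) \<longlonglongrightarrow> 0 powr (1/p)"
      using p by (intro tendsto_powr') (auto intro: always_eventually)
    hence "(\<lambda>n. \<bar>v (r1 n) x - h x\<bar>) \<longlonglongrightarrow> 0" using p by (simp add: powr_powr)
    thus ?case using LIM_zero_cancel tendsto_rabs_zero_iff by blast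
  qed
  \<comment> \<open>The foot point has parameter \<open>c\<close> with
    \<open>\<bar>c\<bar> \<le> \<sigma>\<close>, and the segment behind it has length
    \<open>\<sigma>\<close>, so the window \<open>2 * \<sigma>\<close> contains all of it.\<close>
  from AE_surface_measure_lines[OF d this e, of "2 * \<sigma>"] \<sigma>
  have A: "AE x in lborel. \<forall>t. \<bar>t\<bar> \<le> 2 * \<sigma> \<longrightarrow> x + t *\<^sub>R e \<in> frontier S \<longrightarrow> (\<lambda>n. v (r1 n) (x + t *\<^sub>R e)) \<longlonglongrightarrow> h (x + t *\<^sub>R e)"
    by simp
  have "(\<lambda>n. \<integral>\<^sup>+x. f (r1 n) x \<partial>lborel) \<longlonglongrightarrow> 0"
    using LIMSEQ_subseq_LIMSEQ[OF flim r1(1)] by (simp add: o_def)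
  from AE_lines_subseq[OF fm this, of "2 * \<sigma>" e] \<sigma> obtain r2 :: "nat \<Rightarrow> nat" where r2: "strict_mono r2"
    and B: "AE x in lborel. (\<lambda>n. \<integral>\<^sup>+t. f (r1 (r2 n)) (x + t *\<^sub>R e) * indicator {-(2*\<sigma>)..2*\<sigma>} t \<partial>lborel) \<longlonglongrightarrow> 0"
    by auto
  show ?thesis using A B
  proof eventually_elim
    case (elim x)
    show ?case
    proof
      assume x: "x \<in> ball x0 \<rho>"
      define c where "c = chart_fun \<gamma> e x"
      define q where "q = x + c *\<^sub>R e"
      have qs: "q + s *\<^sub>R e = x + (c + s) *\<^sub>R e" for s by (simp add: q_def scaleR_add_left)
      have chq: "chart_fun \<gamma> e (q + s *\<^sub>R e) = - s" for s
        using chart_fun_shift[OF e, of \<gamma> x "c + s"] by (simp add: qs c_def)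
      have inb: "q + s *\<^sub>R e \<in> ball x0 r" if "0 \<le> s" "s \<le> \<sigma>" for s
        using dom[OF x that] by (simp add: qs c_def)
      have qf: "q \<in> frontier S" using chart_frontier[OF S(1) ch inb[of 0]] chq[of 0] \<sigma> by simp
      have qS: "q + s *\<^sub>R e \<in> S" if "0 < s" "s \<le> \<sigma>" for s
        using chart_inside[OF ch inb[of s]] chq[of s] that by simp
      have qc: "q + s *\<^sub>R e \<in> closure S" if "0 \<le> s" "s \<le> \<sigma>" for s
        using qS[of s] that closure_subset[of S] qf by (cases "s = 0") (auto simp: frontier_def)
      have ccl: "continuous_on {0..\<sigma>} (\<lambda>s. f (q + s *\<^sub>R e))" if "continuous_on (closure S) f" for f :: "'a \<Rightarrow> real"
        by (rule continuous_on_compose2[OF that]) (auto intro!: continuous_intros qc)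
      have csm: "\<bar>c\<bar> \<le> \<sigma>" using small[OF x] by (simp add: c_def)
      have "(\<lambda>s. u (q + s *\<^sub>R e)) 0 = h q"
      proof (rule trace_on_segment[OF \<sigma>])
        show "continuous_on {0..\<sigma>} (\<lambda>s. v (r1 (r2 n)) (q + s *\<^sub>R e))" for n by (rule ccl[OF vc])
        show "continuous_on {0..\<sigma>} (\<lambda>s. G (r1 (r2 n)) (q + s *\<^sub>R e) \<bullet> e)" for n
          by (rule ccl) (intro continuous_intros G(1))
        show "continuous_on {0..\<sigma>} (\<lambda>s. u (q + s *\<^sub>R e))" by (rule ccl[OF u])
        show "((\<lambda>s. v (r1 (r2 n)) (q + s *\<^sub>R e)) has_real_derivative G (r1 (r2 n)) (q + s *\<^sub>R e) \<bullet> e) (at s)"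
          if "0 < s" "s < \<sigma>" for n s
        proof -
          have "((\<lambda>s. q + s *\<^sub>R e) has_derivative (\<lambda>h. h *\<^sub>R e)) (at s)"
            by (auto intro!: derivative_eq_intros)
          moreover have "(v (r1 (r2 n)) has_derivative (\<lambda>h. h \<bullet> G (r1 (r2 n)) (q + s *\<^sub>R e))) (at (q + s *\<^sub>R e))"
            using G(2)[OF qS[of s]] that by (simp add: gderiv_def)
          ultimately have "((\<lambda>s. v (r1 (r2 n)) (q + s *\<^sub>R e)) has_derivative
              (\<lambda>h. (h *\<^sub>R e) \<bullet> G (r1 (r2 n)) (q + s *\<^sub>R e))) (at s)"
            by (rule has_derivative_compose)
          thus ?thesis by (simp add: has_field_derivative_def inner_commute mult_commute_abs)
        qed
        have "(\<lambda>n. v (r1 n) q) \<longlonglongrightarrow> h q"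
          using elim(1) csm qf \<sigma> by (auto simp: q_def)
        from LIMSEQ_subseq_LIMSEQ[OF this r2]
        show "(\<lambda>n. v (r1 (r2 n)) (q + 0 *\<^sub>R e)) \<longlonglongrightarrow> h q" by (simp add: o_def)
        show "(\<lambda>s. \<Sum>b\<in>Basis. (e \<bullet> b) * W b (q + s *\<^sub>R e)) \<in> borel_measurable borel"
          using W(1) by measurable
        have le: "(\<integral>\<^sup>+s. ennreal (\<bar>v (r1 (r2 n)) (q + s *\<^sub>R e) - u (q + s *\<^sub>R e)\<bar> +
            \<bar>G (r1 (r2 n)) (q + s *\<^sub>R e) \<bullet> e - (\<Sum>b\<in>Basis. (e \<bullet> b) * W b (q + s *\<^sub>R e))\<bar>) * indicator {0<..<\<sigma>} s \<partial>lborel)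
          \<le> (\<integral>\<^sup>+t. f (r1 (r2 n)) (x + t *\<^sub>R e) * indicator {-(2*\<sigma>)..2*\<sigma>} t \<partial>lborel)" for n
        proof -
          note [measurable] = fm
          \<comment> \<open>Shifting the line parameter by \<open>c\<close> makes the segment start
            at the foot point.\<close>
          define m where "m = r1 (r2 n)"
          have "(\<integral>\<^sup>+t. f m (x + t *\<^sub>R e) * indicator {-(2*\<sigma>)..2*\<sigma>} t \<partial>lborel) =
            (\<integral>\<^sup>+t. f m (x + t *\<^sub>R e) * indicator {-(2*\<sigma>)..2*\<sigma>} t \<partial>distr lborel borel ((+) c))"
            by (simp add: lborel_distr_plus)
          also have "\<dots> = (\<integral>\<^sup>+s. f m (q + s *\<^sub>R e) * indicator {-(2*\<sigma>)..2*\<sigma>} (c + s) \<partial>lborel)"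
            unfolding qs by (rule nn_integral_distr) measurable
          finally have eq: "(\<integral>\<^sup>+t. f m (x + t *\<^sub>R e) * indicator {-(2*\<sigma>)..2*\<sigma>} t \<partial>lborel) =
            (\<integral>\<^sup>+s. f m (q + s *\<^sub>R e) * indicator {-(2*\<sigma>)..2*\<sigma>} (c + s) \<partial>lborel)" .
          show ?thesis unfolding m_def[symmetric] eq
          proof (rule nn_integral_mono)
            fix s
            show "ennreal (\<bar>v m (q + s *\<^sub>R e) - u (q + s *\<^sub>R e)\<bar> +
                \<bar>G m (q + s *\<^sub>R e) \<bullet> e - (\<Sum>b\<in>Basis. (e \<bullet> b) * W b (q + s *\<^sub>R e))\<bar>) * indicator {0<..<\<sigma>} s
              \<le> f m (q + s *\<^sub>R e) * indicator {-(2*\<sigma>)..2*\<sigma>} (c + s)"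
            proof (cases "0 < s \<and> s < \<sigma>")
              case True
              let ?y = "q + s *\<^sub>R e"
              have y: "?y \<in> S" using qS True by auto
              have "G m ?y \<bullet> e = (\<Sum>b\<in>Basis. (e \<bullet> b) * (G m ?y \<bullet> b))"
                by (subst euclidean_inner) (simp add: mult.commute)
              hence "\<bar>G m ?y \<bullet> e - (\<Sum>b\<in>Basis. (e \<bullet> b) * W b ?y)\<bar> = \<bar>\<Sum>b\<in>Basis. (e \<bullet> b) * (G m ?y \<bullet> b - W b ?y)\<bar>"
                by (simp add: sum_subtractf right_diff_distrib)
              also have "\<dots> \<le> (\<Sum>b\<in>Basis. \<bar>(e \<bullet> b) * (G m ?y \<bullet> b - W b ?y)\<bar>)" by (rule sum_abs)
              also have "\<dots> \<le> (\<Sum>b\<in>Basis. \<bar>G m ?y \<bullet> b - W b ?y\<bar>)"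
                using e Basis_le_norm[of _ e] by (intro sum_mono) (auto simp: abs_mult intro!: mult_left_le_one_le)
              finally have "ennreal (\<bar>v m ?y - u ?y\<bar> + \<bar>G m ?y \<bullet> e - (\<Sum>b\<in>Basis. (e \<bullet> b) * W b ?y)\<bar>)
                \<le> ennreal (\<bar>v m ?y - u ?y\<bar> + (\<Sum>b\<in>Basis. \<bar>G m ?y \<bullet> b - W b ?y\<bar>))"
                by (intro ennreal_leI) simp
              also have "\<dots> = f m ?y" using y by (simp add: f_def sum_nonneg)
              finally show ?thesis using True csm by (simp add: indicator_def abs_le_iff)
            next
              case False
              hence "s \<notin> {0<..<\<sigma>}" by simp
              thus ?thesis by simp
            qed
          qed
        qed
        show "(\<lambda>n. \<integral>\<^sup>+s. ennreal (\<bar>v (r1 (r2 n)) (q + s *\<^sub>R e) - u (q + s *\<^sub>R e)\<bar> +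
            \<bar>G (r1 (r2 n)) (q + s *\<^sub>R e) \<bullet> e - (\<Sum>b\<in>Basis. (e \<bullet> b) * W b (q + s *\<^sub>R e))\<bar>) * indicator {0<..<\<sigma>} s \<partial>lborel)
          \<longlonglongrightarrow> 0"
          by (rule tendsto_sandwich[OF _ _ tendsto_const elim(2)]) (auto intro!: always_eventually le simp del: ennreal_plus)
      qed
      thus "h (x + chart_fun \<gamma> e x *\<^sub>R e) = u (x + chart_fun \<gamma> e x *\<^sub>R e)"
        by (simp add: q_def c_def)
    qed
  qed
qed


text \<open>At the foot points of almost all lines the trace \<open>h\<close> of the weak gradient
  equals \<open>G\<close> and is orthogonal to the chart normal, the normalised gradient of the
  chart function. The continuous function \<open>q\<close> thus vanishes almost everywhere near
  \<open>x0\<close>, and \<open>x0\<close> is its own foot point.\<close>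

lemma neumann_pointwise:
  fixes S :: "'a::euclidean_space set" and u :: "'a \<Rightarrow> real"
  assumes S: "open S" "bounded S" and d: "DIM('a) \<ge> 2" and p: "p \<ge> 1"
    and u: "\<And>x. x \<in> S \<Longrightarrow> GDERIV u x :> G x" "continuous_on (closure S) G"
    and nd: "normal_deriv_zero p S u"
    and ch: "C2_graph_chart S x0 r e \<gamma>" and x0: "x0 \<in> frontier S"
  shows "G x0 \<bullet> grad (chart_fun \<gamma> e) x0 = 0"
proof -
  have r: "r > 0" and e: "norm e = 1" and \<gamma>: "Ck_on 2 UNIV \<gamma>" using ch by (auto simp: C2_graph_chart_def)
  have ch0: "chart_fun \<gamma> e x0 = 0" using chart_frontier[OF S(1) ch, of x0] x0 r by simp
  \<comment> \<open>A base point within \<open>\<sigma>\<close> of \<open>x0\<close>, moved by at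
    most \<open>2 * \<sigma>\<close> along \<open>e\<close>, stays in the chart ball.\<close>
  define \<sigma> where "\<sigma> = r / 4"
  have \<sigma>: "\<sigma> > 0" using r by (simp add: \<sigma>_def)
  obtain \<rho>0 where \<rho>0: "\<rho>0 > 0" "\<And>x. dist x x0 < \<rho>0 \<Longrightarrow> dist (chart_fun \<gamma> e x) (chart_fun \<gamma> e x0) < \<sigma>"
    using chart_fun_C1(3)[OF \<gamma>, of UNIV e, unfolded continuous_on_iff, rule_format, of x0 \<sigma>] \<sigma> by auto
  define \<rho> where "\<rho> = min \<rho>0 \<sigma>"
  have \<rho>: "\<rho> > 0" using \<rho>0 \<sigma> by (simp add: \<rho>_def)
  have small: "\<bar>chart_fun \<gamma> e x\<bar> \<le> \<sigma>" if "x \<in> ball x0 \<rho>" for x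
    using \<rho>0(2)[of x] that ch0 by (auto simp: \<rho>_def dist_commute dist_real_def)
  have dom: "x + (chart_fun \<gamma> e x + s) *\<^sub>R e \<in> ball x0 r" if x: "x \<in> ball x0 \<rho>" and s: "0 \<le> s" "s \<le> \<sigma>" for x s
  proof -
    have "dist x0 (x + (chart_fun \<gamma> e x + s) *\<^sub>R e) \<le> dist x0 x + norm ((chart_fun \<gamma> e x + s) *\<^sub>R e)"
      using dist_triangle[of x0 "x + (chart_fun \<gamma> e x + s) *\<^sub>R e" x] by (simp add: dist_norm)
    also have "norm ((chart_fun \<gamma> e x + s) *\<^sub>R e) \<le> 2 * \<sigma>" using e small[OF x] s by simp
    finally show ?thesis using x r by (auto simp: \<rho>_def \<sigma>_def)
  qed
  define \<pi> where "\<pi> x = x + chart_fun \<gamma> e x *\<^sub>R e" for x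
  have \<pi>b: "\<pi> x \<in> ball x0 r" if "x \<in> ball x0 \<rho>" for x using dom[OF that, of 0] \<sigma> by (simp add: \<pi>_def)
  have \<pi>f: "\<pi> x \<in> frontier S" if "x \<in> ball x0 \<rho>" for x
    using chart_frontier[OF S(1) ch \<pi>b[OF that]] chart_fun_shift[OF e, of \<gamma> x "chart_fun \<gamma> e x"] by (simp add: \<pi>_def)
  obtain h :: "'a \<Rightarrow> 'a" where h: "\<And>b. b \<in> Basis \<Longrightarrow> \<exists>w. weak_deriv S b u w \<and> sobolev_trace p S w (\<lambda>x. h x \<bullet> b)"
    "AE x in surface_measure S. \<forall>\<nu>. outer_unit_normal S x \<nu> \<longrightarrow> h x \<bullet> \<nu> = 0"
    using nd unfolding normal_deriv_zero_def by blast
  have 1: "AE x in lborel. x \<in> ball x0 \<rho> \<longrightarrow> h (\<pi> x) \<bullet> b = G (\<pi> x) \<bullet> b" if b: "b \<in> Basis" for b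
  proof -
    obtain w where w: "weak_deriv S b u w" "sobolev_trace p S w (\<lambda>x. h x \<bullet> b)" using h(1)[OF b] by blast
    have "Lp p S w" using w(2) by (simp add: sobolev_trace_def)
    hence "integrable (lebesgue_on S) w" by (rule Lp_imp_integrable[OF S p])
    from weak_deriv_C1_unique[OF S u b w(1) this]
    show ?thesis unfolding \<pi>_def
      by (intro trace_eq_boundary_value[OF S d p ch _ w(2) _ \<sigma> dom small] continuous_intros u(2))
  qed
  have 2: "AE x in lborel. \<forall>b\<in>Basis. x \<in> ball x0 \<rho> \<longrightarrow> h (\<pi> x) \<bullet> b = G (\<pi> x) \<bullet> b"
    by (rule AE_finite_allI[OF finite_Basis 1])
  have 3: "AE x in lborel. \<forall>t. \<bar>t\<bar> \<le> \<sigma> \<longrightarrow> x + t *\<^sub>R e \<in> frontier S \<longrightarrow>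
      (\<forall>\<nu>. outer_unit_normal S (x + t *\<^sub>R e) \<nu> \<longrightarrow> h (x + t *\<^sub>R e) \<bullet> \<nu> = 0)"
    by (rule AE_surface_measure_lines[OF d h(2) e \<sigma>])
  define q where "q x = G (\<pi> x) \<bullet> grad (chart_fun \<gamma> e) (\<pi> x)" for x
  have "AE x in lborel. x \<in> ball x0 \<rho> \<longrightarrow> q x = 0"
    using 2 3
  proof eventually_elim
    case (elim x)
    show ?case
    proof
      assume x: "x \<in> ball x0 \<rho>"
      have hG: "h (\<pi> x) = G (\<pi> x)" using elim(1) x by (auto intro: euclidean_eqI)
      \<comment> \<open>The boundary condition covers the normals of all charts at the foot point;
        the recentred chart supplies the one built from \<open>\<gamma>\<close> and
        \<open>e\<close>.\<close>
      have "outer_unit_normal S (\<pi> x) (sgn (grad (chart_fun \<gamma> e) (\<pi> x)))"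
        unfolding outer_unit_normal_def chart_fun_def[abs_def]
        using \<pi>f[OF x] chart_recenter[OF ch \<pi>b[OF x]] by blast
      hence "G (\<pi> x) \<bullet> sgn (grad (chart_fun \<gamma> e) (\<pi> x)) = 0"
        using elim(2) small[OF x] \<pi>f[OF x] hG by (auto simp: \<pi>_def)
      thus "q x = 0" unfolding q_def
        by (cases "grad (chart_fun \<gamma> e) (\<pi> x) = 0") (auto simp: sgn_div_norm)
    qed
  qed
  moreover have "continuous_on (ball x0 \<rho>) q"
  proof -
    have c\<pi>: "continuous_on (ball x0 \<rho>) \<pi>" unfolding \<pi>_def
      by (intro continuous_intros chart_fun_C1(3)[OF \<gamma>])
    show ?thesis unfolding q_def
      by (intro continuous_intros continuous_on_compose2[OF u(2) c\<pi>] continuous_on_compose2[OF chart_fun_C1(2)[OF \<gamma>] c\<pi>])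
        (use \<pi>f in \<open>auto simp: frontier_def\<close>)
  qed
  ultimately have "q x0 = 0" by (intro continuous_AE_zero[of "ball x0 \<rho>"]) (use \<rho> in auto)
  thus ?thesis by (simp add: q_def \<pi>_def ch0)
qed

section \<open>The weak formulation up to the boundary\<close>

lemma AE_lebesgue_on_imp_lborel:
  assumes "open S" "AE x in lebesgue_on S. P x"
  shows "AE x in lborel. x \<in> S \<longrightarrow> P x"
  using assms by (simp add: AE_restrict_space_iff AE_completion_iff)

lemma test_funI:
  assumes "\<And>k. Ck_on k UNIV \<phi>" "compact K" "K \<subseteq> S" "\<And>x. x \<notin> K \<Longrightarrow> \<phi> x = 0"
  shows "test_fun S \<phi>"
proof -
  have "closure {x. \<phi> x \<noteq> 0} \<subseteq> K"
    by (rule closure_minimal) (use assms in \<open>auto intro: compact_imp_closed\<close>)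
  thus ?thesis unfolding test_fun_def
    using assms compact_Int_closed[OF assms(2) closed_closure, of "{x. \<phi> x \<noteq> 0}"] by (auto simp: Int_absorb1)
qed

text \<open>The primitive from the left end vanishes before the support of \<open>f\<close>, and
  behind it equals the total integral, which is zero.\<close>

lemma antiderivative_test_fun:
  fixes f :: "real \<Rightarrow> real"
  assumes f: "test_fun {a<..<b} f" and ab: "a < b" and z: "(LINT x|lborel. f x) = 0"
  obtains \<theta> where "test_fun {a<..<b} \<theta>" "\<And>x. deriv \<theta> x = f x"
proof -
  \<comment> \<open>The midpoint keeps \<open>K\<close> nonempty when \<open>f\<close> is zero, so
    that its extreme points exist.\<close>
  define K where "K = insert ((a + b) / 2) (closure {x. f x \<noteq> 0})"
  note t = test_fun_C1[OF f]
  have cf: "continuous_on UNIV f" by (rule t(3))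
  have K: "compact K" "K \<noteq> {}" "K \<subseteq> {a<..<b}" using t(4,5) ab by (auto simp: K_def)
  have fK: "f x = 0" if "x \<notin> K" for x using that closure_subset[of "{x. f x \<noteq> 0}"] by (auto simp: K_def)
  obtain a' where a': "a' \<in> K" "\<And>x. x \<in> K \<Longrightarrow> a' \<le> x" using compact_attains_inf[OF K(1,2)] by blast
  obtain b' where b': "b' \<in> K" "\<And>x. x \<in> K \<Longrightarrow> x \<le> b'" using compact_attains_sup[OF K(1,2)] by blast
  have f0: "f x = 0" if "x < a' \<or> x > b'" for x using fK[of x] a'(2)[of x] b'(2)[of x] that by force
  have ab': "a < a'" "a' \<le> b'" "b' < b" using K(3) a' b' by auto
  define \<theta> where "\<theta> x = integral {a..x} f" for x
  have \<theta>0: "\<theta> x = 0" if "x < a'" for x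
  proof -
    have "\<theta> x = integral {a..x} (\<lambda>_. 0)" unfolding \<theta>_def by (rule integral_cong) (use f0 that in auto)
    thus ?thesis by simp
  qed
  have "integrable lborel f" by (rule integrable_continuous_compact_support[OF cf K(1) fK])
  hence "integral UNIV f = 0" using z by (simp add: integral_lborel)
  hence \<theta>1: "\<theta> x = 0" if "x > b'" for x
  proof -
    have "\<theta> x = integral UNIV (\<lambda>y. if y \<in> {a..x} then f y else 0)"
      unfolding \<theta>_def by (rule integral_restrict_UNIV[symmetric])
    also have "\<dots> = integral UNIV f" by (rule integral_cong) (use f0 that ab' in auto)
    finally show ?thesis using \<open>integral UNIV f = 0\<close> by simp
  qed
  have D: "(\<theta> has_real_derivative f x) (at x)" for x
  proof (cases "x < a'")
    case True
    have "((\<lambda>_. 0) has_real_derivative f x) (at x)" using f0 True by simp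
    thus ?thesis
      by (rule has_field_derivative_transform_within_open[of _ _ _ "{..<a'}"]) (use True \<theta>0 in auto)
  next
    case False
    hence "x \<in> {a<..<x+1}" using ab' by simp
    have "((\<lambda>x. integral {a..x} f) has_vector_derivative f x) (at x within {a..x+1})"
      by (rule integral_has_vector_derivative[OF continuous_on_subset[OF cf]]) (use False ab' in auto)
    hence "((\<lambda>x. integral {a..x} f) has_vector_derivative f x) (at x)"
      using \<open>x \<in> {a<..<x+1}\<close> by (simp add: at_within_Icc_at)
    thus ?thesis by (simp add: \<theta>_def[abs_def] has_real_derivative_iff_has_vector_derivative)
  qed
  have "Ck_on k UNIV \<theta>" for k
  proof (cases k)
    case 0
    thus ?thesis using DERIV_isCont[OF D] by (auto intro!: continuous_at_imp_continuous_on)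
  next
    case (Suc j)
    have "Ck_on j UNIV f" using f by (simp add: test_fun_def)
    thus ?thesis unfolding Suc by (intro Ck_on_SucI[where G=f]) (use D in auto)
  qed
  hence "test_fun {a<..<b} \<theta>"
    by (rule test_funI[where K="{a'..b'}"]) (use ab' \<theta>0 \<theta>1 in force)+
  thus ?thesis using that DERIV_imp_deriv[OF D] by blast
qed

lemma grad_eq_deriv: "test_fun S f \<Longrightarrow> grad f x = deriv f (x::real)"
  using test_fun_C1(1)[of S f x] by (simp add: DERIV_imp_deriv)

text \<open>Du Bois-Reymond's lemma. Subtracting a multiple of one fixed bump \<open>\<rho>0\<close>
  of integral one gives any test function mean zero and so makes it the derivative of a test
  function. The constant value is the average of \<open>M\<close> against
  \<open>\<rho>0\<close>.\<close>

lemma zero_weak_derivative_constant: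
  fixes M :: "real \<Rightarrow> real"
  assumes ab: "a < b" and M: "continuous_on {a..b} M"
    and z: "\<And>\<theta>. test_fun {a<..<b} \<theta> \<Longrightarrow> (LINT t|lebesgue_on {a<..<b}. M t * deriv \<theta> t) = 0"
    and st: "s \<in> {a<..<b}" "t \<in> {a<..<b}"
  shows "M s = M t"
proof -
  let ?I = "{a<..<b}"
  have cl: "closure ?I = {a..b}" using ab by simp
  have iM: "integrable (lebesgue_on ?I) M"
    by (rule integrable_continuous_closure) (use M cl in auto)
  define \<epsilon> where "\<epsilon> = (b - a) / 4"
  define c where "c = (a + b) / 2"
  have \<epsilon>: "\<epsilon> > 0" using ab by (simp add: \<epsilon>_def)
  obtain \<rho> :: "real \<Rightarrow> real" where \<rho>: "\<And>k. Ck_on k UNIV \<rho>" "\<And>x. \<rho> x \<ge> 0"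
    "\<And>x. norm x \<ge> \<epsilon> \<Longrightarrow> \<rho> x = 0" "integrable lborel \<rho>" "(LINT x|lborel. \<rho> x) = 1"
    by (rule mollifier_exists[OF \<epsilon>]) blast
  define \<rho>0 where "\<rho>0 x = \<rho> (- c + x)" for x
  have t\<rho>: "test_fun ?I \<rho>0"
  proof (rule test_funI)
    show "Ck_on k UNIV \<rho>0" for k unfolding \<rho>0_def by (rule Ck_on_affine[OF bounded_linear_ident \<rho>(1)])
    show "\<rho>0 x = 0" if "x \<notin> cball c \<epsilon>" for x using that \<rho>(3)[of "- c + x"] by (auto simp: \<rho>0_def dist_real_def)
    show "cball c \<epsilon> \<subseteq> ?I" using ab by (auto simp: cball_eq_atLeastAtMost c_def \<epsilon>_def field_simps)
  qed simp
  have "(LINT x|lborel. \<rho>0 x) = (LINT x|distr lborel borel ((+) (- c)). \<rho> x)"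
    unfolding \<rho>0_def using \<rho>(4) by (subst integral_distr) auto
  hence i\<rho>: "(LINT x|lborel. \<rho>0 x) = 1" by (simp add: lborel_distr_plus \<rho>(5))
  define c0 where "c0 = (LINT t|lebesgue_on ?I. M t * \<rho>0 t)"
  have itest: "integrable (lebesgue_on ?I) (\<lambda>t. w t * \<phi> t)" if "test_fun ?I \<phi>" "integrable (lebesgue_on ?I) w" for \<phi> w
  proof -
    define K where "K = closure {x. \<phi> x \<noteq> 0}"
    note t = test_fun_C1[OF that(1), folded K_def]
    obtain B where B: "\<And>x. norm (\<phi> x) \<le> B" using bounded_compact_support[OF t(3,4,6)] by metis
    show ?thesis
      by (rule integrable_times_continuous[OF _ that(2) continuous_on_subset[OF t(3)], of B]) (use B in auto)
  qed
  have i1: "integrable (lebesgue_on ?I) (\<lambda>_. c :: real)" for c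
    by (rule integrable_continuous_closure) auto
  have "AE t in lebesgue_on ?I. M t - c0 = 0"
  proof (rule test_fun_integrals_zero_imp_AE_zero)
    show "integrable (lebesgue_on ?I) (\<lambda>t. M t - c0)" using iM i1 by (rule Bochner_Integration.integrable_diff)
    fix \<phi> assume \<phi>: "test_fun ?I \<phi>"
    define \<kappa> where "\<kappa> = (LINT x|lborel. \<phi> x)"
    define K where "K = closure {x. \<phi> x \<noteq> 0}"
    note t = test_fun_C1[OF \<phi>, folded K_def]
    have \<kappa>2: "(LINT x|lebesgue_on ?I. \<phi> x) = \<kappa>"
    proof -
      have "(\<lambda>x. if x \<in> ?I then \<phi> x else 0) = \<phi>" using t(5,6) by force
      thus ?thesis using integral_lebesgue_on_lborel[of ?I \<phi>] t(3)
        by (simp add: \<kappa>_def borel_measurable_continuous_onI)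
    qed
    define K2 where "K2 = closure {x. \<rho>0 x \<noteq> 0}"
    note t2 = test_fun_C1[OF t\<rho>, folded K2_def]
    define f where "f x = \<phi> x + (- \<kappa>) * \<rho>0 x" for x
    have "test_fun ?I f"
    proof (rule test_funI)
      show "Ck_on k UNIV f" for k unfolding f_def
        using \<phi> t\<rho> by (intro Ck_on_add Ck_on_mult Ck_on_const) (auto simp: test_fun_def)
      show "compact (K \<union> K2)" using t(4) t2(4) by (rule compact_Un)
      show "K \<union> K2 \<subseteq> ?I" using t(5) t2(5) by blast
      show "f x = 0" if "x \<notin> K \<union> K2" for x using that t(6) t2(6) by (simp add: f_def)
    qed
    moreover have "(LINT x|lborel. f x) = 0"
      unfolding f_def
      using integrable_continuous_compact_support[OF t(3,4,6)] integrable_continuous_compact_support[OF t2(3,4,6)]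
      by (subst Bochner_Integration.integral_add) (auto simp: \<kappa>_def i\<rho>)
    ultimately obtain \<theta> where \<theta>: "test_fun ?I \<theta>" "\<And>x. deriv \<theta> x = f x"
      using antiderivative_test_fun[OF _ ab] by blast
    have "(LINT t|lebesgue_on ?I. M t * f t) = 0" using z[OF \<theta>(1)] \<theta>(2) by simp
    also have "(LINT t|lebesgue_on ?I. M t * f t) = (LINT t|lebesgue_on ?I. M t * \<phi> t - \<kappa> * (M t * \<rho>0 t))"
      by (simp add: f_def algebra_simps)
    also have "\<dots> = (LINT t|lebesgue_on ?I. M t * \<phi> t) - \<kappa> * c0"
      using itest[OF \<phi> iM] itest[OF t\<rho> iM] by (simp add: c0_def)
    finally have "(LINT t|lebesgue_on ?I. M t * \<phi> t) = \<kappa> * c0" by simp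
    moreover have "(LINT t|lebesgue_on ?I. (M t - c0) * \<phi> t) = (LINT t|lebesgue_on ?I. M t * \<phi> t) - c0 * \<kappa>"
      using itest[OF \<phi> iM] itest[OF \<phi> i1[of 1]] by (simp add: left_diff_distrib \<kappa>2)
    ultimately show "(LINT t|lebesgue_on ?I. (M t - c0) * \<phi> t) = 0" by simp
  qed auto
  hence "AE t in lborel. t \<in> ?I \<longrightarrow> M t - c0 = 0" by (intro AE_lebesgue_on_imp_lborel) auto
  moreover have "continuous_on ?I (\<lambda>t. M t - c0)"
    by (intro continuous_intros continuous_on_subset[OF M]) auto
  ultimately have "M x - c0 = 0" if "x \<in> ?I" for x
    using continuous_AE_zero[of ?I "\<lambda>t. M t - c0" x] that by auto
  from this[OF st(1)] this[OF st(2)] show ?thesis by simp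
qed

section \<open>Bounds for integrals, parameters and product domains\<close>

lemma abs_integral_le_indicator:
  fixes h :: "'a::euclidean_space \<Rightarrow> real"
  assumes S: "open S" "bounded S" and P: "P \<in> sets lebesgue" "P \<subseteq> S" and c: "c \<ge> 0"
    and h: "\<And>x. x \<in> S \<Longrightarrow> \<bar>h x\<bar> \<le> c * indicator P x"
  shows "\<bar>LINT x|lebesgue_on S. h x\<bar> \<le> c * measure lebesgue P"
proof -
  interpret finite_measure "lebesgue_on S" by (rule finite_measure_lebesgue_on_bounded[OF S])
  have PS: "P \<in> sets (lebesgue_on S)" using P S by (auto simp: sets_restrict_space_iff)
  have "\<bar>LINT x|lebesgue_on S. h x\<bar> \<le> (LINT x|lebesgue_on S. \<bar>h x\<bar>)" by (rule integral_abs_bound)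
  also have "\<dots> \<le> (LINT x|lebesgue_on S. c * indicator P x)"
  proof (rule integral_mono')
    show "integrable (lebesgue_on S) (\<lambda>x. c * indicator P x)"
      using PS by (intro integrable_mult_right integrable_real_indicator) (auto simp: emeasure_eq_measure)
  qed (use h c in auto)
  also have "\<dots> = c * measure (lebesgue_on S) P" using PS S(1) P(2) by (simp add: Int_absorb2)
  also have "measure (lebesgue_on S) P = measure lebesgue P"
    using P S by (simp add: measure_restrict_space)
  finally show ?thesis .
qed

lemma abs_integral_le:
  fixes h :: "'a::euclidean_space \<Rightarrow> real"
  assumes S: "open S" "bounded S" and c: "c \<ge> 0" and h: "\<And>x. x \<in> S \<Longrightarrow> \<bar>h x\<bar> \<le> c"
  shows "\<bar>LINT x|lebesgue_on S. h x\<bar> \<le> c * measure lebesgue S"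
  by (rule abs_integral_le_indicator[OF S]) (use S c h in auto)

lemma continuous_on_integral_parameter:
  fixes F :: "'p::metric_space \<Rightarrow> 'a::euclidean_space \<Rightarrow> real"
  assumes S: "open S" "bounded S" and X: "compact X" and F: "continuous_on (X \<times> closure S) (\<lambda>(t, x). F t x)"
  shows "continuous_on X (\<lambda>t. LINT x|lebesgue_on S. F t x)"
  unfolding continuous_on_iff
proof (intro ballI allI impI)
  fix t e assume t: "t \<in> X" and e: "(e::real) > 0"
  define m where "m = measure lebesgue S"
  have m: "m \<ge> 0" by (simp add: m_def)
  have "compact (X \<times> closure S)" using S X by (simp add: compact_Times compact_closure)
  hence "uniformly_continuous_on (X \<times> closure S) (\<lambda>(t, x). F t x)" using compact_uniformly_continuous F by blast
  then obtain d where d: "d > 0" "\<And>p q. p \<in> X \<times> closure S \<Longrightarrow> q \<in> X \<times> closure S \<Longrightarrow> dist q p < d \<Longrightarrow>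
      dist ((\<lambda>(t, x). F t x) q) ((\<lambda>(t, x). F t x) p) < e / (m + 1)"
    unfolding uniformly_continuous_on_def using e m by (metis divide_pos_pos add_nonneg_pos zero_less_one)
  have int: "integrable (lebesgue_on S) (F t)" if "t \<in> X" for t
    by (rule integrable_continuous_closure[OF S])
      (use that in \<open>auto intro!: continuous_on_compose2[OF F, of _ "\<lambda>x. (t, x)", simplified] continuous_intros\<close>)
  show "\<exists>d>0. \<forall>t'\<in>X. dist t' t < d \<longrightarrow> dist (LINT x|lebesgue_on S. F t' x) (LINT x|lebesgue_on S. F t x) < e"
  proof (intro exI conjI ballI impI)
    fix t' assume t': "t' \<in> X" "dist t' t < d"
    have "(LINT x|lebesgue_on S. F t' x) - (LINT x|lebesgue_on S. F t x) = (LINT x|lebesgue_on S. F t' x - F t x)"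
      using int t t' by simp
    also have "\<bar>\<dots>\<bar> \<le> e / (m + 1) * measure lebesgue S"
    proof (rule abs_integral_le[OF S])
      fix x assume "x \<in> S"
      hence "x \<in> closure S" using closure_subset by blast
      thus "\<bar>F t' x - F t x\<bar> \<le> e / (m + 1)"
        using d(2)[of "(t, x)" "(t', x)"] t t' by (auto simp: dist_Pair_Pair dist_real_def)
    qed (use e m in auto)
    also have "\<dots> < e" using e m by (simp add: m_def[symmetric] field_simps)
    finally show "dist (LINT x|lebesgue_on S. F t' x) (LINT x|lebesgue_on S. F t x) < e" by (simp add: dist_real_def)
  qed (rule d(1))
qed

text \<open>The integrand extended by zero is continuous with compact support, so Fubini's theorem
  for \<open>lborel\<close> applies; the completed measures enter only through
  \<open>integral_lebesgue_on_lborel\<close>.\<close>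

lemma integral_product_domain:
  fixes F :: "real \<Rightarrow> 'a::euclidean_space \<Rightarrow> real"
  assumes S: "open S" "open I" and K: "compact K"
    and c: "continuous_on UNIV (\<lambda>p. if p \<in> I \<times> S then F (fst p) (snd p) else 0)"
    and z: "\<And>p. p \<in> I \<times> S \<Longrightarrow> p \<notin> K \<Longrightarrow> F (fst p) (snd p) = 0"
  shows "(LINT (t, x)|lebesgue_on (I \<times> S). F t x) = (LINT t|lebesgue_on I. LINT x|lebesgue_on S. F t x)"
proof -
  define H where "H p = (if p \<in> I \<times> S then F (fst p) (snd p) else 0)" for p
  have cH: "continuous_on UNIV H" using c by (simp add: H_def[abs_def])
  hence [measurable]: "H \<in> borel_measurable borel" by (rule borel_measurable_continuous_onI)
  have iH: "integrable lborel H"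
    by (rule integrable_continuous_compact_support[OF cH K]) (use z in \<open>auto simp: H_def\<close>)
  have cs: "continuous_on UNIV (\<lambda>x. H (t, x))" for t
    by (rule continuous_on_compose2[OF cH]) (auto intro!: continuous_intros)
  have sec: "(LINT x|lborel. H (t, x)) = (if t \<in> I then (LINT x|lebesgue_on S. F t x) else 0)" for t
  proof (cases "t \<in> I")
    case True
    hence eq: "(\<lambda>x. if x \<in> S then F t x else 0) = (\<lambda>x. H (t, x))" by (auto simp: H_def)
    show ?thesis
      using True integral_lebesgue_on_lborel[OF S(1), of "F t"] cs[of t]
      unfolding eq by (simp add: borel_measurable_continuous_onI)
  qed (simp add: H_def)
  have "(LINT (t, x)|lebesgue_on (I \<times> S). F t x) = (LINT p|lborel. H p)"
    using integral_lebesgue_on_lborel[of "I \<times> S" "\<lambda>p. F (fst p) (snd p)"] S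
    by (simp add: open_Times H_def[abs_def] case_prod_unfold borel_measurable_continuous_onI[OF c])
  also have "\<dots> = (LINT p|(lborel \<Otimes>\<^sub>M lborel). H p)" by (simp add: lborel_prod)
  also have "\<dots> = (LINT t|lborel. LINT x|lborel. H (t, x))"
    by (rule lborel_pair.integral_fst'[symmetric]) (use iH in \<open>simp add: lborel_prod\<close>)
  also have "\<dots> = (LINT t|lborel. (if t \<in> I then (LINT x|lebesgue_on S. F t x) else 0))"
    by (simp only: sec)
  also have "\<dots> = (LINT t|lebesgue_on I. LINT x|lebesgue_on S. F t x)"
  proof (rule integral_lebesgue_on_lborel[OF S(2), symmetric])
    have "(\<lambda>t. LINT x|lborel. H (t, x)) \<in> borel_measurable borel" by measurable
    thus "(\<lambda>t. if t \<in> I then (LINT x|lebesgue_on S. F t x) else 0) \<in> borel_measurable borel"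
      by (simp only: sec)
  qed
  finally show ?thesis .
qed

section \<open>C1 cutoffs, boundary layers and partitions of unity\<close>

lemma DERIV_max_zero_square: "((\<lambda>s::real. (max 0 s)\<^sup>2) has_real_derivative 2 * max 0 s) (at s)"
proof -
  consider "s > 0" | "s < 0" | "s = 0" by linarith
  thus ?thesis
  proof cases
    case 1
    have "((\<lambda>s. s\<^sup>2) has_real_derivative 2 * max 0 s) (at s)"
      using 1 by (auto intro!: derivative_eq_intros)
    thus ?thesis by (rule has_field_derivative_transform_within_open[of _ _ _ "{0<..}"])
      (use 1 in \<open>auto\<close>)
  next
    case 2
    have "((\<lambda>s. 0) has_real_derivative 2 * max 0 s) (at s)" using 2 by auto
    thus ?thesis by (rule has_field_derivative_transform_within_open[of _ _ _ "{..<0}"])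
      (use 2 in \<open>auto\<close>)
  next
    case 3
    have "((\<lambda>h. max 0 h) \<longlongrightarrow> (0::real)) (at 0)"
      using tendsto_max[OF tendsto_const tendsto_ident_at, of 0 "0::real"] by simp
    hence "((\<lambda>h::real. (max 0 h)\<^sup>2 / h) \<longlongrightarrow> 0) (at 0)"
      by (rule Lim_transform_eventually)
        (auto simp: eventually_at_filter power2_eq_square max_def)
    thus ?thesis using 3 by (simp add: DERIV_def)
  qed
qed

text \<open>The squared positive part \<open>P\<close> is C1, and
  \<open>1 - P (1 - P (2 * s - 1))\<close> uses it twice: the inner \<open>P\<close> is zero up to
  one half and at least one from \<open>s = 1\<close> on, the outer one flattens the upper end. The
  chain rule gives the bound 8 for the derivative.\<close>

lemma cutoff_exists:
  obtains \<xi> \<xi>' :: "real \<Rightarrow> real" and C where "\<And>s. (\<xi> has_real_derivative \<xi>' s) (at s)" "continuous_on UNIV \<xi>'"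
    "\<And>s. s \<le> 1/2 \<Longrightarrow> \<xi> s = 0" "\<And>s. s \<ge> 1 \<Longrightarrow> \<xi> s = 1" "\<And>s. 0 \<le> \<xi> s" "\<And>s. \<xi> s \<le> 1"
    "\<And>s. s \<ge> 1 \<Longrightarrow> \<xi>' s = 0" "\<And>s. \<bar>\<xi>' s\<bar> \<le> C" "C \<ge> 0"
proof -
  define P where "P s = (max 0 s)\<^sup>2" for s :: real
  have D: "(P has_real_derivative 2 * max 0 s) (at s)" for s
    using DERIV_max_zero_square unfolding P_def[abs_def] .
  define \<xi> where "\<xi> s = 1 - P (1 - P (2 * s - 1))" for s
  define \<xi>' where "\<xi>' s = 2 * max 0 (1 - P (2 * s - 1)) * (2 * max 0 (2 * s - 1) * 2)" for s
  show ?thesis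
  proof
    show "(\<xi> has_real_derivative \<xi>' s) (at s)" for s unfolding \<xi>_def \<xi>'_def
      by (rule derivative_eq_intros DERIV_chain2[OF D] refl)+ simp
    show "continuous_on UNIV \<xi>'" unfolding \<xi>'_def P_def by (intro continuous_intros)
    show "\<xi> s = 0" if "s \<le> 1/2" for s using that by (simp add: \<xi>_def P_def)
    have big: "P (2 * s - 1) \<ge> 1" if "s \<ge> 1" for s
      using that power_mono[of 1 "2 * s - 1" 2] by (simp add: P_def max_def)
    show "\<xi> s = 1" if "s \<ge> 1" for s using big[OF that] by (simp add: \<xi>_def P_def[of "1 - P (2 * s - 1)"])
    show "\<xi>' s = 0" if "s \<ge> 1" for s using big[OF that] by (simp add: \<xi>'_def)
    have P0: "P s \<ge> 0" for s by (simp add: P_def)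
    show "\<xi> s \<le> 1" for s using P0 by (simp add: \<xi>_def)
    have "P (1 - P (2 * s - 1)) \<le> 1" for s
      using P0[of "2 * s - 1"] power_mono[of "max 0 (1 - P (2 * s - 1))" 1 2] by (simp add: P_def[of "1 - P (2 * s - 1)"])
    thus "0 \<le> \<xi> s" for s by (simp add: \<xi>_def)
    show "\<bar>\<xi>' s\<bar> \<le> 8" for s
    proof (cases "s \<ge> 1")
      case True
      thus ?thesis using big[OF True] by (simp add: \<xi>'_def)
    next
      case False
      have "\<bar>2 * max 0 (1 - P (2 * s - 1)) * (2 * max 0 (2 * s - 1) * 2)\<bar> \<le> 2 * 1 * (2 * 1 * 2)"
        unfolding abs_mult by (intro mult_mono) (use False P0[of "2 * s - 1"] in auto)
      thus ?thesis by (simp add: \<xi>'_def)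
    qed
  qed simp
qed

text \<open>Shifting the layer by \<open>k / n\<close> in direction \<open>e\<close> lowers the
  chart function by \<open>k / n\<close>, so \<open>n\<close> such copies are disjoint, and all of
  them lie in the ball enlarged by one.\<close>

lemma chart_layer_measure:
  fixes x0 e :: "'a::euclidean_space" and \<gamma> :: "'a \<Rightarrow> real" and \<rho> :: real and n :: nat
  assumes e: "norm e = 1" and \<gamma>: "Ck_on 2 UNIV \<gamma>" and n: "n \<ge> 1"
  defines "P \<equiv> {x \<in> cball x0 \<rho>. - 1 / real n < chart_fun \<gamma> e x \<and> chart_fun \<gamma> e x < 0}"
  shows "P \<in> sets borel" "real n * measure lebesgue P \<le> measure lebesgue (cball x0 (\<rho> + 1))"
proof -
  have [measurable]: "chart_fun \<gamma> e \<in> borel_measurable borel"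
    by (rule borel_measurable_continuous_onI[OF chart_fun_C1(3)[OF \<gamma>]])
  have "P = cball x0 \<rho> \<inter> {x \<in> space borel. - 1 / real n < chart_fun \<gamma> e x \<and> chart_fun \<gamma> e x < 0}"
    by (auto simp: P_def)
  also have "\<dots> \<in> sets borel" by measurable
  finally show Pb: "P \<in> sets borel" .
  have Pl: "P \<in> lmeasurable"
    by (rule bounded_set_imp_lmeasurable) (use Pb in \<open>auto simp: P_def intro: bounded_subset[OF bounded_cball]\<close>)
  define Q where "Q k = (+) ((real k / real n) *\<^sub>R e) ` P" for k
  have Ql: "Q k \<in> lmeasurable" for k unfolding Q_def by (rule measurable_translation[OF Pl])
  have Qc: "- real (k + 1) / n < chart_fun \<gamma> e x \<and> chart_fun \<gamma> e x < - real k / n" if "x \<in> Q k" for k x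
  proof -
    from that obtain y where y: "y \<in> P" "x = y + (real k / real n) *\<^sub>R e" by (auto simp: Q_def add.commute)
    have "chart_fun \<gamma> e x = chart_fun \<gamma> e y - real k / real n" using chart_fun_shift[OF e] y(2) by simp
    moreover have "- real (k + 1) / n = - 1 / real n - real k / real n"
      by (simp add: add_divide_distrib diff_divide_distrib)
    ultimately show ?thesis using y(1) by (simp add: P_def)
  qed
  have dis: "disjoint_family_on Q {..<n}" unfolding disjoint_family_on_def
  proof (intro ballI impI)
    have lt: "Q j \<inter> Q k = {}" if "j < k" for j k
    proof -
      have "- real k / n \<le> - real (j + 1) / n" using that n by (intro divide_right_mono) auto
      thus ?thesis using Qc[of _ j] Qc[of _ k] by fastforce
    qed
    fix j k :: nat assume "j \<noteq> k"
    thus "Q j \<inter> Q k = {}" using lt[of j k] lt[of k j] by (cases "j < k") auto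
  qed
  have sub: "(\<Union>k<n. Q k) \<subseteq> cball x0 (\<rho> + 1)"
  proof
    fix x assume "x \<in> (\<Union>k<n. Q k)"
    then obtain k y where k: "k < n" "y \<in> P" "x = y + (real k / real n) *\<^sub>R e" by (auto simp: Q_def add.commute)
    have "dist x0 x \<le> dist x0 y + norm ((real k / real n) *\<^sub>R e)"
      using dist_triangle[of x0 x y] k(3) by (simp add: dist_norm)
    also have "norm ((real k / real n) *\<^sub>R e) \<le> 1" using e k(1) by simp
    finally show "x \<in> cball x0 (\<rho> + 1)" using k(2) by (simp add: P_def)
  qed
  have "real n * measure lebesgue P = (\<Sum>k<n. measure lebesgue (Q k))"
    by (simp add: Q_def measure_translation)
  also have "\<dots> = measure lebesgue (\<Union>k<n. Q k)"
  proof (rule measure_finite_Union[symmetric])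
    show "emeasure lebesgue (Q k) \<noteq> \<infinity>" for k using fmeasurableD2[OF Ql] by simp
  qed (use Ql dis in auto)
  also have "\<dots> \<le> measure lebesgue (cball x0 (\<rho> + 1))"
    by (rule measure_mono_fmeasurable[OF sub]) (use Ql in auto)
  finally show "real n * measure lebesgue P \<le> measure lebesgue (cball x0 (\<rho> + 1))" .
qed

lemma GDERIV_sum:
  fixes f :: "'i \<Rightarrow> 'a::euclidean_space \<Rightarrow> real"
  assumes "\<And>i. i \<in> I \<Longrightarrow> GDERIV (f i) x :> F i"
  shows "GDERIV (\<lambda>x. \<Sum>i\<in>I. f i x) x :> (\<Sum>i\<in>I. F i)"
  using assms unfolding gderiv_def inner_sum_right by (rule has_derivative_sum)

text \<open>The bumps are squared positive parts of
  \<open>(\<rho> y)\<^sup>2 - (x - y) \<bullet> (x - y)\<close>, hence C1. On \<open>C\<close> their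
  finite sum is positive by the choice of the subcover, so one may divide by it there.\<close>

lemma C1_partition_of_unity:
  fixes C :: "'a::euclidean_space set"
  assumes C: "compact C" and \<rho>: "\<And>y. y \<in> C \<Longrightarrow> \<rho> y > 0"
  obtains Y p P where "finite Y" "Y \<subseteq> C"
    "\<And>y x. y \<in> Y \<Longrightarrow> x \<in> C \<Longrightarrow> GDERIV (p y) x :> P y x"
    "\<And>y. y \<in> Y \<Longrightarrow> continuous_on C (P y)"
    "\<And>y x. y \<in> Y \<Longrightarrow> x \<notin> cball y (\<rho> y) \<Longrightarrow> p y x = 0 \<and> P y x = 0"
    "\<And>x. x \<in> C \<Longrightarrow> (\<Sum>y\<in>Y. p y x) = 1"
proof -
  obtain Y where Y: "Y \<subseteq> C" "finite Y" "C \<subseteq> (\<Union>y\<in>Y. ball y (\<rho> y))"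
    by (rule compactE_image[OF C, of C "\<lambda>y. ball y (\<rho> y)"]) (use \<rho> in force)+
  define d where "d y x = (\<rho> y)\<^sup>2 - (x - y) \<bullet> (x - y)" for y x
  define q where "q y x = (max 0 (d y x))\<^sup>2" for y x
  define Q where "Q y x = (2 * max 0 (d y x)) *\<^sub>R (- 2 *\<^sub>R (x - y))" for y x
  have q: "GDERIV (q y) x :> Q y x" for y x
  proof -
    have "GDERIV (d y) x :> - 2 *\<^sub>R (x - y)" unfolding gderiv_def d_def
      by (auto intro!: derivative_eq_intros simp: inner_commute algebra_simps)
    from GDERIV_DERIV_compose[OF this DERIV_max_zero_square] show ?thesis unfolding q_def Q_def .
  qed
  have cQ: "continuous_on A (Q y)" for A y unfolding Q_def d_def by (intro continuous_intros)
  have cq: "continuous_on A (q y)" for A y unfolding q_def d_def by (intro continuous_intros)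
  have d0: "d y x \<le> 0" if "y \<in> C" "x \<notin> cball y (\<rho> y)" for y x
  proof -
    have "(\<rho> y)\<^sup>2 \<le> (norm (x - y))\<^sup>2"
      using that \<rho>[of y] by (intro power_mono) (auto simp: dist_norm norm_minus_commute)
    thus ?thesis by (simp add: d_def power2_norm_eq_inner)
  qed
  have dpos: "d y x > 0" if "x \<in> ball y (\<rho> y)" for y x
  proof -
    have "(norm (x - y))\<^sup>2 < (\<rho> y)\<^sup>2"
      using that by (intro power_strict_mono) (auto simp: dist_norm norm_minus_commute)
    thus ?thesis by (simp add: d_def power2_norm_eq_inner)
  qed
  define s where "s x = (\<Sum>y\<in>Y. q y x)" for x
  have s: "s x > 0" if xC: "x \<in> C" for x
  proof -
    obtain y where y: "y \<in> Y" "x \<in> ball y (\<rho> y)" using Y(3) xC by blast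
    have "0 < q y x" using dpos[OF y(2)] by (simp add: q_def)
    also have "\<dots> \<le> s x" unfolding s_def by (rule member_le_sum) (use y Y(2) in \<open>auto simp: q_def\<close>)
    finally show ?thesis .
  qed
  have s0: "(\<Sum>y\<in>Y. q y x) \<noteq> 0" if "x \<in> C" for x using s[OF that] by (simp add: s_def)
  define p where "p y x = q y x * inverse (s x)" for y x
  define P where "P y x = q y x *\<^sub>R (- (inverse (s x))\<^sup>2 *\<^sub>R (\<Sum>y\<in>Y. Q y x)) + inverse (s x) *\<^sub>R Q y x" for y x
  show ?thesis
  proof (rule that[of Y p P])
    show "finite Y" "Y \<subseteq> C" by fact+
    have s': "GDERIV s x :> (\<Sum>y\<in>Y. Q y x)" for x
      unfolding s_def by (rule GDERIV_sum) (rule q)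
    show "GDERIV (p y) x :> P y x" if "x \<in> C" for y x
      unfolding p_def P_def by (rule GDERIV_mult[OF q GDERIV_inverse[OF s']]) (use s[OF that] in simp)
    show "continuous_on C (P y)" for y unfolding P_def s_def
      by (intro continuous_intros cq cQ) (use s0 in auto)
    show "p y x = 0 \<and> P y x = 0" if "y \<in> Y" "x \<notin> cball y (\<rho> y)" for y x
      using d0[of y x] that Y(1) by (auto simp: p_def P_def q_def Q_def)
    show "(\<Sum>y\<in>Y. p y x) = 1" if "x \<in> C" for x
      using s[OF that] by (simp add: p_def sum_distrib_right[symmetric] s_def)
  qed
qed

section \<open>The equation integrated in time, tested with functions of space\<close>

locale space_time_fields =
  fixes S :: "'a::euclidean_space set" and u B :: "real \<Rightarrow> 'a \<Rightarrow> real" and A :: "real \<Rightarrow> 'a \<Rightarrow> 'a"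
    and a b :: real
  assumes open_S: "open S" and bounded_S: "bounded S" and ab: "a < b"
    and cont_u: "continuous_on ({a..b} \<times> closure S) (\<lambda>(t, x). u t x)"
    and cont_A: "continuous_on ({a..b} \<times> closure S) (\<lambda>(t, x). A t x)"
    and cont_B: "continuous_on ({a..b} \<times> closure S) (\<lambda>(t, x). B t x)"
begin

definition mass :: "real \<Rightarrow> ('a \<Rightarrow> real) \<Rightarrow> real" where
  "mass t \<psi> = (LINT x|lebesgue_on S. u t x * \<psi> x)"

text \<open>The gradient is an argument of its own because later \<open>\<psi>\<close> is
  differentiable in \<open>S\<close> only, and \<open>G\<close> is the continuous extension of its
  gradient to the closure.\<close>

definition flux :: "real \<Rightarrow> ('a \<Rightarrow> real) \<Rightarrow> ('a \<Rightarrow> 'a) \<Rightarrow> real" where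
  "flux t \<psi> G = (LINT x|lebesgue_on S. A t x \<bullet> G x + B t x * \<psi> x)"

text \<open>Weak form of the equation u_t = div A - B, with no derivative in time and no boundary
  term. Once \<open>\<psi>\<close> may be nonzero at the boundary, it also encodes that the normal
  component of \<open>A\<close> vanishes there.\<close>

definition balance :: "real \<Rightarrow> real \<Rightarrow> ('a \<Rightarrow> real) \<Rightarrow> ('a \<Rightarrow> 'a) \<Rightarrow> bool" where
  "balance s t \<psi> G \<longleftrightarrow> mass t \<psi> - mass s \<psi> = - integral {s..t} (\<lambda>r. flux r \<psi> G)"

lemma cont_slice:
  assumes "continuous_on ({a..b} \<times> closure S) (\<lambda>(t, x). f t x)" "t \<in> {a..b}"
  shows "continuous_on (closure S) (f t)"
  using assms(2) by (intro continuous_on_compose2[OF assms(1), of _ "\<lambda>x. (t, x)", simplified] continuous_intros) auto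

lemma bounded_field:
  fixes f :: "real \<Rightarrow> 'a \<Rightarrow> 'b::real_normed_vector"
  assumes "continuous_on ({a..b} \<times> closure S) (\<lambda>(t, x). f t x)"
  obtains C where "C \<ge> 0" "\<And>t x. t \<in> {a..b} \<Longrightarrow> x \<in> closure S \<Longrightarrow> norm (f t x) \<le> C"
proof -
  have "compact ({a..b} \<times> closure S)" using bounded_S by (simp add: compact_Times compact_closure)
  hence "bounded ((\<lambda>(t, x). f t x) ` ({a..b} \<times> closure S))"
    using compact_continuous_image[OF assms] compact_imp_bounded by blast
  then obtain C where C: "\<And>t x. t \<in> {a..b} \<Longrightarrow> x \<in> closure S \<Longrightarrow> norm (f t x) \<le> C"
    by (force simp: bounded_iff)
  show ?thesis by (rule that[of "max C 0"]) (use C in \<open>auto simp: le_max_iff_disj\<close>)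
qed

lemma integrable_mass:
  assumes "t \<in> {a..b}" "continuous_on (closure S) \<psi>"
  shows "integrable (lebesgue_on S) (\<lambda>x. u t x * \<psi> x)"
  by (rule integrable_continuous_closure[OF open_S bounded_S])
    (intro continuous_intros cont_slice[OF cont_u] assms)

lemma integrable_flux:
  assumes "t \<in> {a..b}" "continuous_on (closure S) \<psi>" "continuous_on (closure S) G"
  shows "integrable (lebesgue_on S) (\<lambda>x. A t x \<bullet> G x + B t x * \<psi> x)"
  by (rule integrable_continuous_closure[OF open_S bounded_S])
    (intro continuous_intros cont_slice[OF cont_A] cont_slice[OF cont_B] assms)

lemma continuous_on_mass:
  assumes "continuous_on (closure S) \<psi>"
  shows "continuous_on {a..b} (\<lambda>t. mass t \<psi>)"
  unfolding mass_def
proof (rule continuous_on_integral_parameter[OF open_S bounded_S compact_Icc])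
  show "continuous_on ({a..b} \<times> closure S) (\<lambda>(t, x). u t x * \<psi> x)"
    using continuous_on_mult[OF cont_u continuous_on_compose2[OF assms continuous_on_snd[OF continuous_on_id], of "{a..b} \<times> closure S"]]
    by (force simp: case_prod_unfold)
qed

lemma continuous_on_flux:
  assumes "continuous_on (closure S) \<psi>" "continuous_on (closure S) G"
  shows "continuous_on {a..b} (\<lambda>t. flux t \<psi> G)"
  unfolding flux_def
proof (rule continuous_on_integral_parameter[OF open_S bounded_S compact_Icc])
  have *: "continuous_on ({a..b} \<times> closure S) (\<lambda>p. \<psi> (snd p))" "continuous_on ({a..b} \<times> closure S) (\<lambda>p. G (snd p))"
    by (rule continuous_on_compose2[OF assms(1)] continuous_on_compose2[OF assms(2)]; force intro: continuous_intros)+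
  show "continuous_on ({a..b} \<times> closure S) (\<lambda>(t, x). A t x \<bullet> G x + B t x * \<psi> x)"
    using continuous_on_add[OF continuous_on_inner[OF cont_A *(2)] continuous_on_mult[OF cont_B *(1)]]
    by (simp add: case_prod_unfold)
qed

text \<open>Only masses and fluxes have to converge, not the test functions with their gradients.
  This matters at the boundary, where the gradients of the cutoffs blow up.\<close>

lemma balance_limit:
  assumes st: "a \<le> s" "s \<le> t" "t \<le> b"
    and \<psi>: "continuous_on (closure S) \<psi>" "continuous_on (closure S) G"
    and approx: "\<And>e. e > 0 \<Longrightarrow> \<exists>\<phi> H. balance s t \<phi> H \<and> continuous_on (closure S) \<phi> \<and> continuous_on (closure S) H \<and>
      (\<forall>r\<in>{s..t}. \<bar>mass r \<phi> - mass r \<psi>\<bar> \<le> e \<and> \<bar>flux r \<phi> H - flux r \<psi> G\<bar> \<le> e)"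
  shows "balance s t \<psi> G"
proof -
  have ii: "(\<lambda>r. flux r \<phi> H) integrable_on {s..t}" if "continuous_on (closure S) \<phi>" "continuous_on (closure S) H" for \<phi> H
    by (intro integrable_continuous_real continuous_on_subset[OF continuous_on_flux[OF that]]) (use st in auto)
  define X where "X = mass t \<psi> - mass s \<psi> + integral {s..t} (\<lambda>r. flux r \<psi> G)"
  have "\<bar>X\<bar> \<le> 0 + \<epsilon>" if \<epsilon>: "\<epsilon> > 0" for \<epsilon>
  proof -
    \<comment> \<open>Two masses contribute \<open>e\<close> each, and the flux over an interval of
      length \<open>t - s\<close> contributes \<open>e * (t - s)\<close>.\<close>
    define e where "e = \<epsilon> / (2 + (t - s))"
    have e: "e > 0" using \<epsilon> st by (simp add: e_def)
    obtain \<phi> H where \<phi>: "balance s t \<phi> H" "continuous_on (closure S) \<phi>" "continuous_on (closure S) H"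
      "\<forall>r\<in>{s..t}. \<bar>mass r \<phi> - mass r \<psi>\<bar> \<le> e \<and> \<bar>flux r \<phi> H - flux r \<psi> G\<bar> \<le> e"
      using approx[OF e] by blast
    have "norm (integral {s..t} (\<lambda>r. flux r \<phi> H - flux r \<psi> G)) \<le> e * (t - s)"
      by (rule integral_bound) (use st \<phi> \<psi> in \<open>auto intro!: continuous_intros continuous_on_subset[OF continuous_on_flux]\<close>)
    moreover have "integral {s..t} (\<lambda>r. flux r \<phi> H - flux r \<psi> G) = integral {s..t} (\<lambda>r. flux r \<phi> H) - integral {s..t} (\<lambda>r. flux r \<psi> G)"
      by (rule integral_diff; intro ii \<phi>(2,3) \<psi>)
    moreover have "mass t \<phi> - mass s \<phi> + integral {s..t} (\<lambda>r. flux r \<phi> H) = 0"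
      using \<phi>(1) by (simp add: balance_def)
    moreover have "\<bar>mass t \<phi> - mass t \<psi>\<bar> \<le> e" "\<bar>mass s \<phi> - mass s \<psi>\<bar> \<le> e" using \<phi>(4) st by auto
    ultimately have "\<bar>X\<bar> \<le> 2 * e + e * (t - s)" unfolding X_def by (simp only: real_norm_def)
    also have "\<dots> = e * (2 + (t - s))" by (simp add: algebra_simps)
    also have "\<dots> = \<epsilon>" using st by (simp add: e_def)
    finally show ?thesis by simp
  qed
  hence "\<bar>X\<bar> \<le> 0" by (rule field_le_epsilon)
  thus ?thesis by (simp add: X_def balance_def)
qed


text \<open>Test functions of product form in time and space show that mass plus the primitive of
  the flux has weak derivative zero. Being continuous it is constant, which gives the balance
  between all pairs of times and not just almost all.\<close>

lemma balance_test_fun: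
  assumes weak: "\<And>\<phi>. test_fun ({a<..<b} \<times> S) \<phi> \<Longrightarrow> (LINT (t, x)|lebesgue_on ({a<..<b} \<times> S).
      - u t x * deriv (\<lambda>s. \<phi> (s, x)) t + A t x \<bullet> grad (\<lambda>y. \<phi> (t, y)) x + B t x * \<phi> (t, x)) = 0"
    and \<psi>0: "test_fun S \<psi>" and st: "a < s" "s \<le> t" "t < b"
  shows "balance s t \<psi> (grad \<psi>)"
proof -
  let ?I = "{a<..<b}"
  define K where "K = closure {x. \<psi> x \<noteq> 0}"
  note \<psi> = test_fun_C1[OF \<psi>0, folded K_def]
  have c\<psi>: "continuous_on (closure S) \<psi>" "continuous_on (closure S) (grad \<psi>)"
    using \<psi>(2,3) continuous_on_subset by blast+
  define m where "m r = mass r \<psi>" for r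
  define l where "l r = flux r \<psi> (grad \<psi>)" for r
  have cm: "continuous_on {a..b} m" unfolding m_def by (rule continuous_on_mass[OF c\<psi>(1)])
  have cl: "continuous_on {a..b} l" unfolding l_def by (rule continuous_on_flux[OF c\<psi>])
  define L where "L r = integral {a..r} l" for r
  have DL: "(L has_real_derivative l r) (at r)" if "r \<in> ?I" for r
  proof -
    have "(L has_vector_derivative l r) (at r within {a..b})" unfolding L_def
      by (rule integral_has_vector_derivative[OF cl]) (use that in auto)
    thus ?thesis using that by (simp add: at_within_Icc_at has_real_derivative_iff_has_vector_derivative)
  qed
  have cL: "continuous_on {a..b} L" unfolding L_def
    by (rule indefinite_integral_continuous_1[OF integrable_continuous_real[OF cl]])
  have ici: "integrable (lebesgue_on ?I) f" if "continuous_on {a..b} f" for f :: "real \<Rightarrow> real"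
    by (rule integrable_continuous_closure) (use that ab in auto)
  have "m s + L s = m t + L t"
  proof (rule zero_weak_derivative_constant[OF ab, of "\<lambda>r. m r + L r"])
    fix \<theta> assume \<theta>0: "test_fun ?I \<theta>"
    define K2 where "K2 = closure {x. \<theta> x \<noteq> 0}"
    note \<theta> = test_fun_C1[OF \<theta>0, folded K2_def]
    note gd = grad_eq_deriv[OF \<theta>0]
    \<comment> \<open>The vanishing offsets give the factors the shape that
      \<open>Ck_on_affine\<close> expects.\<close>
    define \<phi> where "\<phi> p = \<theta> (0 + fst p) * \<psi> (0 + snd p)" for p
    have t\<phi>: "test_fun (?I \<times> S) \<phi>"
    proof (rule test_funI)
      show "Ck_on k UNIV \<phi>" for k unfolding \<phi>_def
        using \<theta>0 \<psi>0 by (intro Ck_on_mult Ck_on_affine bounded_linear_fst bounded_linear_snd) (auto simp: test_fun_def)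
      show "compact (K2 \<times> K)" using \<psi>(4) \<theta>(4) by (rule compact_Times[rotated])
      show "K2 \<times> K \<subseteq> ?I \<times> S" using \<psi>(5) \<theta>(5) by blast
      show "\<phi> p = 0" if "p \<notin> K2 \<times> K" for p
        using that \<psi>(6) \<theta>(6) by (cases p) (auto simp: \<phi>_def)
    qed
    have d1: "deriv (\<lambda>s. \<phi> (s, x)) t = deriv \<theta> t * \<psi> x" for t x
    proof (rule DERIV_imp_deriv)
      have "(\<theta> has_real_derivative deriv \<theta> t) (at t)" using \<theta>(1)[of t] gd by simp
      from DERIV_cmult_right[OF this] show "((\<lambda>s. \<phi> (s, x)) has_real_derivative deriv \<theta> t * \<psi> x) (at t)"
        by (simp add: \<phi>_def)
    qed
    have d2: "grad (\<lambda>y. \<phi> (t, y)) x = \<theta> t *\<^sub>R grad \<psi> x" for t x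
    proof (rule grad_eq)
      show "GDERIV (\<lambda>y. \<phi> (t, y)) x :> \<theta> t *\<^sub>R grad \<psi> x"
        using GDERIV_mult[OF GDERIV_const \<psi>(1), of "\<theta> t" x] by (simp add: \<phi>_def)
    qed
    define F where "F t x = - u t x * deriv (\<lambda>s. \<phi> (s, x)) t + A t x \<bullet> grad (\<lambda>y. \<phi> (t, y)) x + B t x * \<phi> (t, x)" for t x
    have F: "F t x = - u t x * (deriv \<theta> t * \<psi> x) + A t x \<bullet> (\<theta> t *\<^sub>R grad \<psi> x) + B t x * (\<theta> t * \<psi> x)" for t x
      unfolding F_def d1 d2 by (simp add: \<phi>_def)
    have Fz: "F (fst p) (snd p) = 0" if "p \<notin> K2 \<times> K" for p
      using that \<psi>(6,7) \<theta>(6) \<theta>(7)[unfolded gd] by (cases p) (auto simp: F)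
    have sub: "?I \<times> S \<subseteq> {a..b} \<times> closure S" using closure_subset[of S] by auto
    have cF: "continuous_on (?I \<times> S) (\<lambda>p. F (fst p) (snd p))"
    proof -
      have 1: "continuous_on (?I \<times> S) (\<lambda>p. deriv \<theta> (fst p))" "continuous_on (?I \<times> S) (\<lambda>p. \<theta> (fst p))"
        "continuous_on (?I \<times> S) (\<lambda>p. \<psi> (snd p))" "continuous_on (?I \<times> S) (\<lambda>p. grad \<psi> (snd p))"
        by (rule continuous_on_compose2[OF \<theta>(2)[unfolded gd[abs_def]]] continuous_on_compose2[OF \<theta>(3)]
             continuous_on_compose2[OF \<psi>(3)] continuous_on_compose2[OF \<psi>(2)]; force intro: continuous_intros)+
      have 2: "continuous_on (?I \<times> S) (\<lambda>p. u (fst p) (snd p))" "continuous_on (?I \<times> S) (\<lambda>p. A (fst p) (snd p))"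
         "continuous_on (?I \<times> S) (\<lambda>p. B (fst p) (snd p))"
        using continuous_on_subset[OF cont_u sub] continuous_on_subset[OF cont_A sub] continuous_on_subset[OF cont_B sub]
        by (auto simp: case_prod_unfold)
      show ?thesis unfolding F by (intro continuous_intros 1 2)
    qed
    have "0 = (LINT (t, x)|lebesgue_on (?I \<times> S). F t x)" using weak[OF t\<phi>] unfolding F_def by simp
    also have "\<dots> = (LINT t|lebesgue_on ?I. LINT x|lebesgue_on S. F t x)"
    proof (rule integral_product_domain[OF open_S])
      show "compact (K2 \<times> K)" using \<psi>(4) \<theta>(4) by (rule compact_Times[rotated])
      show "continuous_on UNIV (\<lambda>p. if p \<in> ?I \<times> S then F (fst p) (snd p) else 0)"
        by (rule continuous_extend_zero[OF _ \<open>compact (K2 \<times> K)\<close> _ cF])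
          (use open_S \<psi>(5) \<theta>(5) Fz in \<open>auto intro!: open_Times\<close>)
    qed (use Fz in auto)
    also have "\<dots> = (LINT t|lebesgue_on ?I. - (m t * deriv \<theta> t) + l t * \<theta> t)"
    proof (rule Bochner_Integration.integral_cong[OF refl])
      fix t assume "t \<in> space (lebesgue_on ?I)"
      hence t: "t \<in> {a..b}" by simp
      have "(LINT x|lebesgue_on S. F t x) = (LINT x|lebesgue_on S. (- deriv \<theta> t) * (u t x * \<psi> x) +
          \<theta> t * (A t x \<bullet> grad \<psi> x + B t x * \<psi> x))"
        unfolding F by (simp add: algebra_simps)
      also have "\<dots> = (- deriv \<theta> t) * m t + \<theta> t * l t"
        unfolding m_def l_def mass_def flux_def
        using integrable_mass[OF t c\<psi>(1)] integrable_flux[OF t c\<psi>]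
        by (subst Bochner_Integration.integral_add) auto
      finally show "(LINT x|lebesgue_on S. F t x) = - (m t * deriv \<theta> t) + l t * \<theta> t" by (simp add: mult.commute)
    qed
    finally have 1: "(LINT t|lebesgue_on ?I. - (m t * deriv \<theta> t) + l t * \<theta> t) = 0" by simp
    have wd: "weak_deriv ?I 1 L (\<lambda>x. l x \<bullet> 1)"
      by (rule weak_deriv_C1) (use DL in \<open>auto intro: continuous_on_subset[OF cl]\<close>)
    have 2: "(LINT t|lebesgue_on ?I. L t * deriv \<theta> t) = - (LINT t|lebesgue_on ?I. l t * \<theta> t)"
      using wd[unfolded weak_deriv_def, rule_format, OF \<theta>0] by (simp add: gd)
    have c: "continuous_on {a..b} (deriv \<theta>)" "continuous_on {a..b} \<theta>"
      using \<theta>(2)[unfolded gd[abs_def]] \<theta>(3) continuous_on_subset by blast+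
    have i: "integrable (lebesgue_on ?I) (\<lambda>t. m t * deriv \<theta> t)" "integrable (lebesgue_on ?I) (\<lambda>t. L t * deriv \<theta> t)"
       "integrable (lebesgue_on ?I) (\<lambda>t. l t * \<theta> t)"
      by (intro ici continuous_intros cm cL cl c)+
    have "(LINT t|lebesgue_on ?I. (m t + L t) * deriv \<theta> t) =
        (LINT t|lebesgue_on ?I. m t * deriv \<theta> t) + (LINT t|lebesgue_on ?I. L t * deriv \<theta> t)"
      using i by (simp add: distrib_right)
    also have "\<dots> = 0" using 1 2 i by simp
    finally show "(LINT t|lebesgue_on ?I. (m t + L t) * deriv \<theta> t) = 0" .
  qed (use st in \<open>auto intro!: continuous_intros cm cL\<close>)
  moreover have "L t - L s = integral {s..t} l"
  proof -
    have "L s + integral {s..t} l = L t" unfolding L_def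
      by (rule Henstock_Kurzweil_Integration.integral_combine)
        (use st in \<open>auto intro!: integrable_continuous_real continuous_on_subset[OF cl]\<close>)
    thus ?thesis by simp
  qed
  ultimately show ?thesis unfolding balance_def m_def l_def[abs_def] by simp
qed

lemma mass_diff:
  assumes "r \<in> {a..b}" "continuous_on (closure S) \<phi>" "continuous_on (closure S) \<psi>"
  shows "mass r \<phi> - mass r \<psi> = (LINT x|lebesgue_on S. u r x * (\<phi> x - \<psi> x))"
  unfolding mass_def using integrable_mass[OF assms(1,2)] integrable_mass[OF assms(1,3)]
  by (simp add: right_diff_distrib)

lemma flux_diff:
  assumes "r \<in> {a..b}" "continuous_on (closure S) \<phi>" "continuous_on (closure S) H"
    "continuous_on (closure S) \<psi>" "continuous_on (closure S) G"
  shows "flux r \<phi> H - flux r \<psi> G = (LINT x|lebesgue_on S. A r x \<bullet> (H x - G x) + B r x * (\<phi> x - \<psi> x))"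
proof -
  have "flux r \<phi> H - flux r \<psi> G = (LINT x|lebesgue_on S. (A r x \<bullet> H x + B r x * \<phi> x) - (A r x \<bullet> G x + B r x * \<psi> x))"
    unfolding flux_def using integrable_flux[OF assms(1,2,3)] integrable_flux[OF assms(1,4,5)] by simp
  thus ?thesis by (simp add: inner_diff_right right_diff_distrib algebra_simps)
qed

text \<open>Mollification changes the function and its gradient uniformly by at most
  \<open>d\<close>, and the fields are bounded on the compact slab, so masses and fluxes change
  little, uniformly in time.\<close>

lemma balance_C1_compact:
  assumes test: "\<And>\<psi>. test_fun S \<psi> \<Longrightarrow> balance s t \<psi> (grad \<psi>)" and st: "a \<le> s" "s \<le> t" "t \<le> b"
    and \<psi>: "\<And>x. GDERIV \<psi> x :> G x" "continuous_on UNIV G" and K: "compact K" "K \<subseteq> S" "\<And>x. x \<notin> K \<Longrightarrow> \<psi> x = 0"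
  shows "balance s t \<psi> G"
proof (rule balance_limit[OF st])
  have c: "continuous_on UNIV \<psi>" using \<psi>(1) by (auto intro!: continuous_at_imp_continuous_on GDERIV_continuous)
  thus c\<psi>: "continuous_on (closure S) \<psi>" and cG: "continuous_on (closure S) G" using \<psi>(2) continuous_on_subset by blast+
  obtain Cu where Cu: "Cu \<ge> 0" "\<And>t x. t \<in> {a..b} \<Longrightarrow> x \<in> closure S \<Longrightarrow> norm (u t x) \<le> Cu" using bounded_field[OF cont_u] by metis
  obtain CA where CA: "CA \<ge> 0" "\<And>t x. t \<in> {a..b} \<Longrightarrow> x \<in> closure S \<Longrightarrow> norm (A t x) \<le> CA" using bounded_field[OF cont_A] by metis
  obtain CB where CB: "CB \<ge> 0" "\<And>t x. t \<in> {a..b} \<Longrightarrow> x \<in> closure S \<Longrightarrow> norm (B t x) \<le> CB" using bounded_field[OF cont_B] by metis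
  define M where "M = measure lebesgue S"
  have M: "M \<ge> 0" by (simp add: M_def)
  fix e :: real assume e: "e > 0"
  define d where "d = e / ((Cu + CA + CB + 1) * (M + 1))"
  have den: "(Cu + CA + CB + 1) * (M + 1) > 0" using Cu(1) CA(1) CB(1) M by (intro mult_pos_pos) auto
  have d: "d > 0" using e den by (simp add: d_def)
  have "(Cu + CA + CB) * d * M \<le> (Cu + CA + CB + 1) * d * (M + 1)"
    using Cu(1) CA(1) CB(1) M d by (intro mult_mono) auto
  also have "\<dots> = e" using den by (simp add: d_def field_simps)
  finally have dM: "(Cu + CA + CB) * d * M \<le> e" .
  obtain \<phi> where \<phi>: "test_fun S \<phi>" "\<And>x. \<bar>\<phi> x - \<psi> x\<bar> \<le> d" "\<And>x. norm (grad \<phi> x - G x) \<le> d"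
  proof (rule mollify[OF open_S K(1,2)])
    fix K' assume "\<And>f e. continuous_on UNIV f \<Longrightarrow> (\<And>x. x \<notin> K \<Longrightarrow> f x = 0) \<Longrightarrow> 0 < e \<Longrightarrow>
      \<exists>\<phi>. test_fun S \<phi> \<and> (\<forall>x. x \<notin> K' \<longrightarrow> \<phi> x = 0) \<and> (\<forall>x. \<bar>\<phi> x - f x\<bar> \<le> e) \<and>
        (\<forall>F. continuous_on UNIV F \<longrightarrow> (\<forall>x. GDERIV f x :> F x) \<longrightarrow> (\<forall>x. norm (grad \<phi> x - F x) \<le> e))"
    from this[OF c K(3) d] show thesis using that \<psi> by blast
  qed
  note t = test_fun_C1[OF \<phi>(1)]
  have c\<phi>: "continuous_on (closure S) \<phi>" "continuous_on (closure S) (grad \<phi>)" using t(2,3) continuous_on_subset by blast+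
  have "\<bar>mass r \<phi> - mass r \<psi>\<bar> \<le> e \<and> \<bar>flux r \<phi> (grad \<phi>) - flux r \<psi> G\<bar> \<le> e" if "r \<in> {s..t}" for r
  proof
    have r: "r \<in> {a..b}" using that st by auto
    have "\<bar>mass r \<phi> - mass r \<psi>\<bar> \<le> (Cu * d) * M"
      unfolding mass_diff[OF r c\<phi>(1) c\<psi>] M_def
    proof (rule abs_integral_le[OF open_S bounded_S])
      fix x assume "x \<in> S"
      thus "\<bar>u r x * (\<phi> x - \<psi> x)\<bar> \<le> Cu * d" unfolding abs_mult
        using Cu(1) Cu(2)[OF r, of x] \<phi>(2)[of x] closure_subset[of S] by (intro mult_mono) auto
    qed (use Cu(1) d in auto)
    also have "\<dots> \<le> (Cu + CA + CB) * d * M" using CA(1) CB(1) d M by (intro mult_right_mono) auto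
    finally show "\<bar>mass r \<phi> - mass r \<psi>\<bar> \<le> e" using dM by linarith
    have "\<bar>flux r \<phi> (grad \<phi>) - flux r \<psi> G\<bar> \<le> (CA * d + CB * d) * M"
      unfolding flux_diff[OF r c\<phi> c\<psi> cG] M_def
    proof (rule abs_integral_le[OF open_S bounded_S])
      fix x assume "x \<in> S"
      hence x: "x \<in> closure S" using closure_subset by blast
      have "\<bar>A r x \<bullet> (grad \<phi> x - G x)\<bar> \<le> norm (A r x) * norm (grad \<phi> x - G x)" by (rule Cauchy_Schwarz_ineq2)
      also have "\<dots> \<le> CA * d" using CA(1) CA(2)[OF r x] \<phi>(3)[of x] by (intro mult_mono) auto
      finally have 1: "\<bar>A r x \<bullet> (grad \<phi> x - G x)\<bar> \<le> CA * d" .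
      have 2: "\<bar>B r x * (\<phi> x - \<psi> x)\<bar> \<le> CB * d" unfolding abs_mult
        using CB(1) CB(2)[OF r x] \<phi>(2)[of x] by (intro mult_mono) auto
      show "\<bar>A r x \<bullet> (grad \<phi> x - G x) + B r x * (\<phi> x - \<psi> x)\<bar> \<le> CA * d + CB * d"
        using 1 2 by linarith
    qed (use CA(1) CB(1) d in auto)
    also have "\<dots> \<le> (Cu + CA + CB) * d * M"
      using Cu(1) d M by (intro mult_right_mono) (auto simp: algebra_simps)
    finally show "\<bar>flux r \<phi> (grad \<phi>) - flux r \<psi> G\<bar> \<le> e" using dM by linarith
  qed
  thus "\<exists>\<phi> H. balance s t \<phi> H \<and> continuous_on (closure S) \<phi> \<and> continuous_on (closure S) H \<and>
      (\<forall>r\<in>{s..t}. \<bar>mass r \<phi> - mass r \<psi>\<bar> \<le> e \<and> \<bar>flux r \<phi> H - flux r \<psi> G\<bar> \<le> e)"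
    using test[OF \<phi>(1)] c\<phi> by blast
qed


lemma balance_cong:
  assumes "\<And>x. x \<in> S \<Longrightarrow> \<phi> x = \<psi> x" "\<And>x. x \<in> S \<Longrightarrow> H x = G x" "balance s t \<phi> H"
  shows "balance s t \<psi> G"
proof -
  have "mass r \<phi> = mass r \<psi>" for r
    unfolding mass_def by (rule Bochner_Integration.integral_cong) (use assms in auto)
  moreover have "flux r \<phi> H = flux r \<psi> G" for r
    unfolding flux_def by (rule Bochner_Integration.integral_cong) (use assms in auto)
  ultimately show ?thesis using assms(3) unfolding balance_def by presburger
qed

lemma balance_sum:
  assumes Y: "finite Y" and st: "a \<le> s" "s \<le> t" "t \<le> b"
    and f: "\<And>y. y \<in> Y \<Longrightarrow> continuous_on (closure S) (f y)" "\<And>y. y \<in> Y \<Longrightarrow> continuous_on (closure S) (F y)"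
    and bal: "\<And>y. y \<in> Y \<Longrightarrow> balance s t (f y) (F y)"
  shows "balance s t (\<lambda>x. \<Sum>y\<in>Y. f y x) (\<lambda>x. \<Sum>y\<in>Y. F y x)"
proof -
  have m: "mass r (\<lambda>x. \<Sum>y\<in>Y. f y x) = (\<Sum>y\<in>Y. mass r (f y))" if "r \<in> {a..b}" for r
    unfolding mass_def sum_distrib_left by (rule Bochner_Integration.integral_sum) (intro integrable_mass that f)
  have fl: "flux r (\<lambda>x. \<Sum>y\<in>Y. f y x) (\<lambda>x. \<Sum>y\<in>Y. F y x) = (\<Sum>y\<in>Y. flux r (f y) (F y))" if "r \<in> {a..b}" for r
    unfolding flux_def sum_distrib_left inner_sum_right sum.distrib[symmetric]
    by (rule Bochner_Integration.integral_sum) (intro integrable_flux that f)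
  have "integral {s..t} (\<lambda>r. flux r (\<lambda>x. \<Sum>y\<in>Y. f y x) (\<lambda>x. \<Sum>y\<in>Y. F y x)) = integral {s..t} (\<lambda>r. \<Sum>y\<in>Y. flux r (f y) (F y))"
    by (rule integral_cong) (use fl st in auto)
  also have "\<dots> = (\<Sum>y\<in>Y. integral {s..t} (\<lambda>r. flux r (f y) (F y)))"
    by (rule Henstock_Kurzweil_Integration.integral_sum[OF Y])
      (use st in \<open>auto intro!: integrable_continuous_real continuous_on_subset[OF continuous_on_flux] f\<close>)
  finally show ?thesis using bal m[of s] m[of t] st
    by (simp add: balance_def sum_subtractf[symmetric] sum_negf[symmetric])
qed

lemma balance_interior_piece:
  assumes test: "\<And>\<psi>. test_fun S \<psi> \<Longrightarrow> balance s t \<psi> (grad \<psi>)" and st: "a \<le> s" "s \<le> t" "t \<le> b"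
    and \<psi>: "\<And>x. x \<in> S \<Longrightarrow> GDERIV \<psi> x :> G x" "continuous_on (closure S) G"
    and K: "compact K" "K \<subseteq> S" "\<And>x. x \<in> S \<Longrightarrow> x \<notin> K \<Longrightarrow> \<psi> x = 0"
  shows "balance s t \<psi> G"
proof (rule balance_cong)
  note ext = C1_extend_zero[OF open_S K(1,2) \<psi>(1) continuous_on_subset[OF \<psi>(2) closure_subset] K(3)]
  show "balance s t (\<lambda>x. if x \<in> S then \<psi> x else 0) (\<lambda>x. if x \<in> S then G x else 0)"
    by (rule balance_C1_compact[OF test st ext(1,2) K(1,2)]) (use K(3) in auto)
qed auto

text \<open>Cutting off with a function of \<open>n \<cdot> chart_fun\<close> costs a gradient of order \<open>n\<close> on a layer of measure
  of order \<open>1 / n\<close>; it points in the normal direction, in which \<open>A\<close> vanishes at the boundary.\<close>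

lemma balance_boundary_piece:
  assumes test: "\<And>\<psi>. test_fun S \<psi> \<Longrightarrow> balance s t \<psi> (grad \<psi>)" and st: "a \<le> s" "s \<le> t" "t \<le> b"
    and ch: "C2_graph_chart S x0 r0 e \<gamma>" and \<rho>: "\<rho> < r0"
    and nm: "\<And>r x. r \<in> {a..b} \<Longrightarrow> x \<in> frontier S \<Longrightarrow> x \<in> ball x0 r0 \<Longrightarrow> A r x \<bullet> grad (chart_fun \<gamma> e) x = 0"
    and \<psi>: "\<And>x. x \<in> S \<Longrightarrow> GDERIV \<psi> x :> G x" "continuous_on (closure S) \<psi>" "continuous_on (closure S) G"
    and z: "\<And>x. x \<in> S \<Longrightarrow> x \<notin> cball x0 \<rho> \<Longrightarrow> \<psi> x = 0 \<and> G x = 0"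
  shows "balance s t \<psi> G"
proof (rule balance_limit[OF st \<psi>(2,3)])
  have e: "norm e = 1" and \<gamma>: "Ck_on 2 UNIV \<gamma>" using ch by (auto simp: C2_graph_chart_def)
  define \<beta> where "\<beta> = chart_fun \<gamma> e"
  note \<beta> = chart_fun_C1[OF \<gamma>, where e=e, folded \<beta>_def]
  define Q where "Q = closure S \<inter> cball x0 \<rho>"
  have Q: "compact Q" using bounded_S by (auto simp: Q_def compact_closure intro!: compact_Int_closed)
  have Qb: "x \<in> ball x0 r0" if "x \<in> Q" for x using that \<rho> by (auto simp: Q_def)
  have Q_le: "\<beta> x \<le> 0" if "x \<in> Q" for x
  proof (cases "x \<in> S")
    case True
    thus ?thesis using chart_inside[OF ch Qb[OF that]] by (simp add: \<beta>_def)
  next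
    case False
    hence "x \<in> frontier S" using that open_S by (simp add: frontier_def interior_open Q_def)
    thus ?thesis using chart_frontier[OF open_S ch Qb[OF that]] by (simp add: \<beta>_def)
  qed
  obtain Cu where Cu: "Cu \<ge> 0" "\<And>t x. t \<in> {a..b} \<Longrightarrow> x \<in> closure S \<Longrightarrow> norm (u t x) \<le> Cu" using bounded_field[OF cont_u] by metis
  have "continuous_on ({a..b} \<times> closure S) (\<lambda>(t, x). \<psi> x)"
    unfolding case_prod_unfold by (rule continuous_on_compose2[OF \<psi>(2)]) (force intro: continuous_intros)+
  then obtain Cp where Cp: "Cp \<ge> 0" "\<And>x. x \<in> closure S \<Longrightarrow> \<bar>\<psi> x\<bar> \<le> Cp"
    using bounded_field[of "\<lambda>t x. \<psi> x"] ab by (metis atLeastAtMost_iff order_refl less_imp_le real_norm_def)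
  have cW: "continuous_on ({a..b} \<times> closure S) (\<lambda>(t, x). A t x \<bullet> G x + B t x * \<psi> x)"
  proof -
    have *: "continuous_on ({a..b} \<times> closure S) (\<lambda>p. \<psi> (snd p))" "continuous_on ({a..b} \<times> closure S) (\<lambda>p. G (snd p))"
      by (rule continuous_on_compose2[OF \<psi>(2)] continuous_on_compose2[OF \<psi>(3)]; force intro: continuous_intros)+
    show ?thesis
      using continuous_on_add[OF continuous_on_inner[OF cont_A *(2)] continuous_on_mult[OF cont_B *(1)]]
      by (simp add: case_prod_unfold)
  qed
  then obtain C1 where C1: "C1 \<ge> 0" "\<And>t x. t \<in> {a..b} \<Longrightarrow> x \<in> closure S \<Longrightarrow> \<bar>A t x \<bullet> G x + B t x * \<psi> x\<bar> \<le> C1"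
    using bounded_field[OF cW] by (metis real_norm_def)
  obtain \<xi> \<xi>' :: "real \<Rightarrow> real" and Cx where \<xi>: "\<And>s. (\<xi> has_real_derivative \<xi>' s) (at s)" "continuous_on UNIV \<xi>'"
    "\<And>s. s \<le> 1/2 \<Longrightarrow> \<xi> s = 0" "\<And>s. s \<ge> 1 \<Longrightarrow> \<xi> s = 1" "\<And>s. 0 \<le> \<xi> s" "\<And>s. \<xi> s \<le> 1"
    "\<And>s. s \<ge> 1 \<Longrightarrow> \<xi>' s = 0" "\<And>s. \<bar>\<xi>' s\<bar> \<le> Cx" "Cx \<ge> 0"
    by (rule cutoff_exists) blast
  have c\<xi>: "continuous_on UNIV \<xi>" using DERIV_isCont[OF \<xi>(1)] by (auto intro!: continuous_at_imp_continuous_on)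
  define V where "V = measure lebesgue (cball x0 (\<rho> + 1))"
  have V: "V \<ge> 0" by (simp add: V_def)
  fix \<epsilon> :: real assume \<epsilon>: "\<epsilon> > 0"
  \<comment> \<open>The gradient of the cutoff contributes at most
    \<open>Cp * (Cx * (n * \<delta>))\<close> on a layer of measure at most \<open>V / n\<close>.
    The factor \<open>n\<close> cancels, so \<open>\<delta>\<close> can be fixed before
    \<open>n\<close>.\<close>
  define \<delta> where "\<delta> = \<epsilon> / (2 * (Cp * Cx * V + 1))"
  have den: "Cp * Cx * V + 1 > 0" using Cp(1) \<xi>(9) V by (intro add_nonneg_pos mult_nonneg_nonneg) auto
  have \<delta>: "\<delta> > 0" "Cp * Cx * V * \<delta> \<le> \<epsilon> / 2" using \<epsilon> den by (auto simp: \<delta>_def field_simps)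
  \<comment> \<open>On the compact set where the normal component of \<open>A\<close> is at least
    \<open>\<delta>\<close> in modulus, the chart function attains a maximum. It is negative, since
    the component vanishes on the boundary.\<close>
  obtain \<eta> where \<eta>: "\<eta> > 0" "\<And>r x. r \<in> {a..b} \<Longrightarrow> x \<in> Q \<Longrightarrow> \<beta> x > - \<eta> \<Longrightarrow> \<bar>A r x \<bullet> grad \<beta> x\<bar> \<le> \<delta>"
  proof -
    define W where "W = {p \<in> {a..b} \<times> Q. \<delta> \<le> \<bar>A (fst p) (snd p) \<bullet> grad \<beta> (snd p)\<bar>}"
    have cQ: "compact ({a..b} \<times> Q)" using Q by (simp add: compact_Times)
    have "continuous_on ({a..b} \<times> Q) (\<lambda>p. \<bar>A (fst p) (snd p) \<bullet> grad \<beta> (snd p)\<bar>)"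
    proof (intro continuous_intros)
      show "continuous_on ({a..b} \<times> Q) (\<lambda>p. A (fst p) (snd p))"
        using continuous_on_subset[OF cont_A, of "{a..b} \<times> Q"] by (auto simp: Q_def case_prod_unfold)
      show "continuous_on ({a..b} \<times> Q) (\<lambda>p. grad \<beta> (snd p))"
        by (rule continuous_on_compose2[OF \<beta>(2)]) (auto intro: continuous_intros)
    qed
    hence "closed ({a..b} \<times> Q \<inter> (\<lambda>p. \<bar>A (fst p) (snd p) \<bullet> grad \<beta> (snd p)\<bar>) -` {\<delta>..})"
      by (rule continuous_closed_preimage[OF _ compact_imp_closed[OF cQ]]) simp
    moreover have "{a..b} \<times> Q \<inter> (\<lambda>p. \<bar>A (fst p) (snd p) \<bullet> grad \<beta> (snd p)\<bar>) -` {\<delta>..} = W"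
      by (auto simp: W_def)
    ultimately have W: "compact W"
      using compact_Int_closed[OF cQ, of W] by (simp add: W_def Int_absorb1 subset_iff)
    show ?thesis
    proof (cases "W = {}")
      case True
      show ?thesis by (rule that[of 1]) (use True in \<open>force simp: W_def\<close>)+
    next
      case False
      have "continuous_on W (\<lambda>p. \<beta> (snd p))"
        by (rule continuous_on_compose2[OF \<beta>(3)[of UNIV]]) (auto intro: continuous_intros)
      then obtain p where p: "p \<in> W" "\<And>q. q \<in> W \<Longrightarrow> \<beta> (snd q) \<le> \<beta> (snd p)"
        using continuous_attains_sup[OF W False] by blast
      have pQ: "fst p \<in> {a..b}" "snd p \<in> Q" using p(1) by (auto simp: W_def)
      have "\<beta> (snd p) \<noteq> 0"
      proof
        assume "\<beta> (snd p) = 0"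
        hence "snd p \<in> frontier S" using chart_frontier[OF open_S ch Qb[OF pQ(2)]] by (simp add: \<beta>_def)
        hence "A (fst p) (snd p) \<bullet> grad \<beta> (snd p) = 0" using nm[OF pQ(1) _ Qb[OF pQ(2)]] by (simp add: \<beta>_def)
        thus False using p(1) \<delta>(1) by (simp add: W_def)
      qed
      hence neg: "\<beta> (snd p) < 0" using Q_le[OF pQ(2)] by simp
      show ?thesis
      proof (rule that[of "- \<beta> (snd p)"])
        show "\<bar>A r x \<bullet> grad \<beta> x\<bar> \<le> \<delta>" if "r \<in> {a..b}" "x \<in> Q" "\<beta> x > - (- \<beta> (snd p))" for r x
          using p(2)[of "(r, x)"] that by (force simp: W_def)
      qed (use neg in simp)
    qed
  qed
  \<comment> \<open>\<open>n0\<close> makes the layer thinner than \<open>\<eta>\<close>;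
    \<open>n1\<close> makes the terms bounded independently of \<open>n\<close>, integrated over the
    layer, at most \<open>\<epsilon> / 2\<close>.\<close>
  obtain n0 :: nat where n0: "1 / \<eta> < real n0" using reals_Archimedean2 by blast
  obtain n1 :: nat where n1: "2 * (C1 + Cu * Cp) * V / \<epsilon> \<le> real n1" using real_arch_simple by blast
  define n where "n = max 1 (max n0 n1)"
  have n: "n \<ge> 1" "1 / real n \<le> \<eta>" "(C1 + Cu * Cp) * (V / n) \<le> \<epsilon> / 2"
  proof -
    show n1': "n \<ge> 1" by (simp add: n_def)
    have "1 / \<eta> \<le> real n" using n0 by (simp add: n_def)
    thus "1 / real n \<le> \<eta>" using \<eta>(1) n1' by (simp add: field_simps)
    have "2 * (C1 + Cu * Cp) * V / \<epsilon> \<le> real n" using n1 by (simp add: n_def)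
    thus "(C1 + Cu * Cp) * (V / n) \<le> \<epsilon> / 2" using \<epsilon> n1' by (simp add: field_simps)
  qed
  define P where "P = {x \<in> cball x0 \<rho>. - 1 / real n < \<beta> x \<and> \<beta> x < 0}"
  note lay = chart_layer_measure[OF e \<gamma> n(1), of x0 \<rho>, folded \<beta>_def, folded P_def V_def]
  have P: "P \<inter> S \<in> sets lebesgue" using lay(1) open_S by auto
  have mP: "measure lebesgue (P \<inter> S) \<le> V / n"
  proof -
    have "measure lebesgue (P \<inter> S) \<le> measure lebesgue P"
      by (rule measure_mono_fmeasurable) (use lay(1) P in \<open>auto intro!: bounded_set_imp_lmeasurable bounded_subset[OF bounded_cball] simp: P_def\<close>)
    also have "\<dots> \<le> V / n" using lay(2) n(1) by (simp add: field_simps)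
    finally show ?thesis .
  qed
  \<comment> \<open>The cutoff is zero where the chart function is at least
    \<open>- 1 / (2 * n)\<close> and one where it is at most \<open>- 1 / n\<close>, so within
    \<open>S\<close> and the ball its gradient lives on the layer \<open>P\<close>.\<close>
  define k where "k x = \<xi> ((- real n) * \<beta> x)" for x
  define k' where "k' x = \<xi>' ((- real n) * \<beta> x) *\<^sub>R ((- real n) *\<^sub>R grad \<beta> x)" for x
  have Dk: "GDERIV k x :> k' x" for x
  proof -
    have "GDERIV (\<lambda>x. (- real n) * \<beta> x) x :> (- real n) *\<^sub>R grad \<beta> x"
      using GDERIV_mult[OF GDERIV_const \<beta>(1), of "- real n" x] by simp
    from GDERIV_DERIV_compose[OF this \<xi>(1)] show ?thesis unfolding k_def k'_def .
  qed
  define \<phi> where "\<phi> x = \<psi> x * k x" for x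
  define H where "H x = \<psi> x *\<^sub>R k' x + k x *\<^sub>R G x" for x
  define K where "K = Q \<inter> {x. \<beta> x \<le> - 1 / (2 * real n)}"
  have K: "compact K" unfolding K_def
    by (rule compact_Int_closed[OF Q]) (intro closed_Collect_le \<beta>(3) continuous_on_const)
  have KS: "K \<subseteq> S"
  proof
    fix x assume x: "x \<in> K"
    have "- 1 / (2 * real n) < 0" using n(1) by simp
    hence "\<beta> x < 0" using x unfolding K_def by (auto intro: order_le_less_trans)
    thus "x \<in> S" using chart_inside[OF ch Qb, of x] x by (simp add: K_def \<beta>_def)
  qed
  have \<phi>K: "\<phi> x = 0" if "x \<in> S" "x \<notin> K" for x
  proof (cases "x \<in> cball x0 \<rho>")
    case True
    hence "x \<in> Q" using that closure_subset by (auto simp: Q_def)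
    hence "\<beta> x > - 1 / (2 * real n)" using that by (simp add: K_def)
    hence "(- real n) * \<beta> x \<le> 1/2" using n(1) by (simp add: field_simps)
    thus ?thesis by (simp add: \<phi>_def k_def \<xi>(3))
  qed (use z[OF that(1)] in \<open>simp add: \<phi>_def\<close>)
  have D\<phi>: "GDERIV \<phi> x :> H x" if "x \<in> S" for x
    unfolding \<phi>_def H_def by (rule GDERIV_mult[OF \<psi>(1)[OF that] Dk])
  have ck: "continuous_on A k" "continuous_on A k'" for A
    unfolding k_def k'_def
    by (intro continuous_intros continuous_on_compose2[OF c\<xi>] continuous_on_compose2[OF \<xi>(2)] \<beta>(3) continuous_on_subset[OF \<beta>(2)]; simp)+
  have cH: "continuous_on (closure S) H" "continuous_on (closure S) \<phi>" unfolding H_def \<phi>_def by (intro continuous_intros ck \<psi>)+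
  have bal: "balance s t \<phi> H"
    by (rule balance_interior_piece[OF test st D\<phi> cH(1) K KS \<phi>K])
  have k1: "k x = 1 \<and> k' x = 0" if "x \<in> S" "x \<in> cball x0 \<rho>" "x \<notin> P" for x
  proof -
    have xQ: "x \<in> Q" using that closure_subset by (auto simp: Q_def)
    have "\<beta> x < 0" using chart_inside[OF ch Qb[OF xQ]] that by (simp add: \<beta>_def)
    hence "\<beta> x \<le> - 1 / real n" using that by (simp add: P_def)
    hence "(- real n) * \<beta> x \<ge> 1" using n(1) by (simp add: field_simps)
    thus ?thesis by (simp add: k_def k'_def \<xi>(4,7))
  qed
  have k01: "\<bar>k x - 1\<bar> \<le> 1" for x using \<xi>(5,6)[of "(- real n) * \<beta> x"] by (simp add: k_def abs_le_iff)
  have "\<bar>mass r \<phi> - mass r \<psi>\<bar> \<le> \<epsilon> \<and> \<bar>flux r \<phi> H - flux r \<psi> G\<bar> \<le> \<epsilon>" if "r \<in> {s..t}" for r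
  proof
    have r: "r \<in> {a..b}" using that st by auto
    have "\<bar>mass r \<phi> - mass r \<psi>\<bar> \<le> (Cu * Cp) * measure lebesgue (P \<inter> S)"
      unfolding mass_diff[OF r cH(2) \<psi>(2)]
    proof (rule abs_integral_le_indicator[OF open_S bounded_S P])
      fix x assume x: "x \<in> S"
      hence xc: "x \<in> closure S" using closure_subset by blast
      show "\<bar>u r x * (\<phi> x - \<psi> x)\<bar> \<le> Cu * Cp * indicator (P \<inter> S) x"
      proof (cases "x \<in> P")
        case True
        have "\<phi> x - \<psi> x = \<psi> x * (k x - 1)" by (simp add: \<phi>_def algebra_simps)
        hence "\<bar>u r x * (\<phi> x - \<psi> x)\<bar> = \<bar>u r x\<bar> * (\<bar>\<psi> x\<bar> * \<bar>k x - 1\<bar>)" by (simp add: abs_mult)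
        also have "\<dots> \<le> Cu * (Cp * 1)"
          using Cu(1) Cu(2)[OF r xc] Cp(1) Cp(2)[OF xc] k01[of x] by (intro mult_mono) auto
        finally show ?thesis using True x by simp
      next
        case False
        have "\<phi> x = \<psi> x" using z[OF x] k1[OF x _ False] by (cases "x \<in> cball x0 \<rho>") (auto simp: \<phi>_def)
        thus ?thesis using Cu(1) Cp(1) by simp
      qed
    qed (use Cu(1) Cp(1) in auto)
    also have "\<dots> \<le> (C1 + Cu * Cp) * (V / n)" using Cu(1) Cp(1) C1(1) V mP by (intro mult_mono) auto
    finally show "\<bar>mass r \<phi> - mass r \<psi>\<bar> \<le> \<epsilon>" using n(3) \<epsilon> by linarith
    have "\<bar>flux r \<phi> H - flux r \<psi> G\<bar> \<le> (C1 + Cp * (Cx * (n * \<delta>))) * measure lebesgue (P \<inter> S)"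
      unfolding flux_diff[OF r cH(2,1) \<psi>(2,3)]
    proof (rule abs_integral_le_indicator[OF open_S bounded_S P])
      fix x assume x: "x \<in> S"
      hence xc: "x \<in> closure S" using closure_subset by blast
      show "\<bar>A r x \<bullet> (H x - G x) + B r x * (\<phi> x - \<psi> x)\<bar> \<le> (C1 + Cp * (Cx * (n * \<delta>))) * indicator (P \<inter> S) x"
      proof (cases "x \<in> P")
        case True
        have xQ: "x \<in> Q" using True xc by (auto simp: Q_def P_def)
        have "\<beta> x > - \<eta>" using True n(2) by (auto simp: P_def)
        hence small: "\<bar>A r x \<bullet> grad \<beta> x\<bar> \<le> \<delta>" using \<eta>(2)[OF r xQ] by simp
        \<comment> \<open>The first term is bounded independently of \<open>n\<close>. Only the
          second carries \<open>n\<close>, and it contains nothing of \<open>A\<close> but the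
          normal component.\<close>
        have "A r x \<bullet> (H x - G x) + B r x * (\<phi> x - \<psi> x) =
            (k x - 1) * (A r x \<bullet> G x + B r x * \<psi> x) + \<psi> x * (\<xi>' ((- real n) * \<beta> x) * ((- real n) * (A r x \<bullet> grad \<beta> x)))"
          by (simp add: H_def \<phi>_def k'_def inner_diff_right inner_add_right algebra_simps)
        also have "\<bar>\<dots>\<bar> \<le> \<bar>k x - 1\<bar> * \<bar>A r x \<bullet> G x + B r x * \<psi> x\<bar> +
            \<bar>\<psi> x\<bar> * (\<bar>\<xi>' ((- real n) * \<beta> x)\<bar> * (real n * \<bar>A r x \<bullet> grad \<beta> x\<bar>))"
          by (rule order_trans[OF abs_triangle_ineq]) (simp add: abs_mult)
        also have "\<dots> \<le> 1 * C1 + Cp * (Cx * (n * \<delta>))"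
          by (intro add_mono mult_mono k01 C1(2)[OF r xc] Cp(2)[OF xc] \<xi>(8) small)
            (use C1(1) Cp(1) \<xi>(9) \<delta>(1) in auto)
        finally show ?thesis using True x by simp
      next
        case False
        have "\<phi> x = \<psi> x \<and> H x = G x" using z[OF x] k1[OF x _ False] by (cases "x \<in> cball x0 \<rho>") (auto simp: \<phi>_def H_def)
        thus ?thesis using C1(1) Cp(1) \<xi>(9) \<delta>(1) by simp
      qed
    qed (use C1(1) Cp(1) \<xi>(9) \<delta>(1) in auto)
    also have "\<dots> \<le> (C1 + Cp * (Cx * (n * \<delta>))) * (V / n)"
      using C1(1) Cp(1) \<xi>(9) \<delta>(1) mP by (intro mult_left_mono) auto
    also have "\<dots> = C1 * (V / n) + Cp * Cx * V * \<delta>" using n(1) by (simp add: field_simps)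
    also have "\<dots> \<le> \<epsilon> / 2 + \<epsilon> / 2"
    proof (rule add_mono)
      have "C1 * (V / n) \<le> (C1 + Cu * Cp) * (V / n)" using Cu(1) Cp(1) V by (intro mult_right_mono) auto
      thus "C1 * (V / n) \<le> \<epsilon> / 2" using n(3) by linarith
    qed (rule \<delta>(2))
    finally show "\<bar>flux r \<phi> H - flux r \<psi> G\<bar> \<le> \<epsilon>" by simp
  qed
  thus "\<exists>\<phi> H. balance s t \<phi> H \<and> continuous_on (closure S) \<phi> \<and> continuous_on (closure S) H \<and>
      (\<forall>r\<in>{s..t}. \<bar>mass r \<phi> - mass r \<psi>\<bar> \<le> \<epsilon> \<and> \<bar>flux r \<phi> H - flux r \<psi> G\<bar> \<le> \<epsilon>)"
    using bal cH by blast
qed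

text \<open>A partition of unity subordinate to interior balls and chart balls reduces the claim to
  the two kinds of pieces. The pieces add up to \<open>\<psi>\<close> in \<open>S\<close>, and
  uniqueness of gradients makes theirs add up to \<open>G\<close>.\<close>

lemma balance_C1_closure:
  assumes test: "\<And>\<psi>. test_fun S \<psi> \<Longrightarrow> balance s t \<psi> (grad \<psi>)" and st: "a \<le> s" "s \<le> t" "t \<le> b"
    and C2: "C2_domain S"
    and nm: "\<And>r x \<rho> e \<gamma>. r \<in> {a..b} \<Longrightarrow> x \<in> frontier S \<Longrightarrow> C2_graph_chart S x \<rho> e \<gamma> \<Longrightarrow>
      A r x \<bullet> grad (chart_fun \<gamma> e) x = 0"
    and \<psi>: "\<And>x. x \<in> S \<Longrightarrow> GDERIV \<psi> x :> G x" "continuous_on (closure S) \<psi>" "continuous_on (closure S) G"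
  shows "balance s t \<psi> G"
proof -
  have "\<exists>\<rho>>0. cball y \<rho> \<subseteq> S \<or> (\<exists>r e \<gamma>. C2_graph_chart S y r e \<gamma> \<and> \<rho> < r)" if "y \<in> closure S" for y
  proof (cases "y \<in> S")
    case True
    thus ?thesis using open_S open_contains_cball by blast
  next
    case False
    hence "y \<in> frontier S" using that open_S by (simp add: frontier_def interior_open)
    then obtain r e \<gamma> where ch: "C2_graph_chart S y r e \<gamma>" using C2 unfolding C2_domain_def by blast
    hence "r > 0" by (simp add: C2_graph_chart_def)
    thus ?thesis using ch by (intro exI[of _ "r / 2"]) force
  qed
  then obtain \<rho> where \<rho>: "\<And>y. y \<in> closure S \<Longrightarrow> \<rho> y > 0"
    "\<And>y. y \<in> closure S \<Longrightarrow> cball y (\<rho> y) \<subseteq> S \<or> (\<exists>r e \<gamma>. C2_graph_chart S y r e \<gamma> \<and> \<rho> y < r)"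
    by metis
  have "compact (closure S)" using bounded_S by (simp add: compact_closure)
  hence C: "compact (closure S)" .
  obtain Y p P where
    Y: "finite Y" "Y \<subseteq> closure S"
    "\<And>y x. y \<in> Y \<Longrightarrow> x \<in> closure S \<Longrightarrow> GDERIV (p y) x :> P y x"
    "\<And>y. y \<in> Y \<Longrightarrow> continuous_on (closure S) (P y)"
    "\<And>y x. y \<in> Y \<Longrightarrow> x \<notin> cball y (\<rho> y) \<Longrightarrow> p y x = 0 \<and> P y x = 0"
    "\<And>x. x \<in> closure S \<Longrightarrow> (\<Sum>y\<in>Y. p y x) = 1"
    by (rule C1_partition_of_unity[OF C, of \<rho>]) (use \<rho>(1) in blast)+
  have cp: "continuous_on (closure S) (p y)" if "y \<in> Y" for y
    using Y(3)[OF that] by (auto intro!: continuous_at_imp_continuous_on GDERIV_continuous)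
  have SC: "x \<in> S \<Longrightarrow> x \<in> closure S" for x using closure_subset by blast
  define f where "f y x = \<psi> x * p y x" for y x
  define F where "F y x = \<psi> x *\<^sub>R P y x + p y x *\<^sub>R G x" for y x
  have cf: "continuous_on (closure S) (f y)" "continuous_on (closure S) (F y)" if "y \<in> Y" for y
    unfolding f_def F_def by (intro continuous_intros \<psi> cp Y(4) that)+
  have Df: "GDERIV (f y) x :> F y x" if "y \<in> Y" "x \<in> S" for y x
    unfolding f_def F_def by (rule GDERIV_mult[OF \<psi>(1)[OF that(2)] Y(3)[OF that(1) SC[OF that(2)]]])
  have fz: "f y x = 0 \<and> F y x = 0" if "y \<in> Y" "x \<notin> cball y (\<rho> y)" for y x
    using Y(5)[OF that] by (simp add: f_def F_def)
  have bal: "balance s t (f y) (F y)" if y: "y \<in> Y" for y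
  proof (cases "cball y (\<rho> y) \<subseteq> S")
    case True
    show ?thesis
      by (rule balance_interior_piece[OF test st Df[OF y] cf(2)[OF y] compact_cball True]) (use fz[OF y] in auto)
  next
    case False
    then obtain r e \<gamma> where ch: "C2_graph_chart S y r e \<gamma>" "\<rho> y < r" using \<rho>(2) y Y(2) by blast
    show ?thesis
    proof (rule balance_boundary_piece[OF test st ch _ Df[OF y] cf[OF y] fz[OF y]])
      show "A q x \<bullet> grad (chart_fun \<gamma> e) x = 0" if "q \<in> {a..b}" "x \<in> frontier S" "x \<in> ball y r" for q x
        by (rule nm[OF that(1,2) chart_recenter[OF ch(1) that(3)]])
    qed
  qed
  show ?thesis
  proof (rule balance_cong[OF _ _ balance_sum[OF Y(1) st cf bal]])
    fix x assume x: "x \<in> S"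
    have eq: "(\<Sum>y\<in>Y. f y x) = \<psi> x" if "x \<in> S" for x
      using Y(6)[OF SC[OF that]] by (simp add: f_def sum_distrib_left[symmetric])
    show "(\<Sum>y\<in>Y. f y x) = \<psi> x" by (rule eq[OF x])
    have "GDERIV (\<lambda>x. \<Sum>y\<in>Y. f y x) x :> (\<Sum>y\<in>Y. F y x)" by (rule GDERIV_sum) (rule Df[OF _ x])
    hence "GDERIV \<psi> x :> (\<Sum>y\<in>Y. F y x)" by (rule GDERIV_transform_open[OF _ open_S x]) (rule eq)
    thus "(\<Sum>y\<in>Y. F y x) = G x" using grad_eq[OF \<psi>(1)[OF x]] grad_eq by metis
  qed
qed

end

section \<open>The energy argument\<close>

text \<open>Tangent inequality for a convex function. In the clipped values \<open>W\<close> and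
  \<open>V\<close> it is \<open>(W - V)\<^sup>2 * (2 * W + V) \<ge> 0\<close>; where
  \<open>W > 0\<close>, passing from \<open>W - V\<close> to \<open>y - z\<close> only enlarges the
  right-hand side.\<close>

lemma convexity_cube_pos_part:
  fixes y z k :: real
  shows "(max 0 (y - k)) ^ 3 / 3 - (max 0 (z - k)) ^ 3 / 3 \<le> (y - z) * (max 0 (y - k))\<^sup>2"
proof -
  define W where "W = max 0 (y - k)"
  define V where "V = max 0 (z - k)"
  have WV: "W \<ge> 0" "V \<ge> 0" by (auto simp: W_def V_def)
  have "0 \<le> (W - V)\<^sup>2 * (2 * W + V) / 3" using WV by simp
  also have "\<dots> = (W - V) * W\<^sup>2 - (W ^ 3 / 3 - V ^ 3 / 3)"
    by (simp add: power2_eq_square power3_eq_cube field_simps)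
  finally have "W ^ 3 / 3 - V ^ 3 / 3 \<le> (W - V) * W\<^sup>2" by simp
  also have "\<dots> \<le> (y - z) * W\<^sup>2"
    by (cases "W = 0") (auto simp: W_def V_def max_def intro!: mult_right_mono split: if_splits)
  finally show ?thesis by (simp add: W_def V_def)
qed

text \<open>Completing the square in \<open>g\<close>: expanding
  \<open>2 * \<kappa>0 * w * (g - M * w / (4 * \<kappa>0))\<^sup>2\<close> leaves the remainder
  \<open>M\<^sup>2 * w ^ 3 / (8 * \<kappa>0)\<close>, a multiple of the energy density
  \<open>w ^ 3 / 3\<close>.\<close>

lemma drift_absorption:
  fixes \<kappa> \<kappa>0 M g w B :: real
  assumes "\<kappa>0 > 0" "\<kappa> \<ge> \<kappa>0" "w \<ge> 0" "g \<ge> 0" "\<bar>B\<bar> \<le> M * g"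
  shows "\<kappa> * (2 * w * g\<^sup>2) + B * w\<^sup>2 \<ge> - (3 * M\<^sup>2 / (8 * \<kappa>0)) * (w ^ 3 / 3)"
proof -
  have "0 \<le> 2 * \<kappa>0 * w * (g - M * w / (4 * \<kappa>0))\<^sup>2" using assms by simp
  also have "\<dots> = \<kappa>0 * (2 * w * g\<^sup>2) - M * g * w\<^sup>2 + 3 * M\<^sup>2 / (8 * \<kappa>0) * (w ^ 3 / 3)"
    using assms(1) by (simp add: power2_eq_square power3_eq_cube field_simps)
  finally have 1: "\<kappa>0 * (2 * w * g\<^sup>2) - M * g * w\<^sup>2 \<ge> - (3 * M\<^sup>2 / (8 * \<kappa>0)) * (w ^ 3 / 3)" by linarith
  have 2: "\<kappa>0 * (2 * w * g\<^sup>2) \<le> \<kappa> * (2 * w * g\<^sup>2)" using assms by (intro mult_right_mono) auto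
  have "- B * w\<^sup>2 \<le> M * g * w\<^sup>2" using assms(5) by (intro mult_right_mono) auto
  with 1 2 show ?thesis by linarith
qed

text \<open>Taking \<open>s = t\<close> or \<open>s' = t\<close> gives the difference quotients from
  the right and from the left; ordered pairs match the form of the balance law.\<close>

lemma DERIV_from_increments:
  fixes E :: "real \<Rightarrow> real"
  assumes t: "a < t" "t < b"
    and inc: "\<And>\<epsilon>. \<epsilon> > 0 \<Longrightarrow> \<exists>\<delta>>0. \<forall>s s'. a < s \<and> s \<le> s' \<and> s' < b \<and> \<bar>s - t\<bar> < \<delta> \<and> \<bar>s' - t\<bar> < \<delta> \<longrightarrow>
      \<bar>E s' - E s - D * (s' - s)\<bar> \<le> \<epsilon> * (s' - s)"
  shows "(E has_real_derivative D) (at t)"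
  unfolding DERIV_def
proof (rule LIM_I)
  fix r :: real assume r: "r > 0"
  obtain \<delta> where \<delta>: "\<delta> > 0" "\<And>s s'. a < s \<Longrightarrow> s \<le> s' \<Longrightarrow> s' < b \<Longrightarrow> \<bar>s - t\<bar> < \<delta> \<Longrightarrow> \<bar>s' - t\<bar> < \<delta> \<Longrightarrow>
      \<bar>E s' - E s - D * (s' - s)\<bar> \<le> r / 2 * (s' - s)" using inc[of "r / 2"] r by auto
  define d where "d = min \<delta> (min (t - a) (b - t))"
  show "\<exists>s>0. \<forall>h. h \<noteq> 0 \<and> norm (h - 0) < s \<longrightarrow> norm ((E (t + h) - E t) / h - D) < r"
  proof (intro exI conjI allI impI)
    show "d > 0" using \<delta> t by (simp add: d_def)
    fix h :: real assume h: "h \<noteq> 0 \<and> norm (h - 0) < d"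
    have "\<bar>E (t + h) - E t - D * h\<bar> \<le> r / 2 * \<bar>h\<bar>"
    proof (cases "h > 0")
      case True
      thus ?thesis using \<delta>(2)[of t "t + h"] h t by (auto simp: d_def \<delta>(1))
    next
      case False
      have "\<bar>E t - E (t + h) - D * (t - (t + h))\<bar> \<le> r / 2 * (t - (t + h))"
        by (rule \<delta>(2)) (use False h t \<delta>(1) in \<open>auto simp: d_def\<close>)
      thus ?thesis using False by (simp add: abs_le_iff)
    qed
    also have "\<dots> < r * \<bar>h\<bar>" using h r by simp
    finally have "\<bar>E (t + h) - E t - D * h\<bar> < r * \<bar>h\<bar>" .
    moreover have "(E (t + h) - E t) / h - D = (E (t + h) - E t - D * h) / h" using h by (simp add: field_simps)
    ultimately show "norm ((E (t + h) - E t) / h - D) < r" using h by (simp add: abs_divide field_simps)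
  qed
qed

text \<open>A scalar statement: the other components of the system are hidden in \<open>B\<close>
  and in its bound by the gradient of \<open>u\<close>. The balance is demanded for
  \<open>a < s\<close> only, so that \<open>a\<close> may be the initial time zero.\<close>

lemma parabolic_upper_bound:
  fixes S :: "'a::euclidean_space set" and u \<kappa> B :: "real \<Rightarrow> 'a \<Rightarrow> real" and Gu :: "real \<Rightarrow> 'a \<Rightarrow> 'a"
  assumes S: "open S" "bounded S" and ab: "a < b"
    and cu: "continuous_on ({a..b} \<times> closure S) (\<lambda>(t, x). u t x)"
    and cG: "continuous_on ({a..b} \<times> closure S) (\<lambda>(t, x). Gu t x)"
    and c\<kappa>: "continuous_on ({a..b} \<times> closure S) (\<lambda>(t, x). \<kappa> t x)"
    and cB: "continuous_on ({a..b} \<times> closure S) (\<lambda>(t, x). B t x)"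
    and G: "\<And>t x. t \<in> {a..b} \<Longrightarrow> x \<in> S \<Longrightarrow> GDERIV (u t) x :> Gu t x"
    and \<kappa>: "\<kappa>0 > 0" "\<And>t x. t \<in> {a..b} \<Longrightarrow> x \<in> S \<Longrightarrow> \<kappa> t x \<ge> \<kappa>0"
    and M: "\<And>t x. t \<in> {a..b} \<Longrightarrow> x \<in> S \<Longrightarrow> \<bar>B t x\<bar> \<le> M * norm (Gu t x)"
    and bal: "\<And>s t \<psi> H. a < s \<Longrightarrow> s \<le> t \<Longrightarrow> t < b \<Longrightarrow> (\<And>x. x \<in> S \<Longrightarrow> GDERIV \<psi> x :> H x) \<Longrightarrow>
       continuous_on (closure S) \<psi> \<Longrightarrow> continuous_on (closure S) H \<Longrightarrow>
       space_time_fields.balance S u B (\<lambda>t x. \<kappa> t x *\<^sub>R Gu t x) s t \<psi> H"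
    and init: "\<And>x. x \<in> S \<Longrightarrow> u a x \<le> k"
    and t: "t \<in> {a..<b}" and x: "x \<in> closure S"
  shows "u t x \<le> k"
proof -
  interpret space_time_fields S u B "\<lambda>t x. \<kappa> t x *\<^sub>R Gu t x" a b
  proof
    show "continuous_on ({a..b} \<times> closure S) (\<lambda>(t, x). \<kappa> t x *\<^sub>R Gu t x)"
      using continuous_on_scaleR[OF c\<kappa> cG] by (simp add: case_prod_unfold)
  qed fact+
  define w where "w t x = max 0 (u t x - k)" for t x
  define \<psi> where "\<psi> t x = (w t x)\<^sup>2" for t x
  define H where "H t x = (2 * w t x) *\<^sub>R Gu t x" for t x
  define E where "E t = (LINT x|lebesgue_on S. w t x ^ 3 / 3)" for t
  have cw: "continuous_on ({a..b} \<times> closure S) (\<lambda>(t, x). w t x)"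
    using cu unfolding w_def case_prod_unfold by (intro continuous_intros) auto
  have cws: "continuous_on (closure S) (w t)" if "t \<in> {a..b}" for t by (rule cont_slice[OF cw that])
  have c\<psi>: "continuous_on (closure S) (\<psi> t)" and cH: "continuous_on (closure S) (H t)" if "t \<in> {a..b}" for t
    unfolding \<psi>_def H_def by (intro continuous_intros cws cont_slice[OF cG] that)+
  have D\<psi>: "GDERIV (\<psi> t) x :> H t x" if "t \<in> {a..b}" "x \<in> S" for t x
  proof -
    have "GDERIV (\<lambda>x. u t x - k) x :> Gu t x"
      using GDERIV_diff[OF G[OF that] GDERIV_const, of k] by simp
    from GDERIV_DERIV_compose[OF this DERIV_max_zero_square] show ?thesis
      unfolding \<psi>_def H_def w_def .
  qed
  have iE: "integrable (lebesgue_on S) (\<lambda>x. w t x ^ 3 / 3)" if "t \<in> {a..b}" for t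
    by (rule integrable_continuous_closure[OF S]) (intro continuous_intros cws that, simp)
  have cE: "continuous_on {a..b} E" unfolding E_def
  proof (rule continuous_on_integral_parameter[OF S compact_Icc])
    show "continuous_on ({a..b} \<times> closure S) (\<lambda>(t, x). w t x ^ 3 / 3)"
      using cw unfolding case_prod_unfold by (intro continuous_intros) auto
  qed
  have conv: "E t - E s \<le> mass t (\<psi> t) - mass s (\<psi> t)" "mass t (\<psi> s) - mass s (\<psi> s) \<le> E t - E s"
    if "s \<in> {a..b}" "t \<in> {a..b}" for s t
  proof -
    have "E t - E s = (LINT x|lebesgue_on S. w t x ^ 3 / 3 - w s x ^ 3 / 3)"
      unfolding E_def using iE that by simp
    also have "\<dots> \<le> (LINT x|lebesgue_on S. u t x * \<psi> t x - u s x * \<psi> t x)"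
      using convexity_cube_pos_part[of "u t _" k "u s _"]
      by (intro integral_mono Bochner_Integration.integrable_diff iE integrable_mass c\<psi> that)
        (simp add: w_def \<psi>_def left_diff_distrib)
    also have "\<dots> = mass t (\<psi> t) - mass s (\<psi> t)"
      unfolding mass_def by (rule Bochner_Integration.integral_diff) (intro integrable_mass c\<psi> that)+
    finally show "E t - E s \<le> mass t (\<psi> t) - mass s (\<psi> t)" .
    have "mass t (\<psi> s) - mass s (\<psi> s) = (LINT x|lebesgue_on S. u t x * \<psi> s x - u s x * \<psi> s x)"
      unfolding mass_def by (rule Bochner_Integration.integral_diff[symmetric]) (intro integrable_mass c\<psi> that)+
    also have "\<dots> \<le> (LINT x|lebesgue_on S. w t x ^ 3 / 3 - w s x ^ 3 / 3)"
    proof (intro integral_mono Bochner_Integration.integrable_diff iE integrable_mass c\<psi> that)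
      fix x
      show "u t x * \<psi> s x - u s x * \<psi> s x \<le> w t x ^ 3 / 3 - w s x ^ 3 / 3"
        using convexity_cube_pos_part[of "u s x" k "u t x"] unfolding w_def \<psi>_def by (simp add: algebra_simps)
    qed
    also have "\<dots> = E t - E s" unfolding E_def using iE that by simp
    finally show "mass t (\<psi> s) - mass s (\<psi> s) \<le> E t - E s" .
  qed
  define m where "m p = flux (fst p) (\<psi> (snd p)) (H (snd p))" for p
  have cm: "continuous_on ({a..b} \<times> {a..b}) m"
    unfolding m_def flux_def
  proof (rule continuous_on_integral_parameter[OF S])
    let ?X = "({a..b} \<times> {a..b}) \<times> closure S"
    have sl: "continuous_on ?X (\<lambda>q. f (fst (fst q)) (snd q))" "continuous_on ?X (\<lambda>q. f (snd (fst q)) (snd q))"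
      if f: "continuous_on ({a..b} \<times> closure S) (\<lambda>(t, x). f t x)" for f :: "real \<Rightarrow> 'a \<Rightarrow> 'b::topological_space"
    proof -
      show "continuous_on ?X (\<lambda>q. f (fst (fst q)) (snd q))"
        using continuous_on_compose2[OF f, of ?X "\<lambda>q. (fst (fst q), snd q)"] by (force intro: continuous_intros)
      show "continuous_on ?X (\<lambda>q. f (snd (fst q)) (snd q))"
        using continuous_on_compose2[OF f, of ?X "\<lambda>q. (snd (fst q), snd q)"] by (force intro: continuous_intros)
    qed
    show "continuous_on ?X (\<lambda>(p, x). (\<kappa> (fst p) x *\<^sub>R Gu (fst p) x) \<bullet> H (snd p) x + B (fst p) x * \<psi> (snd p) x)"
      unfolding case_prod_unfold H_def \<psi>_def
      by (intro continuous_intros sl c\<kappa> cG cB cw)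
  qed (simp add: compact_Times)
  define C where "C = 3 * M\<^sup>2 / (8 * \<kappa>0)"
  have mlow: "m (t, t) \<ge> - C * E t" if "t \<in> {a..b}" for t
  proof -
    have "- C * E t = (LINT x|lebesgue_on S. - C * (w t x ^ 3 / 3))" unfolding E_def by simp
    also have "\<dots> \<le> (LINT x|lebesgue_on S. (\<kappa> t x *\<^sub>R Gu t x) \<bullet> H t x + B t x * \<psi> t x)"
    proof (rule integral_mono)
      show "integrable (lebesgue_on S) (\<lambda>x. - C * (w t x ^ 3 / 3))" using iE[OF that] by (rule integrable_mult_right)
      show "integrable (lebesgue_on S) (\<lambda>x. (\<kappa> t x *\<^sub>R Gu t x) \<bullet> H t x + B t x * \<psi> t x)"
        by (rule integrable_flux[OF that c\<psi>[OF that] cH[OF that]])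
      fix x assume "x \<in> space (lebesgue_on S)"
      hence x: "x \<in> S" by simp
      have "(\<kappa> t x *\<^sub>R Gu t x) \<bullet> H t x = \<kappa> t x * (2 * w t x * (norm (Gu t x))\<^sup>2)"
        by (simp add: H_def power2_norm_eq_inner)
      moreover have "- C * (w t x ^ 3 / 3) \<le> \<kappa> t x * (2 * w t x * (norm (Gu t x))\<^sup>2) + B t x * (w t x)\<^sup>2"
        unfolding C_def by (rule drift_absorption[OF \<kappa>(1) \<kappa>(2)[OF that x] _ norm_ge_zero M[OF that x]]) (simp add: w_def)
      ultimately show "- C * (w t x ^ 3 / 3) \<le> (\<kappa> t x *\<^sub>R Gu t x) \<bullet> H t x + B t x * \<psi> t x"
        by (simp only: \<psi>_def)
    qed
    finally show ?thesis by (simp add: m_def flux_def)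
  qed
  have DE: "(E has_real_derivative - m (t, t)) (at t)" if t: "a < t" "t < b" for t
  proof (rule DERIV_from_increments[OF t])
    fix \<epsilon> :: real assume \<epsilon>: "\<epsilon> > 0"
    have "(t, t) \<in> {a..b} \<times> {a..b}" using t by simp
    then obtain \<delta> where \<delta>: "\<delta> > 0" "\<And>p. p \<in> {a..b} \<times> {a..b} \<Longrightarrow> dist p (t, t) < \<delta> \<Longrightarrow> dist (m p) (m (t, t)) < \<epsilon>"
      using cm \<epsilon> unfolding continuous_on_iff by blast
    have near: "\<bar>m (r, q) - m (t, t)\<bar> \<le> \<epsilon>" if "r \<in> {a..b}" "q \<in> {a..b}" "\<bar>r - t\<bar> < \<delta> / 2" "\<bar>q - t\<bar> < \<delta> / 2" for r q
    proof -
      have "dist (r, q) (t, t) \<le> \<bar>r - t\<bar> + \<bar>q - t\<bar>"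
        using sqrt_sum_squares_le_sum_abs[of "dist r t" "dist q t"] by (simp add: dist_Pair_Pair dist_real_def)
      hence "dist (r, q) (t, t) < \<delta>" using that by linarith
      thus ?thesis using \<delta>(2)[of "(r, q)"] that by (simp add: dist_real_def)
    qed
    show "\<exists>\<delta>>0. \<forall>s s'. a < s \<and> s \<le> s' \<and> s' < b \<and> \<bar>s - t\<bar> < \<delta> \<and> \<bar>s' - t\<bar> < \<delta> \<longrightarrow>
      \<bar>E s' - E s - - m (t, t) * (s' - s)\<bar> \<le> \<epsilon> * (s' - s)"
    proof (intro exI conjI allI impI)
      show "\<delta> / 2 > 0" using \<delta> by simp
      fix s s' assume a: "a < s \<and> s \<le> s' \<and> s' < b \<and> \<bar>s - t\<bar> < \<delta> / 2 \<and> \<bar>s' - t\<bar> < \<delta> / 2"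
      hence ss: "s \<in> {a..b}" "s' \<in> {a..b}" by auto
      have I: "\<bar>mass s' (\<psi> q) - mass s (\<psi> q) + m (t, t) * (s' - s)\<bar> \<le> \<epsilon> * (s' - s)"
        if q: "q \<in> {a..b}" "\<bar>q - t\<bar> < \<delta> / 2" for q
      proof -
        have cf: "continuous_on {s..s'} (\<lambda>r. flux r (\<psi> q) (H q))"
          by (rule continuous_on_subset[OF continuous_on_flux[OF c\<psi>[OF q(1)] cH[OF q(1)]]]) (use ss in auto)
        have "balance s s' (\<psi> q) (H q)" using a q by (intro bal D\<psi> c\<psi> cH) auto
        hence "mass s' (\<psi> q) - mass s (\<psi> q) + m (t, t) * (s' - s) =
            - integral {s..s'} (\<lambda>r. flux r (\<psi> q) (H q) - m (t, t))"
          using a by (subst Henstock_Kurzweil_Integration.integral_diff)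
            (auto simp: balance_def intro!: integrable_continuous_real cf)
        moreover have "norm (integral {s..s'} (\<lambda>r. flux r (\<psi> q) (H q) - m (t, t))) \<le> \<epsilon> * (s' - s)"
        proof (rule integral_bound)
          show "norm (flux r (\<psi> q) (H q) - m (t, t)) \<le> \<epsilon>" if "r \<in> {s..s'}" for r
          proof -
            have "\<bar>r - t\<bar> < \<delta> / 2" using that a unfolding abs_less_iff atLeastAtMost_iff by linarith
            thus ?thesis using near[of r q] that a q by (auto simp: m_def)
          qed
        qed (use a in \<open>auto intro!: continuous_intros cf\<close>)
        ultimately show ?thesis by simp
      qed
      \<comment> \<open>Freezing at \<open>s\<close> bounds the increment of the energy from below,
        freezing at \<open>s'\<close> from above.\<close>
      from I[of s] I[of s'] conv[OF ss] a ss
      show "\<bar>E s' - E s - - m (t, t) * (s' - s)\<bar> \<le> \<epsilon> * (s' - s)"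
        unfolding abs_le_iff by simp
    qed
  qed
  have E0: "E a = 0" unfolding E_def
    using init by (intro Bochner_Integration.integral_eq_zero_AE AE_I2) (auto simp: w_def)
  have tab: "t \<in> {a..b}" using t by auto
  have Enn: "E t \<ge> 0" unfolding E_def by (intro integral_nonneg_AE AE_I2) (simp add: w_def)
  \<comment> \<open>The derivative is known after time \<open>a\<close> only; continuity of
    \<open>E\<close> at \<open>a\<close> brings in the initial value zero.\<close>
  have "exp (- C * t) * E t \<le> exp (- C * a) * E a"
  proof (rule DERIV_nonpos_imp_decreasing_open[of a t "\<lambda>t. exp (- C * t) * E t"])
    show "a \<le> t" using t by simp
    fix s assume s: "a < s" "s < t"
    have "((\<lambda>t. exp (- C * t) * E t) has_real_derivative exp (- C * s) * (- m (s, s) - C * E s)) (at s)"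
      using s t by (auto intro!: derivative_eq_intros DE simp: algebra_simps)
    moreover have "exp (- C * s) * (- m (s, s) - C * E s) \<le> 0"
      using mlow[of s] s t by (intro mult_nonneg_nonpos) auto
    ultimately show "\<exists>y. ((\<lambda>t. exp (- C * t) * E t) has_real_derivative y) (at s) \<and> y \<le> 0" by blast
  next
    show "continuous_on {a..t} (\<lambda>t. exp (- C * t) * E t)"
      by (intro continuous_intros continuous_on_subset[OF cE]) (use t in auto)
  qed
  hence "exp (- C * t) * E t \<le> 0" using E0 by simp
  hence "E t = 0" using Enn by (simp add: mult_le_0_iff)
  hence "AE x in lebesgue_on S. w t x ^ 3 / 3 = 0"
    using integral_nonneg_eq_0_iff_AE[OF iE[OF tab]] unfolding E_def by (simp add: w_def)
  hence "AE x in lborel. x \<in> S \<longrightarrow> w t x ^ 3 / 3 = 0" by (rule AE_lebesgue_on_imp_lborel[OF S(1)])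
  hence "AE x in lborel. x \<in> S \<longrightarrow> w t x = 0" by eventually_elim simp
  hence "w t y = 0" if "y \<in> S" for y
    using continuous_AE_zero[OF S(1) continuous_on_subset[OF cws[OF tab] closure_subset] _ that] by blast
  hence "u t y \<le> k" if "y \<in> S" for y using that by (force simp: w_def max_def split: if_splits)
  thus ?thesis
    by (intro continuous_le_on_closure[OF cont_slice[OF cu tab] x])
qed

section \<open>Roots and compositions\<close>

text \<open>The summands are the leading coefficients in Lagrange's interpolation, at the nodes
  \<open>g i\<close>, of the monic polynomial with roots \<open>z j\<close>. There is one node more
  than the degree, so interpolation reproduces the polynomial, and its leading coefficient is
  one.\<close>

lemma lagrange_leading_coefficient:
  fixes g z :: "nat \<Rightarrow> real"
  assumes I: "finite I" "inj_on g I" and J: "finite J" "card I = Suc (card J)"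
  shows "(\<Sum>i\<in>I. (\<Prod>j\<in>J. g i - z j) / (\<Prod>m\<in>I - {i}. g i - g m)) = 1"
proof -
  define c where "c i = (\<Prod>j\<in>J. g i - z j) / (\<Prod>m\<in>I - {i}. g i - g m)" for i
  define q where "q = (\<Prod>j\<in>J. [:- z j, 1:])"
  define L where "L i = (\<Prod>m\<in>I - {i}. [:- g m, 1:])" for i
  define p where "p = (\<Sum>i\<in>I. smult (c i) (L i))"
  have dq: "degree q = card J" "coeff q (card J) = 1"
  proof -
    show "degree q = card J" unfolding q_def by (subst degree_prod_eq_sum_degree) auto
    moreover have "lead_coeff q = 1" unfolding q_def by (simp add: lead_coeff_prod)
    ultimately show "coeff q (card J) = 1" by simp
  qed
  have dL: "degree (L i) = card J" "coeff (L i) (card J) = 1" if "i \<in> I" for i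
  proof -
    show "degree (L i) = card J" unfolding L_def using that J I
      by (subst degree_prod_eq_sum_degree) (auto simp: card_Diff_singleton)
    moreover have "lead_coeff (L i) = 1" unfolding L_def by (simp add: lead_coeff_prod)
    ultimately show "coeff (L i) (card J) = 1" by simp
  qed
  have "degree p \<le> card J" unfolding p_def
    by (rule degree_sum_le) (use I dL degree_smult_le in \<open>auto intro: order_trans[OF degree_smult_le]\<close>)
  hence deg: "degree (q - p) \<le> card J" using dq(1) by (intro degree_diff_le) auto
  have root: "poly (q - p) (g k) = 0" if k: "k \<in> I" for k
  proof -
    have "poly (L i) (g k) = 0" if "i \<in> I" "i \<noteq> k" for i
      unfolding L_def poly_prod using that k I by (intro prod_zero) auto
    hence "poly p (g k) = (\<Sum>i\<in>I. if i = k then c k * poly (L k) (g k) else 0)"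
      unfolding p_def poly_sum by (intro sum.cong) auto
    also have "\<dots> = c k * poly (L k) (g k)" using I k by simp
    also have "\<dots> = poly q (g k)"
    proof -
      have "(\<Prod>m\<in>I - {k}. g k - g m) \<noteq> 0"
        using I k by (auto simp: inj_on_def)
      thus ?thesis unfolding c_def q_def L_def poly_prod by simp
    qed
    finally show ?thesis by simp
  qed
  have "q - p = 0"
  proof (rule ccontr)
    assume ne: "q - p \<noteq> 0"
    have "card (g ` I) \<le> card {x. poly (q - p) x = 0}"
      by (rule card_mono[OF poly_roots_finite[OF ne]]) (use root in blast)
    also have "\<dots> \<le> degree (q - p)" by (rule card_poly_roots_bound[OF ne])
    also have "\<dots> \<le> card J" by (rule deg)
    finally show False using J(2) card_image[OF I(2)] by simp
  qed
  hence "coeff p (card J) = 1" using dq(2) by simp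
  moreover have "coeff p (card J) = (\<Sum>i\<in>I. c i)" unfolding p_def coeff_sum using dL(2) by simp
  ultimately show ?thesis by (simp add: c_def)
qed

text \<open>Interlacing pairs \<open>z j\<close> with \<open>g j\<close> for \<open>j < i\<close>
  and with \<open>g (j + 1)\<close> for \<open>j \<ge> i\<close>. In each resulting quotient
  numerator and denominator have the same sign.\<close>

lemma composition_pos:
  assumes g: "strict_mono_on {1..N} g" and z: "z \<in> root_region N g" and i: "i \<in> {1..N}"
  shows "composition N g z i > 0"
proof -
  have gm: "g m < g n" if "1 \<le> m" "m < n" "n \<le> N" for m n
    using g that by (auto simp: strict_mono_on_def)
  have gm': "g m \<le> g n" if "1 \<le> m" "m \<le> n" "n \<le> N" for m n
    using gm[of m n] that by (cases "m = n") auto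
  have zz: "g j < z j" "z j < g (j + 1)" if "1 \<le> j" "j < N" for j
    using z that by (auto simp: root_region_def)
  have split1: "{1..N - 1} = {1..<i} \<union> {i..<N}" using i by auto
  have split2: "{1..N} - {i} = {1..<i} \<union> Suc ` {i..<N}" using i by (auto simp: image_Suc_atLeastLessThan)
  have "composition N g z i = (\<Prod>j\<in>{1..<i} \<union> {i..<N}. g i - z j) / (\<Prod>m\<in>{1..<i} \<union> Suc ` {i..<N}. g i - g m)"
    using i unfolding composition_def split1 split2 by simp
  also have "\<dots> = (\<Prod>j\<in>{1..<i}. (g i - z j) / (g i - g j)) * (\<Prod>j\<in>{i..<N}. (g i - z j) / (g i - g (Suc j)))"
  proof -
    have "(\<Prod>m\<in>Suc ` {i..<N}. g i - g m) = (\<Prod>j\<in>{i..<N}. g i - g (Suc j))"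
      by (subst prod.reindex) auto
    moreover have "(\<Prod>m\<in>{1..<i} \<union> Suc ` {i..<N}. g i - g m) =
        (\<Prod>m\<in>{1..<i}. g i - g m) * (\<Prod>m\<in>Suc ` {i..<N}. g i - g m)"
      by (rule prod.union_disjoint) auto
    moreover have "(\<Prod>j\<in>{1..<i} \<union> {i..<N}. g i - z j) = (\<Prod>j\<in>{1..<i}. g i - z j) * (\<Prod>j\<in>{i..<N}. g i - z j)"
      by (rule prod.union_disjoint) auto
    ultimately show ?thesis by (simp only: prod_dividef times_divide_times_eq)
  qed
  also have "\<dots> > 0"
  proof (intro mult_pos_pos prod_pos)
    fix j assume j: "j \<in> {1..<i}"
    have "z j < g i" using zz(2)[of j] gm'[of "j + 1" i] j i by auto
    thus "(g i - z j) / (g i - g j) > 0" using gm[of j i] j i by auto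
  next
    fix j assume j: "j \<in> {i..<N}"
    have "g i < z j" using zz(1)[of j] gm'[of i j] j i by auto
    thus "(g i - z j) / (g i - g (Suc j)) > 0" using gm[of i "Suc j"] j i by (auto intro: divide_neg_neg)
  qed
  finally show ?thesis .
qed

text \<open>The entries are positive with sum one, and \<open>N \<ge> 2\<close> provides a further
  positive entry, so none of them reaches one.\<close>

lemma composition_in_open_simplex:
  assumes N: "N \<ge> 2" and g: "strict_mono_on {1..N} g" and z: "z \<in> root_region N g"
  shows "composition N g z \<in> open_simplex N"
proof -
  have sum1: "(\<Sum>i\<in>{1..N}. composition N g z i) = 1"
    using lagrange_leading_coefficient[of "{1..N}" g "{1..N-1}" z] strict_mono_on_imp_inj_on[OF g] N
    by (simp add: composition_def)
  have "composition N g z i < 1" if i: "i \<in> {1..N}" for i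
  proof -
    obtain k where k: "k \<in> {1..N} - {i}" using N i by (cases "i = 1") (auto intro: that[of 1] that[of 2])
    have "0 < (\<Sum>k\<in>{1..N} - {i}. composition N g z k)"
      by (rule sum_pos) (use k composition_pos[OF g z] in auto)
    thus ?thesis using sum1 sum.remove[of "{1..N}" i "composition N g z"] i by simp
  qed
  thus ?thesis using sum1 composition_pos[OF g z] by (auto simp: open_simplex_def composition_def)
qed

text \<open>The continuous image of a compact box. Coordinates with index outside
  \<open>{1..N-1}\<close> do not affect the composition; pinning them to zero makes the box compact
  in the product topology.\<close>

lemma composition_box_compact:
  assumes N: "N \<ge> 2" and g: "strict_mono_on {1..N} g"
    and ab: "\<And>j. j \<in> {1..N-1} \<Longrightarrow> g j < a j \<and> b j < g (j + 1)"
  obtains K where "compact K" "K \<subseteq> open_simplex N"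
    "\<And>z. (\<And>j. j \<in> {1..N-1} \<Longrightarrow> a j \<le> z j \<and> z j \<le> b j) \<Longrightarrow> composition N g z \<in> K"
proof -
  define Z where "Z = PiE UNIV (\<lambda>j. if j \<in> {1..N-1} then {a j..b j} else {0})"
  have "compactin (product_topology (\<lambda>_. euclidean) UNIV) Z"
    unfolding Z_def by (subst compactin_PiE) (auto simp: compactin_euclidean_iff)
  hence cZ: "compact Z" by (simp add: euclidean_product_topology compactin_euclidean_iff)
  have cont: "continuous_on Z (composition N g)"
  proof (rule continuous_on_coordinatewise_then_product)
    show "continuous_on Z (\<lambda>z. composition N g z i)" for i
      by (cases "i \<in> {1..N}")
        (auto simp: composition_def divide_inverse
          intro!: continuous_on_mult_right continuous_on_prod continuous_on_diff continuous_on_const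
            continuous_on_subset[OF continuous_on_product_coordinates])
  qed
  show ?thesis
  proof
    show "compact (composition N g ` Z)" by (rule compact_continuous_image[OF cont cZ])
    show "composition N g ` Z \<subseteq> open_simplex N"
    proof (rule image_subsetI)
      fix z assume "z \<in> Z"
      hence "z j \<in> (if j \<in> {1..N-1} then {a j..b j} else {0})" for j unfolding Z_def by blast
      hence "a j \<le> z j \<and> z j \<le> b j" if "j \<in> {1..N-1}" for j using that by (metis atLeastAtMost_iff)
      hence "z \<in> root_region N g" using ab by (fastforce simp: root_region_def)
      thus "composition N g z \<in> open_simplex N" by (rule composition_in_open_simplex[OF N g])
    qed
    fix z assume z: "\<And>j. j \<in> {1..N-1} \<Longrightarrow> a j \<le> z j \<and> z j \<le> b j"
    define z' where "z' j = (if j \<in> {1..N-1} then z j else 0)" for j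
    have "composition N g z = composition N g z'" by (auto simp: composition_def z'_def)
    moreover have "z' \<in> Z" unfolding Z_def z'_def using z by auto
    ultimately show "composition N g z \<in> composition N g ` Z" by simp
  qed
qed

text \<open>Interlacing gives \<open>z l < g (l + 1)\<close>, so the roots add up to at most the sum
  of all \<open>g i\<close> except \<open>g 1\<close>, and what is left is at least
  \<open>g 1\<close>. The upper bound comes from positivity of the roots and later yields the
  ellipticity constant.\<close>

lemma lam_bounds:
  assumes N: "N \<ge> 2" and g1: "0 < g 1" and g: "strict_mono_on {1..N} g"
    and z: "z \<in> root_region N g" and j: "j \<in> {1..N-1}"
  shows "0 < lam N g z j" "lam N g z j \<le> (\<Sum>i\<in>{1..N}. g i)"
proof -
  have gpos: "0 < g i" if "i \<in> {1..N}" for i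
    using g1 strict_mono_onD[OF g, of 1 i] that N by (cases "i = 1") auto
  have zz: "g l < z l" "z l < g (l + 1)" if "l \<in> {1..N-1}" for l
    using z that by (auto simp: root_region_def)
  have zpos: "0 < z l" if "l \<in> {1..N-1}" for l
  proof -
    have "l \<in> {1..N}" using that by auto
    thus ?thesis using zz(1)[OF that] gpos[of l] by linarith
  qed
  show "lam N g z j \<le> (\<Sum>i\<in>{1..N}. g i)"
  proof -
    have "0 \<le> (\<Sum>l\<in>{1..N-1} - {j}. z l)" by (intro sum_nonneg less_imp_le zpos) auto
    thus ?thesis by (simp add: lam_def)
  qed
  have "(\<Sum>l\<in>{1..N-1} - {j}. z l) \<le> (\<Sum>l\<in>{1..N-1}. z l)"
    by (rule sum_mono2) (use zpos j in \<open>auto intro: less_imp_le\<close>)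
  also have "\<dots> \<le> (\<Sum>l\<in>{1..N-1}. g (l + 1))"
    by (intro sum_mono less_imp_le zz)
  also have "\<dots> = (\<Sum>i\<in>{2..N}. g i)"
    using N by (intro sum.reindex_bij_witness[of _ "\<lambda>i. i - 1" "\<lambda>l. l + 1"]) auto
  also have "\<dots> = (\<Sum>i\<in>{1..N}. g i) - g 1"
    using sum.atLeast_Suc_atMost[of 1 N g] N by (simp add: numeral_2_eq_2)
  finally show "0 < lam N g z j" using g1 by (simp add: lam_def)
qed

lemma lam_diff:
  assumes "j \<in> {1..N-1}" "k \<in> {1..N-1}"
  shows "lam N g z j - lam N g z k = z j - z k"
  using assms by (simp add: lam_def sum_diff1)

text \<open>The intervals containing the roots are disjoint. Together with \<open>lam_diff\<close>
  this makes the coupling denominators nonzero.\<close>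

lemma roots_distinct:
  assumes g: "strict_mono_on {1..N} g" and z: "z \<in> root_region N g"
    and jk: "j \<in> {1..N-1}" "k \<in> {1..N-1}" "j \<noteq> k"
  shows "z j \<noteq> z k"
proof -
  have lt: "z j < z k" if "j \<in> {1..N-1}" "k \<in> {1..N-1}" "j < k" for j k
  proof -
    have "z j < g (j + 1)" using z that by (auto simp: root_region_def)
    also have "g (j + 1) \<le> g k" using strict_mono_onD[OF g, of "j + 1" k] that by (cases "j + 1 = k") (auto intro: less_imp_le)
    also have "g k < z k" using z that by (auto simp: root_region_def)
    finally show ?thesis .
  qed
  show ?thesis using lt[of j k] lt[of k j] jk by (cases "j < k") auto
qed

section \<open>Continuity in time with values in C1\<close>

text \<open>The increment is split at \<open>(s, y)\<close>: the change of time is controlled by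
  \<open>d s t\<close> uniformly in space, the change of place by continuity at the single time
  \<open>s\<close>.\<close>

lemma continuous_on_product_uniform:
  fixes f :: "'t::metric_space \<Rightarrow> 'a::metric_space \<Rightarrow> 'b::real_normed_vector"
  assumes f: "\<And>t. t \<in> I \<Longrightarrow> continuous_on C (f t)"
    and d: "\<And>s. s \<in> I \<Longrightarrow> (d s \<longlongrightarrow> 0) (at s within I)"
    and le: "\<And>s t x. s \<in> I \<Longrightarrow> t \<in> I \<Longrightarrow> x \<in> C \<Longrightarrow> norm (f t x - f s x) \<le> (d s t :: real)"
  shows "continuous_on (I \<times> C) (\<lambda>(t, x). f t x)"
  unfolding continuous_on_iff
proof (intro ballI allI impI)
  fix p and e :: real assume p: "p \<in> I \<times> C" and e: "e > 0"
  obtain s x where sx: "p = (s, x)" "s \<in> I" "x \<in> C" using p by auto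
  have "\<exists>d1>0. \<forall>t\<in>I. t \<noteq> s \<and> dist t s < d1 \<longrightarrow> dist (d s t) 0 < e / 2"
    using tendstoD[OF d[OF sx(2)], of "e / 2"] e unfolding eventually_at by simp
  then obtain d1 where d1: "d1 > 0" "\<And>t. t \<in> I \<Longrightarrow> t \<noteq> s \<Longrightarrow> dist t s < d1 \<Longrightarrow> d s t < e / 2"
    unfolding dist_real_def by (metis abs_less_iff diff_zero)
  obtain d2 where d2: "d2 > 0" "\<And>y. y \<in> C \<Longrightarrow> dist y x < d2 \<Longrightarrow> dist (f s y) (f s x) < e / 2"
    using f[OF sx(2)] sx(3) e unfolding continuous_on_iff by (metis half_gt_zero_iff)
  show "\<exists>d>0. \<forall>q\<in>I \<times> C. dist q p < d \<longrightarrow> dist ((\<lambda>(t, x). f t x) q) ((\<lambda>(t, x). f t x) p) < e"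
  proof (intro exI conjI ballI impI)
    show "min d1 d2 > 0" using d1 d2 by simp
    fix q assume q: "q \<in> I \<times> C" "dist q p < min d1 d2"
    obtain t y where ty: "q = (t, y)" "t \<in> I" "y \<in> C" using q by auto
    have "dist t s < d1" "dist y x < d2"
      using q(2) dist_fst_le[of q p] dist_snd_le[of q p] by (auto simp: sx ty)
    \<comment> \<open>The limit within \<open>I\<close> at \<open>s\<close> says nothing about the
      value \<open>d s s\<close>, so \<open>t = s\<close> is treated apart.\<close>
    have "dist (f t y) (f s y) < e / 2"
    proof (cases "t = s")
      case False
      thus ?thesis using le[OF sx(2) ty(2,3)] d1(2)[OF ty(2) False \<open>dist t s < d1\<close>] by (simp add: dist_norm)
    qed (use e in simp)
    moreover have "dist (f s y) (f s x) < e / 2" by (rule d2(2)[OF ty(3) \<open>dist y x < d2\<close>])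
    ultimately show "dist ((\<lambda>(t, x). f t x) q) ((\<lambda>(t, x). f t x) p) < e"
      using dist_triangle[of "f t y" "f s x" "f s y"] by (simp add: sx ty)
  qed
qed

text \<open>The C1 norm of the difference of two time slices is a common modulus for values and
  gradients. The bound on gradients, a supremum over \<open>S\<close>, extends to the closure by
  continuity.\<close>

lemma C_time_C1_gradient:
  fixes S :: "'a::euclidean_space set"
  assumes S: "open S" "bounded S" "S \<noteq> {}" and u: "C_time_C1 I S u"
  obtains G where "\<And>t x. t \<in> I \<Longrightarrow> x \<in> S \<Longrightarrow> GDERIV (u t) x :> G t x"
    "continuous_on (I \<times> closure S) (\<lambda>(t, x). u t x)" "continuous_on (I \<times> closure S) (\<lambda>(t, x). G t x)"
proof -
  have "\<forall>t\<in>I. \<exists>G. continuous_on (closure S) (u t) \<and> continuous_on (closure S) G \<and> (\<forall>x\<in>S. GDERIV (u t) x :> G x)"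
    using u by (auto simp: C_time_C1_def C1_closure_def)
  then obtain G where G: "\<And>t. t \<in> I \<Longrightarrow> continuous_on (closure S) (u t)" "\<And>t. t \<in> I \<Longrightarrow> continuous_on (closure S) (G t)"
    "\<And>t x. t \<in> I \<Longrightarrow> x \<in> S \<Longrightarrow> GDERIV (u t) x :> G t x" by metis
  define d where "d s t = C1_norm S (\<lambda>x. u t x - u s x)" for s t
  have dl: "(d s \<longlongrightarrow> 0) (at s within I)" if "s \<in> I" for s
    using u that by (simp add: C_time_C1_def d_def[abs_def])
  have comp: "compact (closure S)" using S by (simp add: compact_closure)
  have bdd: "bdd_above ((\<lambda>x. norm (h x)) ` closure S)" if "continuous_on (closure S) h" for h :: "'a \<Rightarrow> 'c::real_normed_vector"
    by (intro bounded_imp_bdd_above compact_imp_bounded compact_continuous_image continuous_on_norm that comp)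
  have le: "norm (u t x - u s x) \<le> d s t" "norm (G t x - G s x) \<le> d s t"
    if s: "s \<in> I" and t: "t \<in> I" and x: "x \<in> closure S" for s t x
  proof -
    have gr: "grad (\<lambda>x. u t x - u s x) x = G t x - G s x" if "x \<in> S" for x
      by (rule grad_eq[OF GDERIV_diff[OF G(3)[OF t that] G(3)[OF s that]]])
    have b1: "bdd_above ((\<lambda>x. \<bar>u t x - u s x\<bar>) ` closure S)"
      using bdd[OF continuous_on_diff[OF G(1)[OF t] G(1)[OF s]]] by simp
    have b2: "bdd_above ((\<lambda>x. norm (grad (\<lambda>x. u t x - u s x) x)) ` S)"
    proof (rule bdd_above_mono)
      show "bdd_above ((\<lambda>x. norm (G t x - G s x)) ` closure S)"
        by (rule bdd[OF continuous_on_diff[OF G(2)[OF t] G(2)[OF s]]])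
      show "(\<lambda>x. norm (grad (\<lambda>x. u t x - u s x) x)) ` S \<subseteq> (\<lambda>x. norm (G t x - G s x)) ` closure S"
        using gr closure_subset by force
    qed
    \<comment> \<open>A point of \<open>S\<close> shows that both suprema are nonnegative, so each
      is bounded by their sum.\<close>
    obtain x0 where x0: "x0 \<in> S" using S(3) by blast
    hence x0': "x0 \<in> closure S" using closure_subset by blast
    define A1 where "A1 = (SUP x\<in>closure S. \<bar>u t x - u s x\<bar>)"
    define A2 where "A2 = (SUP x\<in>S. norm (grad (\<lambda>x. u t x - u s x) x))"
    have d: "d s t = A1 + A2" by (simp add: d_def C1_norm_def A1_def A2_def)
    have A1: "\<bar>u t x - u s x\<bar> \<le> A1" if "x \<in> closure S" for x unfolding A1_def by (rule cSUP_upper[OF that b1])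
    have A2: "norm (G t x - G s x) \<le> A2" if "x \<in> S" for x
      unfolding A2_def gr[OF that, symmetric] by (rule cSUP_upper[OF that b2])
    have nn: "A1 \<ge> 0" "A2 \<ge> 0" using A1[OF x0'] A2[OF x0] by (auto intro: order_trans[rotated])
    show "norm (u t x - u s x) \<le> d s t" using A1[OF x] nn d by simp
    have "norm (G t x - G s x) \<le> A2"
      by (rule continuous_le_on_closure[OF _ x])
        (auto intro!: continuous_intros G s t A2)
    thus "norm (G t x - G s x) \<le> d s t" using nn d by simp
  qed
  show ?thesis
    by (rule that[OF G(3) continuous_on_product_uniform[OF G(1) dl le(1)] continuous_on_product_uniform[OF G(2) dl le(2)]])
qed

lemma min_on_attained:
  fixes f :: "'a::topological_space \<Rightarrow> real"
  assumes "compact K" "K \<noteq> {}" "continuous_on K f"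
  obtains x where "x \<in> K" "min_on K f = f x" "\<And>y. y \<in> K \<Longrightarrow> f x \<le> f y"
proof -
  obtain x where x: "x \<in> K" "\<And>y. y \<in> K \<Longrightarrow> f x \<le> f y" using continuous_attains_inf[OF assms] by blast
  have "min_on K f = f x" unfolding min_on_def by (rule Least_equality) (use x in auto)
  thus ?thesis using that x by blast
qed

lemma max_on_attained:
  fixes f :: "'a::topological_space \<Rightarrow> real"
  assumes "compact K" "K \<noteq> {}" "continuous_on K f"
  obtains x where "x \<in> K" "max_on K f = f x" "\<And>y. y \<in> K \<Longrightarrow> f y \<le> f x"
proof -
  obtain x where x: "x \<in> K" "\<And>y. y \<in> K \<Longrightarrow> f y \<le> f x" using continuous_attains_sup[OF assms] by blast
  have "max_on K f = f x" unfolding max_on_def by (rule Greatest_equality) (use x in auto)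
  thus ?thesis using that x by blast
qed

section \<open>The maximum principle for the root system\<close>

text \<open>Mass and flux are linear in the three fields, so changing all signs preserves the law.
  Lower bounds for a solution are obtained from this as upper bounds.\<close>

lemma balance_uminus:
  assumes "space_time_fields S u B A a b"
  shows "space_time_fields S (\<lambda>t x. - u t x) (\<lambda>t x. - B t x) (\<lambda>t x. - A t x) a b"
    and "space_time_fields.balance S (\<lambda>t x. - u t x) (\<lambda>t x. - B t x) (\<lambda>t x. - A t x) s t \<psi> H
      \<longleftrightarrow> space_time_fields.balance S u B A s t \<psi> H"
proof -
  interpret space_time_fields S u B A a b by fact
  show m: "space_time_fields S (\<lambda>t x. - u t x) (\<lambda>t x. - B t x) (\<lambda>t x. - A t x) a b"
    using open_S bounded_S ab continuous_on_minus[OF cont_u] continuous_on_minus[OF cont_A] continuous_on_minus[OF cont_B]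
    by unfold_locales (auto simp: case_prod_unfold)
  interpret m: space_time_fields S "\<lambda>t x. - u t x" "\<lambda>t x. - B t x" "\<lambda>t x. - A t x" a b by (rule m)
  have "m.mass r f = - mass r f" for r f by (simp add: m.mass_def mass_def)
  moreover have "m.flux r f F = - flux r f F" for r f F
  proof -
    have "m.flux r f F = (LINT x|lebesgue_on S. - (A r x \<bullet> F x + B r x * f x))"
      by (simp add: m.flux_def)
    thus ?thesis by (simp only: flux_def Bochner_Integration.integral_minus)
  qed
  ultimately show "m.balance s t \<psi> H \<longleftrightarrow> balance s t \<psi> H"
    by (auto simp: m.balance_def balance_def integral_neg)
qed

lemma time_interval_less:
  assumes "t \<in> time_interval T"
  obtains T' where "t < T'" "ereal T' < T"
proof -
  have "ereal t < T" using assms by (simp add: time_interval_def)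
  then obtain T' where "ereal t < ereal T'" "ereal T' < T" using ereal_dense2 by blast
  thus ?thesis using that by simp
qed

text \<open>The initial time is arbitrary and may be zero: the equation is used on strips of
  positive times only, and the values are continuous up to \<open>t1\<close>.\<close>

lemma root_system_max_principle:
  fixes \<Omega> :: "'a::euclidean_space set" and g :: "nat \<Rightarrow> real" and z :: "nat \<Rightarrow> real \<Rightarrow> 'a \<Rightarrow> real"
  assumes N: "N \<ge> 2" and g1: "0 < g 1" and g: "strict_mono_on {1..N} g" and dim: "DIM('a) \<ge> 2"
    and bd: "bounded \<Omega>" and C2: "C2_domain \<Omega>" and p: "p \<ge> 1"
    and zC: "\<And>j. j \<in> {1..N-1} \<Longrightarrow> C_time_C1 (time_interval T) \<Omega> (z j)"
    and zr: "\<And>t x. t \<in> time_interval T \<Longrightarrow> x \<in> closure \<Omega> \<Longrightarrow> (\<lambda>j. z j t x) \<in> root_region N g"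
    and eq: "\<And>\<tau> T' j. 0 < \<tau> \<Longrightarrow> \<tau> < T' \<Longrightarrow> ereal T' < T \<Longrightarrow> j \<in> {1..N-1} \<Longrightarrow>
           root_eq_distr N g {\<tau><..<T'} \<Omega> z j"
    and nd: "\<And>\<tau> T' j. 0 < \<tau> \<Longrightarrow> \<tau> < T' \<Longrightarrow> ereal T' < T \<Longrightarrow> j \<in> {1..N-1} \<Longrightarrow>
           (AE t in lebesgue_on {\<tau><..<T'}. normal_deriv_zero p \<Omega> (z j t))"
    and j: "j \<in> {1..N-1}"
    and t: "t1 \<in> time_interval T" "t2 \<in> time_interval T" "t1 \<le> t2"
  shows "(\<And>x. x \<in> closure \<Omega> \<Longrightarrow> z j t1 x \<le> k) \<Longrightarrow> x \<in> closure \<Omega> \<Longrightarrow> z j t2 x \<le> k"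
    and "(\<And>x. x \<in> closure \<Omega> \<Longrightarrow> k \<le> z j t1 x) \<Longrightarrow> x \<in> closure \<Omega> \<Longrightarrow> k \<le> z j t2 x"
proof -
  let ?I = "time_interval T" and ?J = "{1..N-1}"
  have S: "open \<Omega>" "\<Omega> \<noteq> {}" using C2 by (auto simp: C2_domain_def)
  have "\<forall>j\<in>?J. \<exists>G. (\<forall>t\<in>?I. \<forall>x\<in>\<Omega>. GDERIV (z j t) x :> G t x) \<and>
      continuous_on (?I \<times> closure \<Omega>) (\<lambda>(t, x). z j t x) \<and> continuous_on (?I \<times> closure \<Omega>) (\<lambda>(t, x). G t x)"
    using C_time_C1_gradient[OF S(1) bd S(2) zC] by metis
  then obtain G where GD: "\<And>j t x. j \<in> ?J \<Longrightarrow> t \<in> ?I \<Longrightarrow> x \<in> \<Omega> \<Longrightarrow> GDERIV (z j t) x :> G j t x"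
    and zc: "\<And>j. j \<in> ?J \<Longrightarrow> continuous_on (?I \<times> closure \<Omega>) (\<lambda>(t, x). z j t x)"
    and Gc: "\<And>j. j \<in> ?J \<Longrightarrow> continuous_on (?I \<times> closure \<Omega>) (\<lambda>(t, x). G j t x)" by metis
  have SC: "x \<in> closure \<Omega>" if "x \<in> \<Omega>" for x using that closure_subset by blast
  define \<Lambda> where "\<Lambda> t x = lam N g (\<lambda>l. z l t x)" for t x
  define \<kappa> where "\<kappa> t x = 1 / \<Lambda> t x j" for t x
  define c where "c k t x = (\<Lambda> t x j + \<Lambda> t x k) / (\<Lambda> t x j * \<Lambda> t x k * (\<Lambda> t x j - \<Lambda> t x k))" for k t x
  define B where "B t x = (\<Sum>k\<in>?J - {j}. c k t x * (G j t x \<bullet> G k t x))" for t x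
  have \<Lambda>: "0 < \<Lambda> t x l" "\<Lambda> t x l \<le> (\<Sum>i\<in>{1..N}. g i)" if "t \<in> ?I" "x \<in> closure \<Omega>" "l \<in> ?J" for t x l
    using lam_bounds[OF N g1 g zr[OF that(1,2)] that(3)] by (simp_all add: \<Lambda>_def)
  have \<Lambda>d: "\<Lambda> t x j - \<Lambda> t x l \<noteq> 0" if "t \<in> ?I" "x \<in> closure \<Omega>" "l \<in> ?J - {j}" for t x l
    using lam_diff[of j N l g "\<lambda>l. z l t x"] roots_distinct[OF g zr[OF that(1,2)], of j l] j that by (auto simp: \<Lambda>_def)
  have zc': "continuous_on (?I \<times> closure \<Omega>) (\<lambda>q. z l (fst q) (snd q))" if "l \<in> ?J" for l
    using zc[OF that] by (simp add: case_prod_unfold)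
  have Gc': "continuous_on (?I \<times> closure \<Omega>) (\<lambda>q. G l (fst q) (snd q))" if "l \<in> ?J" for l
    using Gc[OF that] by (simp add: case_prod_unfold)
  have \<Lambda>c: "continuous_on (?I \<times> closure \<Omega>) (\<lambda>q. \<Lambda> (fst q) (snd q) l)" for l
    unfolding \<Lambda>_def lam_def by (intro continuous_intros zc') auto
  have \<kappa>c: "continuous_on (?I \<times> closure \<Omega>) (\<lambda>(t, x). \<kappa> t x)"
    unfolding \<kappa>_def case_prod_unfold
    by (intro continuous_intros \<Lambda>c) (use \<Lambda>(1)[OF _ _ j] in force)
  have cc: "continuous_on (?I \<times> closure \<Omega>) (\<lambda>q. c l (fst q) (snd q))" if l: "l \<in> ?J - {j}" for l
    unfolding c_def
  proof (intro continuous_intros \<Lambda>c ballI)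
    fix q assume "q \<in> ?I \<times> closure \<Omega>"
    hence "fst q \<in> ?I" "snd q \<in> closure \<Omega>" by auto
    thus "\<Lambda> (fst q) (snd q) j * \<Lambda> (fst q) (snd q) l * (\<Lambda> (fst q) (snd q) j - \<Lambda> (fst q) (snd q) l) \<noteq> 0"
      using \<Lambda>(1)[of "fst q" "snd q" j] \<Lambda>(1)[of "fst q" "snd q" l] \<Lambda>d[of "fst q" "snd q" l] j l by auto
  qed
  have Bc: "continuous_on (?I \<times> closure \<Omega>) (\<lambda>(t, x). B t x)"
    unfolding B_def case_prod_unfold by (intro continuous_intros cc Gc' j) auto
  let ?A = "\<lambda>t x. \<kappa> t x *\<^sub>R G j t x"
  have Ac: "continuous_on (?I \<times> closure \<Omega>) (\<lambda>(t, x). ?A t x)"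
    using continuous_on_scaleR[OF \<kappa>c Gc[OF j]] by (simp add: case_prod_unfold)
  have stf: "space_time_fields \<Omega> (z j) B ?A a b" if "a \<in> ?I" "b \<in> ?I" "a < b" for a b
  proof -
    have sub: "{a..b} \<times> closure \<Omega> \<subseteq> ?I \<times> closure \<Omega>"
      using that by (auto simp: time_interval_def intro: order_le_less_trans[of _ "ereal b"])
    show ?thesis
      by unfold_locales (use S bd that(3) continuous_on_subset[OF zc[OF j] sub] continuous_on_subset[OF Ac sub]
        continuous_on_subset[OF Bc sub] in auto)
  qed
  \<comment> \<open>The condition holds at almost every positive time, and the gradient is
    continuous in time. A nonzero normal component at \<open>r\<close> would persist on an interval
    to the right of \<open>r\<close>, which contains good times; looking to the right covers
    \<open>r = 0\<close>.\<close>
  have neumann: "G j r x \<bullet> grad (chart_fun \<gamma> e) x = 0"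
    if r: "r \<in> ?I" and x: "x \<in> frontier \<Omega>" and ch: "C2_graph_chart \<Omega> x \<rho> e \<gamma>" for r x \<rho> e \<gamma>
  proof (rule ccontr)
    assume ne: "G j r x \<bullet> grad (chart_fun \<gamma> e) x \<noteq> 0"
    have xc: "x \<in> closure \<Omega>" using x by (simp add: frontier_def)
    define q where "q r = G j r x \<bullet> grad (chart_fun \<gamma> e) x" for r
    have "continuous_on ?I q" unfolding q_def
      by (intro continuous_intros continuous_on_compose2[OF Gc'[OF j], of ?I "\<lambda>r. (r, x)", simplified])
        (use xc in auto)
    then obtain d where d: "d > 0" "\<And>s. s \<in> ?I \<Longrightarrow> dist s r < d \<Longrightarrow> dist (q s) (q r) < \<bar>q r\<bar>"
      using r ne unfolding continuous_on_iff q_def by (metis zero_less_abs_iff)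
    obtain T' where T': "r < T'" "ereal T' < T" using time_interval_less[OF r] .
    define b where "b = min T' (r + d)"
    have r0: "0 \<le> r" using r by (simp add: time_interval_def)
    have b: "r < b" "b \<le> T'" "b \<le> r + d" using T' d by (auto simp: b_def)
    \<comment> \<open>The strip has to begin at a positive time even if
      \<open>r = 0\<close>.\<close>
    define a where "a = (r + b) / 2"
    have a: "0 < a" "r < a" "a < b" using b r0 by (auto simp: a_def)
    have bT: "ereal b < T" using b(2) T'(2) by (metis ereal_less_eq(3) order_le_less_trans)
    have "AE s in lebesgue_on {a<..<b}. normal_deriv_zero p \<Omega> (z j s)" by (rule nd[OF a(1,3) bT j])
    hence "AE s in lborel. s \<in> {a<..<b} \<longrightarrow> normal_deriv_zero p \<Omega> (z j s)"
      by (rule AE_lebesgue_on_imp_lborel[rotated]) simp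
    hence "\<exists>s. s \<in> {a<..<b} \<and> normal_deriv_zero p \<Omega> (z j s)"
    proof (rule contrapos_pp)
      assume no: "\<nexists>s. s \<in> {a<..<b} \<and> normal_deriv_zero p \<Omega> (z j s)"
      show "\<not> (AE s in lborel. s \<in> {a<..<b} \<longrightarrow> normal_deriv_zero p \<Omega> (z j s))"
      proof
        assume "AE s in lborel. s \<in> {a<..<b} \<longrightarrow> normal_deriv_zero p \<Omega> (z j s)"
        hence "AE s in lborel. s \<notin> {a<..<b}" by eventually_elim (use no in blast)
        hence "{a<..<b} \<in> null_sets lborel" by (subst (asm) AE_iff_null_sets[symmetric]) auto
        thus False using a by (simp add: null_sets_def)
      qed
    qed
    then obtain s where s: "s \<in> {a<..<b}" "normal_deriv_zero p \<Omega> (z j s)" by blast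
    have sI: "s \<in> ?I" using s(1) a bT by (auto simp: time_interval_def intro: order_less_trans[of _ "ereal b"])
    have Gs: "continuous_on (closure \<Omega>) (G j s)"
      by (rule continuous_on_compose2[OF Gc'[OF j], of "closure \<Omega>" "\<lambda>x. (s, x)", simplified])
        (use sI in \<open>auto intro: continuous_intros\<close>)
    have "q s = 0" unfolding q_def
      by (rule neumann_pointwise[OF S(1) bd dim p GD[OF j sI] Gs s(2) ch x])
    moreover have "dist s r < d" using s(1) a b by (auto simp: dist_real_def)
    ultimately show False using d(2)[OF sI] by (simp add: dist_real_def)
  qed
  have bal: "space_time_fields.balance \<Omega> (z j) B ?A s t \<psi> H"
    if st: "0 < s" "s \<le> t" "t \<in> ?I" and \<psi>: "\<And>x. x \<in> \<Omega> \<Longrightarrow> GDERIV \<psi> x :> H x"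
      "continuous_on (closure \<Omega>) \<psi>" "continuous_on (closure \<Omega>) H" for s t \<psi> H
  proof -
    obtain b where b: "t < b" "ereal b < T" using time_interval_less[OF st(3)] .
    \<comment> \<open>The strip from \<open>a\<close> to \<open>b\<close> contains \<open>s\<close>
      and \<open>t\<close> in its interior and begins at a positive time, as the equation
      demands.\<close>
    define a where "a = s / 2"
    have a: "0 < a" "a < s" using st by (auto simp: a_def)
    have abI: "a \<in> ?I" "b \<in> ?I" "a < b"
      using a b st by (auto simp: time_interval_def intro: order_less_trans[of _ "ereal b"])
    interpret space_time_fields \<Omega> "z j" B ?A a b by (rule stf[OF abI])
    have rI: "r \<in> ?I" if "r \<in> {a..b}" for r
      using that a b by (auto simp: time_interval_def intro: order_le_less_trans[of _ "ereal b"])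
    show ?thesis
    proof (rule balance_C1_closure[OF _ _ st(2) _ C2 _ \<psi>])
      show "?A r x \<bullet> grad (chart_fun \<gamma> e) x = 0"
        if "r \<in> {a..b}" "x \<in> frontier \<Omega>" "C2_graph_chart \<Omega> x \<rho> e \<gamma>" for r x \<rho> e \<gamma>
        using neumann[OF rI[OF that(1)] that(2,3)] by simp
      fix \<psi> assume \<psi>: "test_fun \<Omega> \<psi>"
      show "balance s t \<psi> (grad \<psi>)"
      proof (rule balance_test_fun[OF _ \<psi> a(2) st(2) b(1)])
        fix \<phi> :: "real \<times> 'a \<Rightarrow> real" assume \<phi>: "test_fun ({a<..<b} \<times> \<Omega>) \<phi>"
        have "(LINT (t, x)|lebesgue_on ({a<..<b} \<times> \<Omega>). - z j t x * deriv (\<lambda>s. \<phi> (s, x)) t +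
            ?A t x \<bullet> grad (\<lambda>y. \<phi> (t, y)) x + B t x * \<phi> (t, x)) =
          (LINT (t, x)|lebesgue_on ({a<..<b} \<times> \<Omega>).
           (let \<Lambda> = lam N g (\<lambda>l. z l t x) in
              - z j t x * deriv (\<lambda>s. \<phi> (s, x)) t
              + (1 / \<Lambda> j) * (grad (z j t) x \<bullet> grad (\<lambda>y. \<phi> (t, y)) x)
              + (\<Sum>k\<in>{1..N-1} - {j}.
                   (\<Lambda> j + \<Lambda> k) / (\<Lambda> j * \<Lambda> k * (\<Lambda> j - \<Lambda> k)) * (grad (z j t) x \<bullet> grad (z k t) x))
                * \<phi> (t, x)))"
        proof (rule Bochner_Integration.integral_cong[OF refl], clarify)
          fix t x assume "(t, x) \<in> space (lebesgue_on ({a<..<b} \<times> \<Omega>))"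
          hence tx: "t \<in> ?I" "x \<in> \<Omega>" using rI by auto
          \<comment> \<open>Inside the domain the description \<open>grad\<close> yields the chosen
            \<open>G\<close>, so the abstract integrand agrees with that of
            \<open>root_eq_distr\<close>.\<close>
          have gr: "grad (z l t) x = G l t x" if "l \<in> ?J" for l by (rule grad_eq[OF GD[OF that tx]])
          show "- z j t x * deriv (\<lambda>s. \<phi> (s, x)) t + ?A t x \<bullet> grad (\<lambda>y. \<phi> (t, y)) x + B t x * \<phi> (t, x) =
            (let \<Lambda> = lam N g (\<lambda>l. z l t x) in
              - z j t x * deriv (\<lambda>s. \<phi> (s, x)) t
              + (1 / \<Lambda> j) * (grad (z j t) x \<bullet> grad (\<lambda>y. \<phi> (t, y)) x)
              + (\<Sum>k\<in>{1..N-1} - {j}.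
                   (\<Lambda> j + \<Lambda> k) / (\<Lambda> j * \<Lambda> k * (\<Lambda> j - \<Lambda> k)) * (grad (z j t) x \<bullet> grad (z k t) x))
                * \<phi> (t, x))"
          proof -
            have "(\<Sum>k\<in>?J - {j}. (\<Lambda> t x j + \<Lambda> t x k) / (\<Lambda> t x j * \<Lambda> t x k * (\<Lambda> t x j - \<Lambda> t x k)) *
                (grad (z j t) x \<bullet> grad (z k t) x)) = B t x"
              unfolding B_def c_def by (rule sum.cong[OF refl]) (use gr j in auto)
            moreover have "(1 / \<Lambda> t x j) * (grad (z j t) x \<bullet> grad (\<lambda>y. \<phi> (t, y)) x) =
                ?A t x \<bullet> grad (\<lambda>y. \<phi> (t, y)) x"
              by (simp add: gr[OF j] \<kappa>_def)
            ultimately show ?thesis unfolding Let_def \<Lambda>_def[symmetric] by (simp only:)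
          qed
        qed
        also have "\<dots> = 0" using eq[OF a(1) abI(3) b(2) j] \<phi> unfolding root_eq_distr_def by blast
        finally show "(LINT (t, x)|lebesgue_on ({a<..<b} \<times> \<Omega>). - z j t x * deriv (\<lambda>s. \<phi> (s, x)) t +
            ?A t x \<bullet> grad (\<lambda>y. \<phi> (t, y)) x + B t x * \<phi> (t, x)) = 0" .
      qed
    qed (use a b in auto)
  qed
  obtain b where b: "t2 < b" "ereal b < T" using time_interval_less[OF t(2)] .
  have t10: "0 \<le> t1" using t(1) by (simp add: time_interval_def)
  have bI: "b \<in> ?I" "t1 < b" using b t t10 by (auto simp: time_interval_def)
  have rI: "r \<in> ?I" if "r \<in> {t1..b}" for r
    using that t10 b by (auto simp: time_interval_def intro: order_le_less_trans[of _ "ereal b"])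
  have sub: "{t1..b} \<times> closure \<Omega> \<subseteq> ?I \<times> closure \<Omega>" using rI by auto
  note F = stf[OF t(1) bI]
  \<comment> \<open>Each \<open>\<Lambda>\<close> is at most the sum of the \<open>g i\<close>,
    which bounds the diffusion coefficient from below uniformly.\<close>
  define \<kappa>0 where "\<kappa>0 = 1 / (\<Sum>i\<in>{1..N}. g i)"
  obtain x0 where x0: "x0 \<in> closure \<Omega>" using S(2) SC by blast
  have gs: "(\<Sum>i\<in>{1..N}. g i) > 0" using \<Lambda>[OF t(1) x0 j] by linarith
  have \<kappa>0: "\<kappa>0 > 0" "\<And>t x. t \<in> {t1..b} \<Longrightarrow> x \<in> \<Omega> \<Longrightarrow> \<kappa> t x \<ge> \<kappa>0"
    using gs \<Lambda>[OF rI SC j] by (auto simp: \<kappa>0_def \<kappa>_def intro!: divide_left_mono mult_pos_pos)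
  \<comment> \<open>The coefficients \<open>c\<close> may be unbounded on the whole root region;
    along this solution they are continuous on a compact slab, hence bounded there.\<close>
  obtain M where M: "\<And>t x. t \<in> {t1..b} \<Longrightarrow> x \<in> closure \<Omega> \<Longrightarrow> norm (\<Sum>k\<in>?J - {j}. \<bar>c k t x\<bar> * norm (G k t x)) \<le> M"
  proof -
    have "continuous_on ({t1..b} \<times> closure \<Omega>) (\<lambda>(t, x). \<Sum>k\<in>?J - {j}. \<bar>c k t x\<bar> * norm (G k t x))"
      unfolding case_prod_unfold
      by (rule continuous_on_subset[OF _ sub]) (intro continuous_intros cc Gc', auto)
    from space_time_fields.bounded_field[OF F this] that show thesis by metis
  qed
  have MB: "\<bar>B t x\<bar> \<le> M * norm (G j t x)" if "t \<in> {t1..b}" "x \<in> \<Omega>" for t x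
  proof -
    have "\<bar>B t x\<bar> \<le> (\<Sum>k\<in>?J - {j}. \<bar>c k t x * (G j t x \<bullet> G k t x)\<bar>)" unfolding B_def by (rule sum_abs)
    also have "\<dots> \<le> (\<Sum>k\<in>?J - {j}. (\<bar>c k t x\<bar> * norm (G k t x)) * norm (G j t x))"
    proof (rule sum_mono)
      fix k
      have "\<bar>G j t x \<bullet> G k t x\<bar> \<le> norm (G j t x) * norm (G k t x)" by (rule Cauchy_Schwarz_ineq2)
      hence "\<bar>c k t x\<bar> * \<bar>G j t x \<bullet> G k t x\<bar> \<le> \<bar>c k t x\<bar> * (norm (G j t x) * norm (G k t x))"
        by (rule mult_left_mono) simp
      thus "\<bar>c k t x * (G j t x \<bullet> G k t x)\<bar> \<le> (\<bar>c k t x\<bar> * norm (G k t x)) * norm (G j t x)"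
        by (simp add: abs_mult mult.assoc mult.commute mult.left_commute)
    qed
    also have "\<dots> = (\<Sum>k\<in>?J - {j}. \<bar>c k t x\<bar> * norm (G k t x)) * norm (G j t x)" by (rule sum_distrib_right[symmetric])
    also have "\<dots> \<le> M * norm (G j t x)" using M[OF that(1) SC[OF that(2)]] by (intro mult_right_mono) auto
    finally show ?thesis .
  qed
  have c: "continuous_on ({t1..b} \<times> closure \<Omega>) (\<lambda>(t, x). z j t x)" "continuous_on ({t1..b} \<times> closure \<Omega>) (\<lambda>(t, x). G j t x)"
    "continuous_on ({t1..b} \<times> closure \<Omega>) (\<lambda>(t, x). \<kappa> t x)" "continuous_on ({t1..b} \<times> closure \<Omega>) (\<lambda>(t, x). B t x)"
    using continuous_on_subset[OF _ sub] zc[OF j] Gc[OF j] \<kappa>c Bc by blast+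
  show "z j t2 x \<le> k" if init: "\<And>x. x \<in> closure \<Omega> \<Longrightarrow> z j t1 x \<le> k" and x: "x \<in> closure \<Omega>"
  proof (rule parabolic_upper_bound[OF S(1) bd bI(2) c GD[OF j rI] \<kappa>0 MB _ init[OF SC] _ x])
    show "space_time_fields.balance \<Omega> (z j) B ?A s t \<psi> H"
      if "t1 < s" "s \<le> t" "t < b" "\<And>x. x \<in> \<Omega> \<Longrightarrow> GDERIV \<psi> x :> H x"
        "continuous_on (closure \<Omega>) \<psi>" "continuous_on (closure \<Omega>) H" for s t \<psi> H
      by (rule bal) (use that t10 rI in auto)
  qed (use t b in auto)
  show "k \<le> z j t2 x" if init: "\<And>x. x \<in> closure \<Omega> \<Longrightarrow> k \<le> z j t1 x" and x: "x \<in> closure \<Omega>"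
  proof -
    \<comment> \<open>Changing sign turns \<open>B\<close> and the gradient into their negatives and
      leaves \<open>\<kappa>\<close>, \<open>\<kappa>0\<close> and \<open>M\<close> as they
      are.\<close>
    have "- z j t2 x \<le> - k"
    proof (rule parabolic_upper_bound[where \<kappa>=\<kappa> and B="\<lambda>t x. - B t x" and Gu="\<lambda>t x. - G j t x" and M=M and u="\<lambda>t x. - z j t x",
          OF S(1) bd bI(2) _ _ c(3) _ _ \<kappa>0 _ _ _ _ x])
      show "continuous_on ({t1..b} \<times> closure \<Omega>) (\<lambda>(t, x). - z j t x)" "continuous_on ({t1..b} \<times> closure \<Omega>) (\<lambda>(t, x). - G j t x)"
        "continuous_on ({t1..b} \<times> closure \<Omega>) (\<lambda>(t, x). - B t x)"
        using continuous_on_minus[OF c(1)] continuous_on_minus[OF c(2)] continuous_on_minus[OF c(4)]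
        by (simp_all add: case_prod_unfold)
      show "GDERIV (\<lambda>x. - z j t x) x :> - G j t x" if "t \<in> {t1..b}" "x \<in> \<Omega>" for t x
        by (rule GDERIV_minus[OF GD[OF j rI[OF that(1)] that(2)]])
      show "\<bar>- B t x\<bar> \<le> M * norm (- G j t x)" if "t \<in> {t1..b}" "x \<in> \<Omega>" for t x using MB[OF that] by simp
      show "space_time_fields.balance \<Omega> (\<lambda>t x. - z j t x) (\<lambda>t x. - B t x) (\<lambda>t x. \<kappa> t x *\<^sub>R - G j t x) s t \<psi> H"
        if "t1 < s" "s \<le> t" "t < b" "\<And>x. x \<in> \<Omega> \<Longrightarrow> GDERIV \<psi> x :> H x"
          "continuous_on (closure \<Omega>) \<psi>" "continuous_on (closure \<Omega>) H" for s t \<psi> H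
      proof -
        have "space_time_fields.balance \<Omega> (z j) B ?A s t \<psi> H" by (rule bal) (use that t10 rI in auto)
        thus ?thesis using balance_uminus(2)[OF F] by simp
      qed
      show "- z j t1 x \<le> - k" if "x \<in> \<Omega>" for x using init[OF SC[OF that]] by simp
    qed (use t b in auto)
    thus ?thesis by simp
  qed
qed

theorem theorem6p1:
  fixes \<Omega> :: "(real ^ 'd) set"
    and N :: nat
    and g a b :: "nat \<Rightarrow> real"
    and T :: ereal
    and p :: real
    and z :: "nat \<Rightarrow> real \<Rightarrow> real ^ 'd \<Rightarrow> real"
  assumes "N \<ge> 2" and "0 < g 1" and "strict_mono_on {1..N} g"
    and "CARD('d) \<ge> 2"
    and "bounded \<Omega>" and "C2_domain \<Omega>"
    and "0 < T"
    and "\<And>j. j \<in> {1..N-1} \<Longrightarrow> C_time_C1 (time_interval T) \<Omega> (z j)"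
    and "\<And>t x. t \<in> time_interval T \<Longrightarrow> x \<in> closure \<Omega> \<Longrightarrow> (\<lambda>j. z j t x) \<in> root_region N g"
    and "p > real CARD('d) + 2"
    and "\<And>\<tau> T' j. 0 < \<tau> \<Longrightarrow> \<tau> < T' \<Longrightarrow> ereal T' < T \<Longrightarrow> j \<in> {1..N-1} \<Longrightarrow>
           W1p_time_Lp p {\<tau><..<T'} \<Omega> (z j) \<and> Lp_time_sobolev 2 p {\<tau><..<T'} \<Omega> (z j)"
    and "\<And>\<tau> T' j. 0 < \<tau> \<Longrightarrow> \<tau> < T' \<Longrightarrow> ereal T' < T \<Longrightarrow> j \<in> {1..N-1} \<Longrightarrow>
           root_eq_distr N g {\<tau><..<T'} \<Omega> z j"
    and "\<And>\<tau> T' j. 0 < \<tau> \<Longrightarrow> \<tau> < T' \<Longrightarrow> ereal T' < T \<Longrightarrow> j \<in> {1..N-1} \<Longrightarrow>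
           (AE t in lebesgue_on {\<tau><..<T'}. normal_deriv_zero p \<Omega> (z j t))"
    and "\<And>j. j \<in> {1..N-1} \<Longrightarrow> g j < a j \<and> a j \<le> b j \<and> b j < g (j + 1)"
    and "\<And>j x. j \<in> {1..N-1} \<Longrightarrow> x \<in> closure \<Omega> \<Longrightarrow> a j \<le> z j 0 x \<and> z j 0 x \<le> b j"
  shows "(\<forall>t\<in>time_interval T. \<forall>x\<in>closure \<Omega>. \<forall>j\<in>{1..N-1}. a j \<le> z j t x \<and> z j t x \<le> b j)
    \<and> (\<forall>t1\<in>time_interval T. \<forall>t2\<in>time_interval T. t1 \<le> t2 \<longrightarrow> (\<forall>j\<in>{1..N-1}.
          g j < min_on (closure \<Omega>) (z j t1)
        \<and> min_on (closure \<Omega>) (z j t1) \<le> min_on (closure \<Omega>) (z j t2)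
        \<and> min_on (closure \<Omega>) (z j t2) \<le> max_on (closure \<Omega>) (z j t2)
        \<and> max_on (closure \<Omega>) (z j t2) \<le> max_on (closure \<Omega>) (z j t1)
        \<and> max_on (closure \<Omega>) (z j t1) < g (j + 1)))
    \<and> (\<forall>j\<in>{1..N-1}. antimono_on (time_interval T)
          (\<lambda>t. max_on (closure \<Omega>) (z j t) - min_on (closure \<Omega>) (z j t)))
    \<and> (\<exists>K. compact K \<and> K \<subseteq> open_simplex N
        \<and> (\<forall>t\<in>time_interval T. \<forall>x\<in>closure \<Omega>. composition N g (\<lambda>j. z j t x) \<in> K))"
proof -
  let ?I = "time_interval T" and ?C = "closure \<Omega>"
  have dim: "DIM(real ^ 'd) \<ge> 2" using assms(4) by simp
  have p1: "p \<ge> 1" using assms(10) by linarith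
  have up: "z j t2 x \<le> k" if "j \<in> {1..N-1}" "t1 \<in> ?I" "t2 \<in> ?I" "t1 \<le> t2"
    "\<And>x. x \<in> ?C \<Longrightarrow> z j t1 x \<le> k" "x \<in> ?C" for j t1 t2 x k
    by (rule root_system_max_principle(1)[where T=T, OF assms(1-3) dim assms(5,6) p1]; fact assms that)
  have low: "k \<le> z j t2 x" if "j \<in> {1..N-1}" "t1 \<in> ?I" "t2 \<in> ?I" "t1 \<le> t2"
    "\<And>x. x \<in> ?C \<Longrightarrow> k \<le> z j t1 x" "x \<in> ?C" for j t1 t2 x k
    by (rule root_system_max_principle(2)[where T=T, OF assms(1-3) dim assms(5,6) p1]; fact assms that)
  have I0: "0 \<in> ?I" using assms(7) by (simp add: time_interval_def zero_ereal_def)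
  have Cne: "compact ?C" "?C \<noteq> {}" using assms(5,6) by (auto simp: compact_closure C2_domain_def)
  have cz: "continuous_on ?C (z j t)" if "j \<in> {1..N-1}" "t \<in> ?I" for j t
    using assms(8)[OF that(1)] that(2) by (auto simp: C_time_C1_def C1_closure_def)
  have zr: "g j < z j t x" "z j t x < g (j + 1)" if "j \<in> {1..N-1}" "t \<in> ?I" "x \<in> ?C" for j t x
    using assms(9)[OF that(2,3)] that(1) by (auto simp: root_region_def)
  \<comment> \<open>The initial time is zero, and the levels are \<open>a j\<close> and
    \<open>b j\<close>.\<close>
  have box: "a j \<le> z j t x \<and> z j t x \<le> b j" if "t \<in> ?I" "x \<in> ?C" "j \<in> {1..N-1}" for t x j
  proof -
    have "0 \<le> t" using that(1) by (simp add: time_interval_def)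
    thus ?thesis
      using low[OF that(3) I0 that(1) _ _ that(2), of "a j"] up[OF that(3) I0 that(1) _ _ that(2), of "b j"]
        assms(15)[OF that(3)] by blast
  qed
  have ext: "g j < min_on ?C (z j t1) \<and> min_on ?C (z j t1) \<le> min_on ?C (z j t2)
        \<and> min_on ?C (z j t2) \<le> max_on ?C (z j t2) \<and> max_on ?C (z j t2) \<le> max_on ?C (z j t1)
        \<and> max_on ?C (z j t1) < g (j + 1)"
    if t: "t1 \<in> ?I" "t2 \<in> ?I" "t1 \<le> t2" and j: "j \<in> {1..N-1}" for t1 t2 j
  proof -
    obtain l1 where l1: "l1 \<in> ?C" "min_on ?C (z j t1) = z j t1 l1" "\<And>y. y \<in> ?C \<Longrightarrow> z j t1 l1 \<le> z j t1 y"
      using min_on_attained[OF Cne cz[OF j t(1)]] by metis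
    obtain l2 where l2: "l2 \<in> ?C" "min_on ?C (z j t2) = z j t2 l2" "\<And>y. y \<in> ?C \<Longrightarrow> z j t2 l2 \<le> z j t2 y"
      using min_on_attained[OF Cne cz[OF j t(2)]] by metis
    obtain h1 where h1: "h1 \<in> ?C" "max_on ?C (z j t1) = z j t1 h1" "\<And>y. y \<in> ?C \<Longrightarrow> z j t1 y \<le> z j t1 h1"
      using max_on_attained[OF Cne cz[OF j t(1)]] by metis
    obtain h2 where h2: "h2 \<in> ?C" "max_on ?C (z j t2) = z j t2 h2" "\<And>y. y \<in> ?C \<Longrightarrow> z j t2 y \<le> z j t2 h2"
      using max_on_attained[OF Cne cz[OF j t(2)]] by metis
    \<comment> \<open>The level is now the minimum attained at time \<open>t1\<close> itself, which
      gives monotonicity and not just the initial bounds.\<close>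
    have "z j t1 l1 \<le> z j t2 l2" by (rule low[OF j t l1(3) l2(1)])
    moreover have "z j t2 h2 \<le> z j t1 h1" by (rule up[OF j t h1(3) h2(1)])
    ultimately show ?thesis
      using zr(1)[OF j t(1) l1(1)] zr(2)[OF j t(1) h1(1)] h2(3)[OF l2(1)] by (simp add: l1(2) l2(2) h1(2) h2(2))
  qed
  obtain K where K: "compact K" "K \<subseteq> open_simplex N"
    "\<And>z. (\<And>j. j \<in> {1..N-1} \<Longrightarrow> a j \<le> z j \<and> z j \<le> b j) \<Longrightarrow> composition N g z \<in> K"
    using composition_box_compact[OF assms(1,3), of a b] assms(14) by metis
  have anti: "antimono_on ?I (\<lambda>t. max_on ?C (z j t) - min_on ?C (z j t))" if "j \<in> {1..N-1}" for j
  proof (rule monotone_onI)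
    fix t1 t2 assume "t1 \<in> ?I" "t2 \<in> ?I" "t1 \<le> t2"
    from ext[OF this that] show "max_on ?C (z j t2) - min_on ?C (z j t2) \<le> max_on ?C (z j t1) - min_on ?C (z j t1)"
      by linarith
  qed
  have "\<forall>t\<in>?I. \<forall>x\<in>?C. composition N g (\<lambda>j. z j t x) \<in> K"
  proof (intro ballI)
    fix t x assume "t \<in> ?I" "x \<in> ?C"
    thus "composition N g (\<lambda>j. z j t x) \<in> K" by (intro K(3) box)
  qed
  thus ?thesis using box ext anti K(1,2) by blast
qed

end
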